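(* There is a polynomial-time algorithm that, given an instance $(V,\mathcal{R},k)$ of \textsc{Dense Rooted Triplet Inconsistency} (\textsc{$k$-dense RTI}), outputs an equivalent instance $(V',\mathcal{R}',k')$ of \textsc{$k$-dense RTI} with $k'\le k$ and $|V'|\le 5k$. That is, \textsc{$k$-dense RTI} admits a kernel with at most $5k$ vertices (leaves).
   Context: A rooted triplet on a set $\{a,b,c\}$ is a rooted binary tree with leaf set $\{a,b,c\}$; $ab|c$ denotes the one in which $a,b$ are siblings below a child of the root and $c$ is the other child of the root. A set $\mathcal{R}$ of rooted triplets on $V$ is dense if it contains exactly one rooted triplet on each 3-element subset of $V$. For a rooted binary tree $T$ whose leaves are in bijection with $V$ and $S\subseteq V$, $T_{|S}$ is the rooted binary tree on $S$ homeomorphic to the subtree of $T$ spanning $S$; a triplet $t$ on $\{a,b,c\}$ is consistent with $T$ if $T_{|\{a,b,c\}}=t$. \textsc{$k$-dense RTI}: given a finite set $V$, a dense set $\mathcal{R}$ of rooted triplets on $V$ and an integer $k$, decide whether there is a rooted binary tree over $V$ with which all but at most $k$ triplets of $\mathcal{R}$ are consistent. Two instances are equivalent if one is a yes-instance iff the other is.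
   Formalization: For negative k the bound |V'| ≤ 5k cannot hold, so it is replaced by |V'| ≤ 5·max(0,k), i.e. V' is empty; for k ≥ 0 it is exactly 5k. As k' is an integer, it may be negative, which no-instances with k = 0 require. *)

theory Defs
  imports "HOL-Library.Uprod" "HOL-Computational_Algebra.Polynomial"
begin

section \<open>Rooted binary trees\<close>

text \<open>
  The two children of a node form an unordered pair, so two leaf-labelled trees are
  isomorphic (by an isomorphism that fixes the leaf labels) iff they are equal.
\<close>

datatype 'a rtree = Leaf 'a | Node "'a rtree uprod"

inductive binary_tree_on :: "'a set \<Rightarrow> 'a rtree \<Rightarrow> bool" where
  Leaf: "binary_tree_on {a} (Leaf a)"
| Node: "binary_tree_on A l \<Longrightarrow> binary_tree_on B r \<Longrightarrow> A \<inter> B = {} \<Longrightarrow>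
         binary_tree_on (A \<union> B) (Node (Upair l r))"

text \<open>
  Restriction to a set of leaves: \<^term>\<open>None\<close> is the empty tree, and a node one of whose
  subtrees contains none of the leaves is suppressed.
\<close>

fun join :: "'a rtree option \<Rightarrow> 'a rtree option \<Rightarrow> 'a rtree option" where
  "join None t = t"
| "join t None = t"
| "join (Some l) (Some r) = Some (Node (Upair l r))"

lemma join_commute: "join s t = join t s"
  by (cases s; cases t) auto

lift_definition join_commuting :: "('a rtree option, 'a rtree option) commute" is join
  by (simp add: join_commute)

primrec restrict_tree :: "'a set \<Rightarrow> 'a rtree \<Rightarrow> 'a rtree option" where
  "restrict_tree S (Leaf a) = (if a \<in> S then Some (Leaf a) else None)"
| "restrict_tree S (Node u) = case_uprod join_commuting (map_uprod (restrict_tree S) u)"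

lemma restrict_tree_Node_Upair:
  "restrict_tree S (Node (Upair l r)) = join (restrict_tree S l) (restrict_tree S r)"
  by (simp add: join_commuting.rep_eq)

section \<open>Dense rooted triplet inconsistency\<close>

definition rooted_triplet_on :: "'a set \<Rightarrow> 'a rtree \<Rightarrow> bool" where
  "rooted_triplet_on S t \<longleftrightarrow> card S = 3 \<and> binary_tree_on S t"

text \<open>The triplet written $ab|c$.\<close>

definition triplet :: "'a \<Rightarrow> 'a \<Rightarrow> 'a \<Rightarrow> 'a rtree" where
  "triplet a b c = Node (Upair (Node (Upair (Leaf a) (Leaf b))) (Leaf c))"

definition dense_triplets :: "'a set \<Rightarrow> 'a rtree set \<Rightarrow> bool" where
  "dense_triplets V R \<longleftrightarrow>
     (\<forall>t\<in>R. \<exists>S\<subseteq>V. rooted_triplet_on S t) \<and>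
     (\<forall>S\<subseteq>V. card S = 3 \<longrightarrow> (\<exists>!t. t \<in> R \<and> rooted_triplet_on S t))"

definition dense_rti_instance :: "'a set \<Rightarrow> 'a rtree set \<Rightarrow> int \<Rightarrow> bool" where
  "dense_rti_instance V R k \<longleftrightarrow> finite V \<and> dense_triplets V R"

text \<open>
  A tree over \<open>V\<close> is \<^term>\<open>None\<close>, the empty tree, if \<open>V\<close> is empty.
\<close>

fun tree_over :: "'a set \<Rightarrow> 'a rtree option \<Rightarrow> bool" where
  "tree_over V None \<longleftrightarrow> V = {}"
| "tree_over V (Some T) \<longleftrightarrow> binary_tree_on V T"

definition consistent :: "'a rtree \<Rightarrow> 'a rtree option \<Rightarrow> bool" where
  "consistent t T \<longleftrightarrow> Option.bind T (restrict_tree (set_rtree t)) = Some t"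

definition dense_rti_yes :: "'a set \<Rightarrow> 'a rtree set \<Rightarrow> int \<Rightarrow> bool" where
  "dense_rti_yes V R k \<longleftrightarrow>
     (\<exists>T. tree_over V T \<and> int (card {t \<in> R. \<not> consistent t T}) \<le> k)"

lemma binary_tree_on_finite: "binary_tree_on S t \<Longrightarrow> finite S \<and> S \<noteq> {}"
  by (induction rule: binary_tree_on.induct) auto

lemma set_rtree_Node_Upair [simp]:
  "set_rtree (Node (Upair l r)) = set_rtree l \<union> set_rtree r"
  by simp

lemma binary_tree_on_set_rtree: "binary_tree_on S t \<Longrightarrow> S = set_rtree t"
  by (induction rule: binary_tree_on.induct) auto

lemma binary_tree_on_card_1:
  assumes "binary_tree_on S t" "card S = 1"
  shows "\<exists>a. S = {a} \<and> t = Leaf a"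
  using assms
proof (cases rule: binary_tree_on.cases)
  case (Node A l B r)
  then have "card A + card B = 1"
    using assms(2) by (metis binary_tree_on_finite card_Un_disjoint)
  moreover have "card A \<noteq> 0" "card B \<noteq> 0"
    using binary_tree_on_finite[OF Node(3)] binary_tree_on_finite[OF Node(4)] by simp_all
  ultimately show ?thesis by linarith
qed auto

lemma binary_tree_on_card_2:
  assumes "binary_tree_on S t" "card S = 2"
  shows "\<exists>a b. a \<noteq> b \<and> S = {a, b} \<and> t = Node (Upair (Leaf a) (Leaf b))"
  using assms
proof (cases rule: binary_tree_on.cases)
  case (Node A l B r)
  then have "card A + card B = 2" "card A \<noteq> 0" "card B \<noteq> 0"
    using assms(2) binary_tree_on_finite[OF Node(3)] binary_tree_on_finite[OF Node(4)]
    by (simp_all add: card_Un_disjoint)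
  then have "card A = 1" "card B = 1" by linarith+
  then obtain a b where "A = {a}" "l = Leaf a" "B = {b}" "r = Leaf b"
    using Node(3,4) binary_tree_on_card_1 by meson
  then show ?thesis using Node by auto
qed auto

text \<open>The rooted triplets on a 3-element set are exactly the trees $ab|c$.\<close>

lemma rooted_triplet_on_iff:
  "rooted_triplet_on S t \<longleftrightarrow>
     (\<exists>a b c. distinct [a, b, c] \<and> S = {a, b, c} \<and> t = triplet a b c)"
proof
  assume "rooted_triplet_on S t"
  then have t: "binary_tree_on S t" and S: "card S = 3"
    by (auto simp: rooted_triplet_on_def)
  from t show "\<exists>a b c. distinct [a, b, c] \<and> S = {a, b, c} \<and> t = triplet a b c"
  proof (cases rule: binary_tree_on.cases)
    case (Leaf a)
    then show ?thesis using S by simp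
  next
    case (Node A l B r)
    then have "card A + card B = 3" "card A \<noteq> 0" "card B \<noteq> 0"
      using S binary_tree_on_finite[OF Node(3)] binary_tree_on_finite[OF Node(4)]
      by (simp_all add: card_Un_disjoint)
    then consider "card A = 2 \<and> card B = 1" | "card A = 1 \<and> card B = 2" by linarith
    then show ?thesis
    proof cases
      case 1
      then obtain a b c where "a \<noteq> b" "A = {a, b}" "l = Node (Upair (Leaf a) (Leaf b))"
        "B = {c}" "r = Leaf c"
        using Node(3,4) binary_tree_on_card_1 binary_tree_on_card_2 by meson
      then have "distinct [a, b, c]" "S = {a, b, c}" "t = triplet a b c"
        using Node by (auto simp: triplet_def)
      then show ?thesis by blast
    next
      case 2
      then obtain a b c where "a \<noteq> b" "B = {a, b}" "r = Node (Upair (Leaf a) (Leaf b))"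
        "A = {c}" "l = Leaf c"
        using Node(3,4) binary_tree_on_card_1 binary_tree_on_card_2 by meson
      then have "distinct [a, b, c]" "S = {a, b, c}" "t = triplet a b c"
        using Node by (auto simp: triplet_def)
      then show ?thesis by blast
    qed
  qed
next
  assume "\<exists>a b c. distinct [a, b, c] \<and> S = {a, b, c} \<and> t = triplet a b c"
  then obtain a b c where "distinct [a, b, c]" "S = {a, b, c}" "t = triplet a b c" by blast
  moreover have "binary_tree_on (({a} \<union> {b}) \<union> {c}) (triplet a b c)"
    using calculation(1) unfolding triplet_def by (intro binary_tree_on.intros) auto
  ultimately show "rooted_triplet_on S t"
    by (simp add: rooted_triplet_on_def insert_commute)
qed

section \<open>Programs and running time\<close>

text \<open>
  The machine model is a WHILE language over binary cons trees, in the style of Jones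
  (Computability and Complexity from a Programming Perspective), with a single implicit
  variable: a program maps its input value to its output value. Unlike unit-cost WHILE,
  every primitive step is charged the size of the value it reads or produces. Hence no value
  arising in a computation is larger than the time spent plus the input size
  (\<open>exec_size\<close>), and time in this model and on Turing machines is
  polynomially related, for functions as well as for decision problems.
\<close>

datatype data = DNil | DCons data data

primrec hd_data :: "data \<Rightarrow> data" where
  "hd_data DNil = DNil"
| "hd_data (DCons x y) = x"

primrec tl_data :: "data \<Rightarrow> data" where
  "tl_data DNil = DNil"
| "tl_data (DCons x y) = y"

definition data_of_bool :: "bool \<Rightarrow> data" where
  "data_of_bool b = (if b then DCons DNil DNil else DNil)"

datatype prog =
    Ident
  | Const data
  | Head
  | Tail
  | Equal
  | MkCons prog prog
  | Seq prog prog
  | Cond prog prog prog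
  | While prog prog

text \<open>
  \<open>exec c x t y\<close>: on input \<open>x\<close>, program \<open>c\<close> halts after time \<open>t\<close> with output \<open>y\<close>.
  Here \<^term>\<open>size (x :: data)\<close> is the number of \<^const>\<open>DCons\<close> cells of \<open>x\<close>, and \<^const>\<open>DNil\<close>
  is the only value regarded as false.
\<close>

inductive exec :: "prog \<Rightarrow> data \<Rightarrow> nat \<Rightarrow> data \<Rightarrow> bool" where
  Ident: "exec Ident x (Suc (size x)) x"
| Const: "exec (Const d) x (Suc (size d)) d"
| Head: "exec Head x (Suc (size x)) (hd_data x)"
| Tail: "exec Tail x (Suc (size x)) (tl_data x)"
| Equal: "exec Equal x (Suc (size x)) (data_of_bool (x \<noteq> DNil \<and> hd_data x = tl_data x))"
| MkCons: "exec p x t1 y \<Longrightarrow> exec q x t2 z \<Longrightarrow> exec (MkCons p q) x (Suc (t1 + t2)) (DCons y z)"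
| Seq: "exec p x t1 y \<Longrightarrow> exec q y t2 z \<Longrightarrow> exec (Seq p q) x (Suc (t1 + t2)) z"
| CondTrue: "exec b x t1 v \<Longrightarrow> v \<noteq> DNil \<Longrightarrow> exec p x t2 y \<Longrightarrow>
    exec (Cond b p q) x (Suc (t1 + t2)) y"
| CondFalse: "exec b x t1 DNil \<Longrightarrow> exec q x t2 y \<Longrightarrow>
    exec (Cond b p q) x (Suc (t1 + t2)) y"
| WhileFalse: "exec b x t DNil \<Longrightarrow> exec (While b p) x (Suc (t + size x)) x"
| WhileTrue: "exec b x t1 v \<Longrightarrow> v \<noteq> DNil \<Longrightarrow> exec p x t2 y \<Longrightarrow> exec (While b p) y t3 z \<Longrightarrow>
    exec (While b p) x (Suc (t1 + t2 + t3)) z"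

inductive_cases exec_IdentE: "exec Ident x t y"
inductive_cases exec_ConstE: "exec (Const d) x t y"
inductive_cases exec_HeadE: "exec Head x t y"
inductive_cases exec_TailE: "exec Tail x t y"
inductive_cases exec_EqualE: "exec Equal x t y"
inductive_cases exec_MkConsE: "exec (MkCons p q) x t y"
inductive_cases exec_SeqE: "exec (Seq p q) x t y"
inductive_cases exec_CondE: "exec (Cond b p q) x t y"
inductive_cases exec_WhileE: "exec (While b p) x t y"

lemma exec_deterministic:
  "exec c x t y \<Longrightarrow> exec c x t' y' \<Longrightarrow> t' = t \<and> y' = y"
proof (induction arbitrary: t' y' rule: exec.induct)
  case Ident then show ?case by (auto elim: exec_IdentE)
next
  case Const then show ?case by (auto elim: exec_ConstE)
next
  case Head then show ?case by (auto elim: exec_HeadE)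
next
  case Tail then show ?case by (auto elim: exec_TailE)
next
  case Equal then show ?case by (auto elim: exec_EqualE)
next
  case (MkCons p x t1 y q t2 z)
  from MkCons.prems show ?case by (rule exec_MkConsE) (use MkCons.IH in blast)
next
  case (Seq p x t1 y q t2 z)
  from Seq.prems show ?case by (rule exec_SeqE) (use Seq.IH in blast)
next
  case (CondTrue b x t1 v p t2 y q)
  from CondTrue.prems show ?case by (rule exec_CondE) (use CondTrue.IH CondTrue.hyps in blast)+
next
  case (CondFalse b x t1 q t2 y p)
  from CondFalse.prems show ?case by (rule exec_CondE) (use CondFalse.IH in blast)+
next
  case (WhileFalse b x t p)
  from WhileFalse.prems show ?case by (rule exec_WhileE) (use WhileFalse.IH in blast)+
next
  case (WhileTrue b x t1 v p t2 y t3 z)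
  from WhileTrue.prems show ?case by (rule exec_WhileE) (use WhileTrue.IH WhileTrue.hyps in blast)+
qed

lemma exec_size: "exec c x t y \<Longrightarrow> size y \<le> t"
proof (induction rule: exec.induct)
  case (Head x) then show ?case by (cases x) auto
next
  case (Tail x) then show ?case by (cases x) auto
qed (auto simp: data_of_bool_def)

section \<open>Encoding of instances\<close>

text \<open>
  Numbers are encoded in binary (least significant bit first, no leading zeros), so the
  parameter contributes only logarithmically to the size of the input.
\<close>

fun data_of_nat :: "nat \<Rightarrow> data" where
  "data_of_nat n =
     (if n = 0 then DNil else DCons (data_of_bool (odd n)) (data_of_nat (n div 2)))"

declare data_of_nat.simps [simp del]

definition data_of_int :: "int \<Rightarrow> data" where
  "data_of_int i = DCons (data_of_bool (i < 0)) (data_of_nat (nat \<bar>i\<bar>))"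

primrec data_of_list :: "('a \<Rightarrow> data) \<Rightarrow> 'a list \<Rightarrow> data" where
  "data_of_list f [] = DNil"
| "data_of_list f (x # xs) = DCons (f x) (data_of_list f xs)"

fun data_of_triple :: "nat \<times> nat \<times> nat \<Rightarrow> data" where
  "data_of_triple (a, b, c) =
     DCons (data_of_nat a) (DCons (data_of_nat b) (data_of_nat c))"

text \<open>
  An instance whose leaves are natural numbers is given by its leaves and its triplets, each
  listed without repetition in any order; $ab|c$ is given as \<open>(a, b, c)\<close> or as \<open>(b, a, c)\<close>.
\<close>

definition encodes :: "data \<Rightarrow> nat set \<Rightarrow> nat rtree set \<Rightarrow> int \<Rightarrow> bool" where
  "encodes x V R k \<longleftrightarrow>
     (\<exists>vs ts. distinct vs \<and> set vs = V \<and>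
        (let rs = map (\<lambda>(a, b, c). triplet a b c) ts in distinct rs \<and> set rs = R) \<and>
        x = DCons (data_of_list data_of_nat vs)
              (DCons (data_of_list data_of_triple ts) (data_of_int k)))"

lemma instance_has_encoding:
  assumes "dense_rti_instance V R k"
  shows "\<exists>x. encodes x V R k"
proof -
  let ?tr = "\<lambda>(a, b, c). triplet a b c"
  have V: "finite V" and "dense_triplets V R"
    using assms by (auto simp: dense_rti_instance_def)
  then have "\<forall>t\<in>R. \<exists>S\<subseteq>V. rooted_triplet_on S t"
    by (simp add: dense_triplets_def)
  have R: "R \<subseteq> ?tr ` (V \<times> V \<times> V)"
  proof
    fix t assume "t \<in> R"
    then obtain S where S: "S \<subseteq> V" "rooted_triplet_on S t"
      using \<open>\<forall>t\<in>R. _\<close> by blast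
    from S(2) obtain a b c where "S = {a, b, c}" "t = triplet a b c"
      unfolding rooted_triplet_on_iff by blast
    then have "t = ?tr (a, b, c)" "(a, b, c) \<in> V \<times> V \<times> V" using S(1) by auto
    then show "t \<in> ?tr ` (V \<times> V \<times> V)" by (rule image_eqI)
  qed
  with V have "finite R" using finite_subset by blast
  then obtain rs where rs: "distinct rs" "set rs = R"
    using finite_distinct_list by blast
  obtain vs where vs: "distinct vs" "set vs = V"
    using V finite_distinct_list by blast
  have "\<forall>t\<in>set rs. \<exists>p. t = ?tr p" using R rs(2) by blast
  then obtain ts where "rs = map ?tr ts"
    unfolding ex_map_conv[symmetric] by blast
  then show ?thesis
    using rs vs unfolding encodes_def Let_def by blast
qed

end

theory Submission
  imports Defs
begin

text \<open>
  Seen from a leaf \<open>a\<close>, a tree preorders the other leaves by where they branch off from the path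
  between \<open>a\<close> and the root, and every triplet split by this preorder is forced by its triplets with
  \<open>a\<close>. A leaf for which this holds in \<open>R\<close> can be inserted into any tree on the remaining leaves
  without creating a new inconsistency, so only the other leaves matter.

  A maximal packing of conflicts with pairwise disjoint certificates yields a set \<open>U\<close> of at most
  \<open>4 * k\<close> leaves such that some tree agrees with all triplets not inside \<open>U\<close>. The triplets inside
  \<open>U\<close> that are refuted by a given leaf outside \<open>U\<close> are then those inconsistent with this tree whose
  least common ancestor is above that leaf, so the sets of leaves refuting a triplet form a laminar
  family and a greedy matching of triplets to refuting leaves is optimal. It has size at most \<open>k\<close>,
  since distinct matched pairs again give disjoint certificates. Let \<open>D\<close> be the leaves refuting
  unmatched triplets; there are at most as many as matched pairs. Every triplet refuted by a leaf
  outside \<open>U\<close> and \<open>D\<close> is matched to such a leaf, so an optimal tree may be assumed to pay exactly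
  one for it: flip it, decrease \<open>k\<close>, and all leaves outside \<open>U\<close> and \<open>D\<close> can be removed.
\<close>

section \<open>Polynomial-time computable functions\<close>

text \<open>A leaf outside \<open>U\<close> may still contradict triplets inside \<open>U\<close>.
  Such a conflict cannot be packed, since the triplet proving it may lie inside \<open>U\<close> and
  be counted already. Nor can the leaf just be dropped, since this loses its pressure on the
  triplets that it refutes. The matching measures that pressure: a refuted triplet together with a
  leaf assigned to it alone accounts for a wrong triplet of its own in every tree. Only leaves
  refuting a triplet without a private leaf have to stay, and each of them is the partner of some
  matched triplet; this is where the fifth \<open>k\<close> comes from. The tree that agrees with
  the triplets not inside \<open>U\<close> exists only in the analysis. The algorithm consults the
  triplets on one leaf at a time, so it consists of filters and folds over lists, and laminarity
  lets one greedy pass replace augmenting paths. No program is written out: \<open>kernel\<close> is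
  an ordinary function, and closure properties show that some program computes it in polynomial
  time.\<close>

class enc =
  fixes enc :: "'a \<Rightarrow> data"
  assumes enc_inject: "enc x = enc y \<Longrightarrow> x = y"

abbreviation sz :: "'a::enc \<Rightarrow> nat" where
  "sz x \<equiv> size (enc x)"

lemma enc_eq_iff [simp]: "enc x = enc y \<longleftrightarrow> x = y"
  using enc_inject by blast

instantiation bool :: enc
begin
definition enc_bool: "enc = data_of_bool"
instance by standard (auto simp: enc_bool data_of_bool_def split: if_splits)
end

lemma data_of_nat_inject: "data_of_nat m = data_of_nat n \<Longrightarrow> m = n"
proof (induction m arbitrary: n rule: less_induct)
  case (less m)
  show ?case
  proof (cases "m = 0 \<or> n = 0")
    case True
    then show ?thesis using less.prems
      by (auto simp: data_of_nat.simps[of m] data_of_nat.simps[of n] split: if_splits)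
  next
    case False
    then have "data_of_bool (odd m) = data_of_bool (odd n)"
      and "data_of_nat (m div 2) = data_of_nat (n div 2)"
      using less.prems data_of_nat.simps[of m] data_of_nat.simps[of n] by auto
    moreover from this have "m div 2 = n div 2"
      using less.IH[of "m div 2"] False by simp
    moreover have "odd m \<longleftrightarrow> odd n"
      using calculation(1) by (auto simp: data_of_bool_def split: if_splits)
    ultimately show ?thesis
      by (metis dvd_mult_div_cancel odd_two_times_div_two_succ)
  qed
qed

instantiation nat :: enc
begin
definition enc_nat: "enc = data_of_nat"
instance by standard (auto simp: enc_nat dest: data_of_nat_inject)
end

instantiation int :: enc
begin
definition enc_int: "enc = data_of_int"
instance
proof
  fix i j :: int
  assume "enc i = enc j"
  then have "(i < 0) = (j < 0)" "nat \<bar>i\<bar> = nat \<bar>j\<bar>"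
    by (auto simp: enc_int data_of_int_def data_of_bool_def dest: data_of_nat_inject split: if_splits)
  then show "i = j" by linarith
qed
end

text \<open>Right nesting makes \<open>enc (a, b, c)\<close> equal to
  \<open>data_of_triple (a, b, c)\<close> and makes the encoding of \<open>(vs, ts, k)\<close>
  literally the value demanded by \<open>encodes\<close>, so no translation between formats is ever
  computed.\<close>

instantiation prod :: (enc, enc) enc
begin
definition enc_prod: "enc p = DCons (enc (fst p)) (enc (snd p))"
instance by standard (auto simp: enc_prod prod_eq_iff)
end

instantiation list :: (enc) enc
begin
definition enc_list: "enc = data_of_list enc"
instance
proof
  fix xs ys :: "'a list"
  show "enc xs = enc ys \<Longrightarrow> xs = ys"
    unfolding enc_list
  proof (induction xs arbitrary: ys)
    case Nil then show ?case by (cases ys) auto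
  next
    case (Cons x xs) then show ?case by (cases ys) auto
  qed
qed
end

lemma enc_Pair [simp]: "enc (x, y) = DCons (enc x) (enc y)"
  by (simp add: enc_prod)

lemma enc_Nil [simp]: "enc [] = DNil"
  by (simp add: enc_list)

lemma enc_Cons [simp]: "enc (x # xs) = DCons (enc x) (enc xs)"
  by (simp add: enc_list)

lemma enc_eq_DNil_iff [simp]: "enc b = DNil \<longleftrightarrow> \<not> b"
  by (simp add: enc_bool data_of_bool_def)

lemma sz_append: "sz (xs @ ys) = sz xs + sz ys"
  by (induction xs) auto

lemma sz_rev: "sz (rev xs) = sz xs"
  by (induction xs) (auto simp: sz_append)

lemma sz_mem: "x \<in> set xs \<Longrightarrow> sz x < sz xs"
  by (induction xs) auto

lemma length_le_sz: "length xs \<le> sz xs"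
  by (induction xs) auto

lemma sz_filter: "sz (filter P xs) \<le> sz xs"
  by (induction xs) auto

lemma poly_nat_mono: "m \<le> n \<Longrightarrow> poly p m \<le> poly (p :: nat poly) n"
  by (induction p) (auto intro!: add_mono mult_mono)

section \<open>Closure under composition, pairing, tests and branching\<close>

definition ptime :: "('a::enc \<Rightarrow> 'b::enc) \<Rightarrow> bool" where
  "ptime f \<longleftrightarrow>
     (\<exists>A p. \<forall>x. \<exists>t. exec A (enc x) t (enc (f x)) \<and> t \<le> poly p (sz x))"

lemma ptimeI:
  assumes "\<And>x. \<exists>t. exec A (enc x) t (enc (f x)) \<and> t \<le> poly p (sz x)"
  shows "ptime f"
  using assms unfolding ptime_def by blast

lemma ptimeE:
  assumes "ptime f"
  obtains A p where
    "\<And>x. \<exists>t. exec A (enc x) t (enc (f x)) \<and> t \<le> poly p (sz x)"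
  using assms unfolding ptime_def by blast

text \<open>Producing a value takes at least its size in time (\<open>exec_size\<close>), so a time
  bound also bounds the output; composition and loops rely on this.\<close>

lemma ptime_sz:
  assumes "ptime f"
  obtains p where "\<And>x. sz (f x) \<le> poly p (sz x)"
proof -
  obtain A p where "\<And>x. \<exists>t. exec A (enc x) t (enc (f x)) \<and> t \<le> poly p (sz x)"
    using assms by (rule ptimeE) blast
  then have "sz (f x) \<le> poly p (sz x)" for x
    using exec_size le_trans by blast
  then show thesis by (rule that)
qed

lemma ptime_id: "ptime (\<lambda>x. x)"
  by (rule ptimeI[of Ident _ "[:1, 1:]"]) (auto intro!: exI exec.Ident)

lemma ptime_const: "ptime (\<lambda>x. c)"
  by (rule ptimeI[of "Const (enc c)" _ "[:Suc (sz c):]"]) (auto intro!: exI exec.Const)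

lemma ptime_comp:
  assumes "ptime f" "ptime g"
  shows "ptime (\<lambda>x. f (g x))"
proof -
  obtain A p where f: "\<And>x. \<exists>t. exec A (enc x) t (enc (f x)) \<and> t \<le> poly p (sz x)"
    using assms(1) by (rule ptimeE) blast
  obtain B q where g: "\<And>x. \<exists>t. exec B (enc x) t (enc (g x)) \<and> t \<le> poly q (sz x)"
    using assms(2) by (rule ptimeE) blast
  obtain r where r: "\<And>x. sz (g x) \<le> poly r (sz x)"
    using assms(2) ptime_sz by blast
  show ?thesis
  proof (rule ptimeI[of "Seq B A" _ "q + pcompose p r + 1"])
    fix x
    obtain t u where "exec B (enc x) t (enc (g x))" "t \<le> poly q (sz x)"
      "exec A (enc (g x)) u (enc (f (g x)))" "u \<le> poly p (sz (g x))"
      using f g by metis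
    moreover have "poly p (sz (g x)) \<le> poly p (poly r (sz x))"
      by (intro poly_nat_mono r)
    ultimately show "\<exists>t. exec (Seq B A) (enc x) t (enc (f (g x))) \<and>
        t \<le> poly (q + pcompose p r + 1) (sz x)"
      by (intro exI[of _ "Suc (t + u)"] conjI exec.Seq) (auto simp: poly_pcompose)
  qed
qed

lemma enc_fst: "hd_data (enc x) = enc (fst x)"
  and enc_snd: "tl_data (enc x) = enc (snd x)"
  by (simp_all add: enc_prod)

lemma ptime_fst': "ptime fst"
proof (rule ptimeI[of Head _ "[:1, 1:]"])
  fix x :: "'a \<times> 'b"
  show "\<exists>t. exec Head (enc x) t (enc (fst x)) \<and> t \<le> poly [:1, 1:] (sz x)"
    using exec.Head[of "enc x"] unfolding enc_fst by auto
qed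

lemma ptime_snd': "ptime snd"
proof (rule ptimeI[of Tail _ "[:1, 1:]"])
  fix x :: "'a \<times> 'b"
  show "\<exists>t. exec Tail (enc x) t (enc (snd x)) \<and> t \<le> poly [:1, 1:] (sz x)"
    using exec.Tail[of "enc x"] unfolding enc_snd by auto
qed

lemmas ptime_fst = ptime_comp[OF ptime_fst']
lemmas ptime_snd = ptime_comp[OF ptime_snd']

lemma ptime_Pair:
  assumes "ptime f" "ptime g"
  shows "ptime (\<lambda>x. (f x, g x))"
proof -
  obtain A p where f: "\<And>x. \<exists>t. exec A (enc x) t (enc (f x)) \<and> t \<le> poly p (sz x)"
    using assms(1) by (rule ptimeE) blast
  obtain B q where g: "\<And>x. \<exists>t. exec B (enc x) t (enc (g x)) \<and> t \<le> poly q (sz x)"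
    using assms(2) by (rule ptimeE) blast
  show ?thesis
  proof (rule ptimeI[of "MkCons A B" _ "p + q + 1"])
    fix x
    obtain t u where "exec A (enc x) t (enc (f x))" "t \<le> poly p (sz x)"
      "exec B (enc x) u (enc (g x))" "u \<le> poly q (sz x)"
      using f g by metis
    then show "\<exists>t. exec (MkCons A B) (enc x) t (enc (f x, g x)) \<and> t \<le> poly (p + q + 1) (sz x)"
      unfolding enc_Pair by (intro exI[of _ "Suc (t + u)"] conjI exec.MkCons) auto
  qed
qed

lemma ptime_recode:
  assumes "ptime f" "\<And>x. enc (g x) = enc (f x)"
  shows "ptime g"
  using assms unfolding ptime_def by simp

text \<open>Programs see only encodings, so a change of type is free. This transfers programs for
  bit lists to numbers, and programs for pairs to integers.\<close>

lemma ptime_recode_input: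
  assumes "ptime f" "\<And>x. \<exists>y. enc y = enc x \<and> enc (g x) = enc (f y)"
  shows "ptime g"
proof -
  obtain A p where f: "\<And>x. \<exists>t. exec A (enc x) t (enc (f x)) \<and> t \<le> poly p (sz x)"
    using assms(1) by (rule ptimeE) blast
  show ?thesis by (rule ptimeI[of A _ p]) (metis f assms(2))
qed

text \<open>Pairs and nonempty lists have the same encoding, so consing is pairing.\<close>

lemma ptime_Cons: "ptime f \<Longrightarrow> ptime g \<Longrightarrow> ptime (\<lambda>x. f x # g x)"
  by (rule ptime_recode[OF ptime_Pair]) auto

lemma ptime_eq:
  assumes "ptime f" "ptime g"
  shows "ptime (\<lambda>x. f x = g x)"
proof -
  have "ptime (\<lambda>p :: 'b \<times> 'b. fst p = snd p)"
  proof (rule ptimeI[of Equal _ "[:1, 1:]"])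
    fix p :: "'b \<times> 'b"
    have "exec Equal (enc p) (Suc (sz p)) (enc (fst p = snd p))"
      using exec.Equal[of "enc p"] by (simp add: enc_prod enc_bool)
    then show "\<exists>t. exec Equal (enc p) t (enc (fst p = snd p)) \<and> t \<le> poly [:1, 1:] (sz p)"
      by auto
  qed
  from ptime_comp[OF this ptime_Pair[OF assms]] show ?thesis by simp
qed

lemma ptime_if:
  assumes "ptime b" "ptime f" "ptime g"
  shows "ptime (\<lambda>x. if b x then f x else g x)"
proof -
  obtain A p where f: "\<And>x. \<exists>t. exec A (enc x) t (enc (f x)) \<and> t \<le> poly p (sz x)"
    using assms(2) by (rule ptimeE) blast
  obtain B q where g: "\<And>x. \<exists>t. exec B (enc x) t (enc (g x)) \<and> t \<le> poly q (sz x)"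
    using assms(3) by (rule ptimeE) blast
  obtain C r where b: "\<And>x. \<exists>t. exec C (enc x) t (enc (b x)) \<and> t \<le> poly r (sz x)"
    using assms(1) by (rule ptimeE) blast
  show ?thesis
  proof (rule ptimeI[of "Cond C A B" _ "p + q + r + 1"])
    fix x
    obtain t u v where *: "exec A (enc x) t (enc (f x))" "t \<le> poly p (sz x)"
      "exec B (enc x) u (enc (g x))" "u \<le> poly q (sz x)"
      "exec C (enc x) v (enc (b x))" "v \<le> poly r (sz x)"
      using f g b by metis
    show "\<exists>t. exec (Cond C A B) (enc x) t (enc (if b x then f x else g x)) \<and>
        t \<le> poly (p + q + r + 1) (sz x)"
    proof (cases "b x")
      case True
      then show ?thesis
        using exec.CondTrue[OF *(5) _ *(1)] *(2,6) by (intro exI conjI) auto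
    next
      case False
      then have "exec C (enc x) v DNil" using *(5) by (simp add: enc_bool data_of_bool_def)
      then show ?thesis
        using exec.CondFalse[OF _ *(3)] *(4,6) False by (intro exI conjI) auto
    qed
  qed
qed

lemma ptime_not: "ptime b \<Longrightarrow> ptime (\<lambda>x. \<not> b x)"
  using ptime_if[OF _ ptime_const[of False] ptime_const[of True], of b]
  by (rule ptime_recode) auto

lemma ptime_conj: "ptime b \<Longrightarrow> ptime c \<Longrightarrow> ptime (\<lambda>x. b x \<and> c x)"
  using ptime_if[OF _ _ ptime_const[of False], of b c]
  by (rule ptime_recode) auto

lemma ptime_disj: "ptime b \<Longrightarrow> ptime c \<Longrightarrow> ptime (\<lambda>x. b x \<or> c x)"
  using ptime_if[OF _ ptime_const[of True], of b c]
  by (rule ptime_recode) auto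

lemma ptime_case_list:
  assumes l: "ptime l" and f: "ptime f" and g: "ptime (\<lambda>c. g (fst c) (fst (snd c)) (snd (snd c)))"
  shows "ptime (\<lambda>x. case l x of [] \<Rightarrow> f x | y # ys \<Rightarrow> g x y ys)"
proof -
  define h where "h = (\<lambda>x. case l x of [] \<Rightarrow> undefined | y # ys \<Rightarrow> g x y ys)"
  obtain A p where A: "\<And>x. \<exists>t. exec A (enc x) t (enc (f x)) \<and> t \<le> poly p (sz x)"
    using f by (rule ptimeE) blast
  obtain B q where B: "\<And>x. \<exists>t. exec B (enc x) t (enc (l x)) \<and> t \<le> poly q (sz x)"
    using l by (rule ptimeE) blast
  obtain C r where C: "\<And>x. \<exists>t. exec C (enc x) t (enc (g (fst x) (fst (snd x)) (snd (snd x)))) \<and> t \<le> poly r (sz x)"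
    using g by (rule ptimeE) blast
  obtain s where s: "\<And>x. sz (l x) \<le> poly s (sz x)"
    using l ptime_sz by blast
  show ?thesis
  \<comment> \<open>\<open>B\<close> runs once as the test and once to build the argument of
    \<open>C\<close>, hence \<open>2 * q\<close>. A nonempty list is encoded like the pair of its
    head and tail, so pairing \<open>x\<close> with \<open>l x\<close> already yields
    \<open>(x, y, ys)\<close>.\<close>
  proof (rule ptimeI[of "Cond B (Seq (MkCons Ident B) C) A" _
        "p + 2 * q + pcompose r ([:0, 1:] + s + 1) + [:4, 1:]"])
    fix x
    obtain t u where *: "exec A (enc x) t (enc (f x))" "t \<le> poly p (sz x)"
      "exec B (enc x) u (enc (l x))" "u \<le> poly q (sz x)"
      using A B by metis
    show "\<exists>t. exec (Cond B (Seq (MkCons Ident B) C) A) (enc x) t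
         (enc (case l x of [] \<Rightarrow> f x | y # ys \<Rightarrow> g x y ys)) \<and>
        t \<le> poly (p + 2 * q + pcompose r ([:0, 1:] + s + 1) + [:4, 1:]) (sz x)"
    proof (cases "l x")
      case Nil
      then have "exec B (enc x) u DNil" using *(3) by simp
      from exec.CondFalse[OF this *(1)] show ?thesis
        using *(2,4) Nil by (intro exI conjI) auto
    next
      case (Cons y ys)
      obtain v where v: "exec C (enc (x, y, ys)) v (enc (g x y ys))" "v \<le> poly r (sz (x, y, ys))"
        using C[of "(x, y, ys)"] by auto
      have e: "enc (x, y, ys) = DCons (enc x) (enc (l x))" by (simp add: Cons)
      have "exec (MkCons Ident B) (enc x) (Suc (Suc (sz x) + u)) (enc (x, y, ys))"
        unfolding e by (intro exec.MkCons exec.Ident *(3))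
      from exec.CondTrue[OF *(3) _ exec.Seq[OF this v(1)]]
      have ex: "exec (Cond B (Seq (MkCons Ident B) C) A) (enc x)
         (Suc (u + Suc (Suc (Suc (sz x) + u) + v))) (enc (g x y ys))"
        by (simp add: Cons)
      have "v \<le> poly r (sz x + poly s (sz x) + 1)"
        using v(2) unfolding e using s[of x] by (elim order_trans) (auto intro!: poly_nat_mono)
      with *(4) have "Suc (u + Suc (Suc (Suc (sz x) + u) + v))
          \<le> poly (p + 2 * q + pcompose r ([:0, 1:] + s + 1) + [:4, 1:]) (sz x)"
        by (simp add: poly_pcompose)
      with ex show ?thesis unfolding Cons list.case by blast
    qed
  qed
qed

lemma ptime_tl: "ptime l \<Longrightarrow> ptime (\<lambda>x. tl (l x))"
  unfolding tl_def by (intro ptime_case_list ptime_const ptime_snd ptime_id)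

lemma ptime_null: "ptime l \<Longrightarrow> ptime (\<lambda>x. l x = [])"
  by (intro ptime_eq ptime_const)

text \<open>
  The running time of a loop is polynomial as soon as the number of iterations and the sizes
  of the intermediate states are.
\<close>

lemma exec_While:
  fixes \<sigma> :: "nat \<Rightarrow> 's::enc"
  assumes G: "\<And>s :: 's. \<exists>t. exec G (enc s) t (enc (b s)) \<and> t \<le> poly p (sz s)"
    and B: "\<And>s :: 's. \<exists>t. exec B (enc s) t (enc (f s)) \<and> t \<le> poly q (sz s)"
    and "\<And>j. j < n \<Longrightarrow> b (\<sigma> j) \<and> \<sigma> (Suc j) = f (\<sigma> j)" "\<not> b (\<sigma> n)"
    and "\<And>j. j \<le> n \<Longrightarrow> sz (\<sigma> j) \<le> M"
  shows "\<exists>t. exec (While G B) (enc (\<sigma> 0)) t (enc (\<sigma> n)) \<and>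
    t \<le> (n + 1) * (poly p M + poly q M + M + 1)"
  using assms(3-)
proof (induction n arbitrary: \<sigma>)
  case 0
  obtain t where t: "exec G (enc (\<sigma> 0)) t (enc (b (\<sigma> 0)))" "t \<le> poly p (sz (\<sigma> 0))"
    using G by blast
  moreover have "enc (b (\<sigma> 0)) = DNil" using 0 by simp
  ultimately have "exec (While G B) (enc (\<sigma> 0)) (Suc (t + sz (\<sigma> 0))) (enc (\<sigma> 0))"
    by (metis exec.WhileFalse)
  moreover have "t \<le> poly p M" "sz (\<sigma> 0) \<le> M"
    using t(2) 0(3)[of 0] poly_nat_mono[of "sz (\<sigma> 0)" M p] by auto
  ultimately show ?case by (intro exI conjI) auto
next
  case (Suc n)
  have "\<exists>t. exec (While G B) (enc (\<sigma> (Suc 0))) t (enc (\<sigma> (Suc n))) \<and>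
    t \<le> (n + 1) * (poly p M + poly q M + M + 1)"
  proof (rule Suc.IH)
    show "b (\<sigma> (Suc j)) \<and> \<sigma> (Suc (Suc j)) = f (\<sigma> (Suc j))" if "j < n" for j
      using Suc.prems(1)[of "Suc j"] that by simp
    show "sz (\<sigma> (Suc j)) \<le> M" if "j \<le> n" for j
      using Suc.prems(3)[of "Suc j"] that by simp
  qed (rule Suc.prems(2))
  then obtain v where v: "exec (While G B) (enc (\<sigma> (Suc 0))) v (enc (\<sigma> (Suc n)))"
    "v \<le> (n + 1) * (poly p M + poly q M + M + 1)" by blast
  obtain t where t: "exec G (enc (\<sigma> 0)) t (enc (b (\<sigma> 0)))" "t \<le> poly p (sz (\<sigma> 0))"
    using G by blast
  obtain u where u: "exec B (enc (\<sigma> 0)) u (enc (\<sigma> (Suc 0)))" "u \<le> poly q (sz (\<sigma> 0))"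
    using B[of "\<sigma> 0"] Suc.prems(1)[of 0] by auto
  have "enc (b (\<sigma> 0)) \<noteq> DNil" using Suc.prems(1)[of 0] by simp
  note ex = exec.WhileTrue[OF t(1) this u(1) v(1)]
  have "sz (\<sigma> 0) \<le> M" using Suc.prems(3) by simp
  then have "t \<le> poly p M" "u \<le> poly q M"
    using t(2) u(2) poly_nat_mono[of "sz (\<sigma> 0)" M] le_trans by blast+
  then have "Suc (t + u + v) \<le> (Suc n + 1) * (poly p M + poly q M + M + 1)"
    using v(2) by simp
  then show ?case using ex by blast
qed

text \<open>The loop state consists of the rest of the list, the accumulator, and the input
  \<open>x\<close>, which the step may consult. The size bound at every prefix is essential: a
  polynomial-time step may double the accumulator in each round.\<close>

lemma ptime_fold:
  fixes s :: "'a::enc \<Rightarrow> 'b::enc \<Rightarrow> 'c::enc \<Rightarrow> 'c"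
  assumes l: "ptime l" and i: "ptime i"
    and s: "ptime (\<lambda>c. s (fst c) (fst (snd c)) (snd (snd c)))"
    and bound: "\<And>x ys zs. l x = ys @ zs \<Longrightarrow> sz (fold (s x) ys (i x)) \<le> poly r (sz x)"
  shows "ptime (\<lambda>x. fold (s x) (l x) (i x))"
proof -
  define f where "f = (\<lambda>c :: 'b list \<times> 'c \<times> 'a. case fst c of [] \<Rightarrow> c
    | y # ys \<Rightarrow> (ys, s (snd (snd c)) y (fst (snd c)), snd (snd c)))"
  have "ptime (\<lambda>e :: ('b list \<times> 'c \<times> 'a) \<times> 'b \<times> 'b list. (snd (snd e),
      s (snd (snd (fst e))) (fst (snd e)) (fst (snd (fst e))), snd (snd (fst e))))"
    by (intro ptime_Pair ptime_fst ptime_snd ptime_id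
        ptime_comp[OF s, of "\<lambda>e. (snd (snd (fst e)), fst (snd e), fst (snd (fst e)))", simplified])
  from ptime_case_list[OF ptime_fst[OF ptime_id] ptime_id this]
  have "ptime f" by (simp add: f_def)
  then obtain B q where B: "\<And>c. \<exists>t. exec B (enc c) t (enc (f c)) \<and> t \<le> poly q (sz c)"
    by (rule ptimeE) blast
  have "ptime (\<lambda>c :: 'b list \<times> 'c \<times> 'a. \<not> fst c = [])"
    by (intro ptime_not ptime_null ptime_fst ptime_id)
  then obtain G p where
    G: "\<And>c :: 'b list \<times> 'c \<times> 'a. \<exists>t. exec G (enc c) t (enc (\<not> fst c = [])) \<and> t \<le> poly p (sz c)"
    by (rule ptimeE) blast
  have "ptime (\<lambda>x. (l x, i x, x))" by (intro ptime_Pair l i ptime_id)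
  then obtain I v where I: "\<And>x. \<exists>t. exec I (enc x) t (enc (l x, i x, x)) \<and> t \<le> poly v (sz x)"
    by (rule ptimeE) blast
  have "ptime (\<lambda>c :: 'b list \<times> 'c \<times> 'a. fst (snd c))"
    by (intro ptime_fst ptime_snd ptime_id)
  then obtain E w where E: "\<And>c :: 'b list \<times> 'c \<times> 'a. \<exists>t. exec E (enc c) t (enc (fst (snd c))) \<and> t \<le> poly w (sz c)"
    by (rule ptimeE) blast
  obtain lp where lp: "\<And>x. sz (l x) \<le> poly lp (sz x)"
    using l ptime_sz by blast
  define m where "m = lp + r + [:2, 1:]"
  show ?thesis
  proof (rule ptimeI[of "Seq I (Seq (While G B) E)" _
        "v + (lp + 1) * (pcompose p m + pcompose q m + m + 1) + pcompose w m + 2"])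
    fix x :: 'a
    define M where "M = poly m (sz x)"
    define \<sigma> where "\<sigma> = (\<lambda>j. (drop j (l x), fold (s x) (take j (l x)) (i x), x))"
    define n where "n = length (l x)"
    have M: "sz (\<sigma> j) \<le> M" for j
    proof -
      have "sz (drop j (l x)) \<le> sz (l x)"
        by (metis append_take_drop_id sz_append le_add2)
      moreover have "sz (fold (s x) (take j (l x)) (i x)) \<le> poly r (sz x)"
        by (rule bound[of _ _ "drop j (l x)"]) simp
      ultimately show ?thesis using lp[of x] by (simp add: \<sigma>_def M_def m_def)
    qed
    have "\<exists>t. exec (While G B) (enc (\<sigma> 0)) t (enc (\<sigma> n)) \<and>
      t \<le> (n + 1) * (poly p M + poly q M + M + 1)"
    proof (rule exec_While[OF G B _ _ M])
      fix j assume j: "j < n"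
      then have "drop j (l x) = l x ! j # drop (Suc j) (l x)"
        by (simp add: n_def Cons_nth_drop_Suc)
      then show "(\<not> fst (\<sigma> j) = []) \<and> \<sigma> (Suc j) = f (\<sigma> j)"
        using j by (simp add: \<sigma>_def f_def n_def take_Suc_conv_app_nth)
    qed (simp add: \<sigma>_def n_def)
    then obtain t where t: "exec (While G B) (enc (\<sigma> 0)) t (enc (\<sigma> n))"
      "t \<le> (n + 1) * (poly p M + poly q M + M + 1)" by blast
    obtain t1 where t1: "exec I (enc x) t1 (enc (\<sigma> 0))" "t1 \<le> poly v (sz x)"
      using I[of x] by (auto simp: \<sigma>_def)
    obtain t2 where t2: "exec E (enc (\<sigma> n)) t2 (enc (fold (s x) (l x) (i x)))" "t2 \<le> poly w (sz (\<sigma> n))"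
      using E[of "\<sigma> n"] by (auto simp: \<sigma>_def n_def)
    have "n \<le> poly lp (sz x)" using lp[of x] length_le_sz[of "l x"] by (simp add: n_def)
    then have "(n + 1) * (poly p M + poly q M + M + 1) \<le> (poly lp (sz x) + 1) * (poly p M + poly q M + M + 1)"
      by (intro mult_right_mono) auto
    moreover have "t2 \<le> poly w M"
      using t2(2) M[of n] poly_nat_mono le_trans by blast
    ultimately have "Suc (t1 + Suc (t + t2)) \<le>
        poly (v + (lp + 1) * (pcompose p m + pcompose q m + m + 1) + pcompose w m + 2) (sz x)"
      using t1(2) t(2) by (simp add: poly_pcompose M_def)
    with exec.Seq[OF t1(1) exec.Seq[OF t(1) t2(1)]]
    show "\<exists>t. exec (Seq I (Seq (While G B) E)) (enc x) t (enc (fold (s x) (l x) (i x))) \<and>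
      t \<le> poly (v + (lp + 1) * (pcompose p m + pcompose q m + m + 1) + pcompose w m + 2) (sz x)"
      by blast
  qed
qed

text \<open>If a step adds an amount that depends on the input but not on the accumulator, the
  increments of at most \<open>sz (l x)\<close> steps add up to a polynomial.\<close>

lemma ptime_fold_growth:
  assumes l: "ptime l" and i: "ptime i"
    and s: "ptime (\<lambda>c. s (fst c) (fst (snd c)) (snd (snd c)))"
    and growth: "\<And>x y acc. y \<in> set (l x) \<Longrightarrow> sz (s x y acc) \<le> sz acc + poly r (sz x)"
  shows "ptime (\<lambda>x. fold (s x) (l x) (i x))"
proof -
  obtain p where p: "\<And>x. sz (l x) \<le> poly p (sz x)"
    using l ptime_sz by blast
  obtain q where q: "\<And>x. sz (i x) \<le> poly q (sz x)"
    using i ptime_sz by blast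
  have *: "sz (fold (s x) ys a) \<le> sz a + length ys * poly r (sz x)"
    if "set ys \<subseteq> set (l x)" for x ys a
    using that
  proof (induction ys arbitrary: a)
    case (Cons y ys)
    have "sz (fold (s x) ys (s x y a)) \<le> sz (s x y a) + length ys * poly r (sz x)"
      using Cons by simp
    also have "\<dots> \<le> sz a + poly r (sz x) + length ys * poly r (sz x)"
      using growth[of y x a] Cons.prems by simp
    finally show ?case by simp
  qed simp
  show ?thesis
  proof (rule ptime_fold[OF l i s, of "q + p * r"])
    fix x ys zs assume xs: "l x = ys @ zs"
    have "length ys \<le> length (l x)" using xs by simp
    also have "\<dots> \<le> poly p (sz x)" using length_le_sz p le_trans by blast
    finally have "length ys * poly r (sz x) \<le> poly p (sz x) * poly r (sz x)"
      by (rule mult_right_mono) simp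
    moreover have "sz (fold (s x) ys (i x)) \<le> sz (i x) + length ys * poly r (sz x)"
      using xs by (intro *) simp
    ultimately show "sz (fold (s x) ys (i x)) \<le> poly (q + p * r) (sz x)"
      using q[of x] unfolding poly_add poly_mult by linarith
  qed
qed

section \<open>List functions\<close>

lemma ptime_rev:
  assumes "ptime l"
  shows "ptime (\<lambda>x. rev (l x))"
proof -
  have "ptime (\<lambda>xs :: 'b list. fold (\<lambda>y acc. y # acc) xs [])"
  proof (rule ptime_fold[OF ptime_id ptime_const])
    show "ptime (\<lambda>c :: 'b list \<times> 'b \<times> 'b list. fst (snd c) # snd (snd c))"
      by (intro ptime_Cons ptime_fst ptime_snd ptime_id)
    show "sz (fold (\<lambda>y acc. y # acc) ys []) \<le> poly [:0, 1:] (sz x)"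
      if "x = ys @ zs" for x ys zs :: "'b list"
      using that sz_rev[of ys] by (simp add: sz_append rev_conv_fold)
  qed
  from ptime_comp[OF this assms] show ?thesis by (simp add: rev_conv_fold)
qed

lemma ptime_append:
  assumes "ptime f" "ptime g"
  shows "ptime (\<lambda>x. f x @ g x)"
proof -
  have "ptime (\<lambda>p :: 'b list \<times> 'b list. fold (\<lambda>y acc. y # acc) (rev (fst p)) (snd p))"
  proof (rule ptime_fold)
    show "ptime (\<lambda>c :: ('b list \<times> 'b list) \<times> 'b \<times> 'b list. fst (snd c) # snd (snd c))"
      by (intro ptime_Cons ptime_fst ptime_snd ptime_id)
    show "sz (fold (\<lambda>y acc. y # acc) ys (snd x)) \<le> poly [:0, 1:] (sz x)"
      if "rev (fst x) = ys @ zs" for x :: "'b list \<times> 'b list" and ys zs :: "'b list"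
    proof -
      have "sz (fst x) = sz (ys @ zs)" by (metis that sz_rev)
      moreover have "fold (\<lambda>y acc. y # acc) ys (snd x) = rev ys @ snd x"
        by (simp add: fold_Cons_rev)
      ultimately show ?thesis by (cases x) (simp add: sz_append sz_rev)
    qed
  qed (intro ptime_rev ptime_fst ptime_snd ptime_id)+
  from ptime_comp[OF this ptime_Pair[OF assms]] show ?thesis
    by (simp add: fold_Cons_rev)
qed

lemma fold_rev_map: "fold (\<lambda>y acc. f y # acc) xs acc = rev (map f xs) @ acc"
  by (induction xs arbitrary: acc) auto

lemma ptime_map:
  fixes f :: "'a::enc \<Rightarrow> 'b::enc \<Rightarrow> 'c::enc"
  assumes f: "ptime (\<lambda>c. f (fst c) (snd c))" and l: "ptime l"
  shows "ptime (\<lambda>x. map (f x) (l x))"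
proof -
  obtain p where p: "\<And>c. sz (f (fst c) (snd c)) \<le> poly p (sz c)"
    using f ptime_sz by blast
  obtain q where q: "\<And>x. sz (l x) \<le> poly q (sz x)"
    using l ptime_sz by blast
  have "ptime (\<lambda>x. rev (fold (\<lambda>y acc. f x y # acc) (l x) []))"
  proof (intro ptime_rev ptime_fold_growth[OF l ptime_const])
    show "ptime (\<lambda>c :: 'a \<times> 'b \<times> 'c list. f (fst c) (fst (snd c)) # snd (snd c))"
      using ptime_comp[OF f, of "\<lambda>c :: 'a \<times> 'b \<times> 'c list. (fst c, fst (snd c))"]
      by (intro ptime_Cons ptime_snd ptime_id) (simp add: ptime_Pair ptime_fst ptime_snd ptime_id)
    fix x y and acc :: "'c list"
    assume "y \<in> set (l x)"
    then have "sz y \<le> poly q (sz x)" using sz_mem q[of x] by fastforce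
    then have "sz (x, y) \<le> sz x + poly q (sz x) + 1" by simp
    then have "sz (f x y) \<le> poly p (sz x + poly q (sz x) + 1)"
      using le_trans[OF p[of "(x, y)"] poly_nat_mono] by simp
    then show "sz (f x y # acc) \<le> sz acc + poly (pcompose p ([:0, 1:] + q + 1) + 1) (sz x)"
      by (simp add: poly_pcompose)
  qed
  then show ?thesis by (simp add: fold_rev_map)
qed

lemma fold_rev_filter:
  "fold (\<lambda>y acc. if P y then y # acc else acc) xs acc = rev (filter P xs) @ acc"
  by (induction xs arbitrary: acc) auto

lemma ptime_filter:
  fixes P :: "'a::enc \<Rightarrow> 'b::enc \<Rightarrow> bool"
  assumes P: "ptime (\<lambda>c. P (fst c) (snd c))" and l: "ptime l"
  shows "ptime (\<lambda>x. filter (P x) (l x))"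
proof -
  obtain q where q: "\<And>x. sz (l x) \<le> poly q (sz x)"
    using l ptime_sz by blast
  have "ptime (\<lambda>x. rev (fold (\<lambda>y acc. if P x y then y # acc else acc) (l x) []))"
  proof (intro ptime_rev ptime_fold_growth[OF l ptime_const])
    show "ptime (\<lambda>c :: 'a \<times> 'b \<times> 'b list.
        if P (fst c) (fst (snd c)) then fst (snd c) # snd (snd c) else snd (snd c))"
      using ptime_comp[OF P, of "\<lambda>c :: 'a \<times> 'b \<times> 'b list. (fst c, fst (snd c))"]
      by (intro ptime_if ptime_Cons ptime_snd ptime_fst ptime_id)
        (simp add: ptime_Pair ptime_fst ptime_snd ptime_id)
    fix x y and acc :: "'b list"
    assume "y \<in> set (l x)"
    then have "sz y < poly q (sz x)" using sz_mem q[of x] by fastforce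
    then show "sz (if P x y then y # acc else acc) \<le> sz acc + poly q (sz x)"
      by simp
  qed
  then show ?thesis by (simp add: fold_rev_filter)
qed

lemma ptime_bex:
  assumes "ptime (\<lambda>c. P (fst c) (snd c))" "ptime l"
  shows "ptime (\<lambda>x. \<exists>y\<in>set (l x). P x y)"
  using ptime_not[OF ptime_null[OF ptime_filter[OF assms]]]
  by (rule ptime_recode) (auto simp: filter_empty_conv)

lemma ptime_mem:
  assumes "ptime f" "ptime l"
  shows "ptime (\<lambda>x. f x \<in> set (l x))"
proof -
  have "ptime (\<lambda>x. \<exists>y\<in>set (l x). f x = y)"
    by (intro ptime_bex ptime_eq ptime_comp[OF assms(1)] assms(2) ptime_fst ptime_snd ptime_id)
  then show ?thesis by simp
qed

lemma ptime_concat: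
  assumes "ptime l"
  shows "ptime (\<lambda>x. concat (l x))"
proof -
  have *: "fold (\<lambda>ys acc. acc @ ys) xss acc = acc @ concat xss" for xss :: "'b list list" and acc
    by (induction xss arbitrary: acc) auto
  have sz: "sz (concat xss) \<le> sz xss" for xss :: "'b list list"
    by (induction xss) (auto simp: sz_append)
  have "ptime (\<lambda>xss :: 'b list list. fold (\<lambda>ys acc. acc @ ys) xss [])"
  proof (rule ptime_fold[OF ptime_id ptime_const])
    show "ptime (\<lambda>c :: 'b list list \<times> 'b list \<times> 'b list. snd (snd c) @ fst (snd c))"
      by (intro ptime_append ptime_fst ptime_snd ptime_id)
    show "sz (fold (\<lambda>ys acc. acc @ ys) ys []) \<le> poly [:0, 1:] (sz x)"
      if "x = ys @ zs" for x ys zs :: "'b list list"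
      using that sz[of ys] by (simp add: sz_append *)
  qed
  from ptime_comp[OF this assms] show ?thesis by (simp add: *)
qed

lemma ptime_product:
  assumes "ptime f" "ptime g"
  shows "ptime (\<lambda>x. List.product (f x) (g x))"
  unfolding product_concat_map
  by (intro ptime_concat ptime_map ptime_Pair ptime_comp[OF assms(2)] assms(1)
      ptime_fst ptime_snd ptime_id)

text \<open>Constant lists act as unary numbers, so the equality test on data compares lengths
  without any counter.\<close>

lemma ptime_length_eq:
  assumes "ptime f" "ptime g"
  shows "ptime (\<lambda>x. length (f x) = length (g x))"
proof -
  have "ptime (\<lambda>x. map (\<lambda>_. False) (f x) = map (\<lambda>_. False) (g x))"
    by (intro ptime_eq ptime_map assms ptime_const)
  then show ?thesis by (simp add: map_replicate_const)
qed

subsection \<open>Binary numbers\<close>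

fun bits :: "nat \<Rightarrow> bool list" where
  "bits n = (if n = 0 then [] else odd n # bits (n div 2))"

declare bits.simps [simp del]

lemma enc_nat_bits: "enc n = enc (bits n)"
proof (induction n rule: less_induct)
  case (less n)
  then show ?case
    by (cases "n = 0")
      (simp_all add: enc_nat enc_bool data_of_nat.simps[of n] data_of_nat.simps[of 0] bits.simps)
qed

text \<open>Decrement with borrow, least significant bit first. The test \<open>bs = []\<close>
  keeps the top bit from turning into a leading zero.\<close>

fun pred_bits :: "bool list \<Rightarrow> bool list" where
  "pred_bits [] = []"
| "pred_bits (b # bs) =
     (if b then (if bs = [] then [] else False # bs) else True # pred_bits bs)"

lemma bits_eq_Nil_iff [simp]: "bits n = [] \<longleftrightarrow> n = 0"
  by (simp add: bits.simps[of n])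

lemma pred_bits: "pred_bits (bits n) = bits (n - 1)"
proof (induction n rule: less_induct)
  case (less n)
  consider "n = 0" | "n = 1" | "odd n" "n > 1" | "even n" "n > 1" by (cases n) auto
  then show ?case
  proof cases
    case 3
    then have "(n - 1) div 2 = n div 2" by (auto elim!: oddE)
    moreover have "n div 2 \<noteq> 0" using 3 by auto
    moreover have "bits n = True # bits (n div 2)" using 3 by (simp add: bits.simps[of n])
    moreover have "bits (n - 1) = False # bits ((n - 1) div 2)"
      using 3 bits.simps[of "n - 1"] by (auto elim!: oddE)
    ultimately show ?thesis by simp
  next
    case 4
    then have "(n - 1) div 2 = n div 2 - 1" by (auto elim!: evenE)
    moreover have "bits n = False # bits (n div 2)" using 4 by (simp add: bits.simps[of n])
    moreover have "bits (n - 1) = True # bits ((n - 1) div 2)"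
    proof -
      have "odd (n - 1)" "n - 1 \<noteq> 0" using 4 by presburger+
      then show ?thesis by (subst bits.simps) simp
    qed
    ultimately show ?thesis using 4 less[of "n div 2"] by simp
  qed (simp_all add: bits.simps)
qed

text \<open>Folding over the reversed list builds the suffixes from the most significant end. The
  state keeps each suffix beside its predecessor, because a \<open>True\<close> bit ends the borrow
  and copies the suffix unchanged.\<close>

lemma fold_pred_bits:
  "fold (\<lambda>b (bs, cs). (b # bs, if b then (if bs = [] then [] else False # bs) else True # cs))
     (rev bs) ([], []) = (bs, pred_bits bs)"
  by (induction bs) auto

lemma sz_pred_bits: "sz (pred_bits bs) \<le> 2 * sz bs"
  by (induction bs) (auto simp: enc_bool data_of_bool_def)

lemma ptime_pred:
  assumes "ptime f"
  shows "ptime (\<lambda>x. f x - 1 :: nat)"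
proof -
  let ?s = "\<lambda>b (bs, cs). (b # bs, if b then (if bs = [] then [] else False # bs) else True # cs)"
  have "ptime (\<lambda>bs. snd (fold ?s (rev bs) ([], [])))"
  proof (intro ptime_snd ptime_fold ptime_rev ptime_id ptime_const)
    show "ptime (\<lambda>c :: bool list \<times> bool \<times> bool list \<times> bool list. ?s (fst (snd c)) (snd (snd c)))"
      unfolding case_prod_beta
      by (intro ptime_Pair ptime_Cons ptime_if ptime_null ptime_fst ptime_snd ptime_id ptime_const)
    fix x ys zs :: "bool list"
    assume "rev x = ys @ zs"
    then have x: "x = rev zs @ rev ys" by (metis rev_append rev_rev_ident)
    have "fold ?s ys ([], []) = (rev ys, pred_bits (rev ys))"
      using fold_pred_bits[of "rev ys"] by simp
    then show "sz (fold ?s ys ([], [])) \<le> poly [:1, 3:] (sz x)"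
      using sz_pred_bits[of "rev ys"] unfolding x by (simp add: sz_append)
  qed
  then have "ptime pred_bits" unfolding fold_pred_bits by simp
  then have "ptime (\<lambda>n :: nat. n - 1)"
    by (rule ptime_recode_input) (metis enc_nat_bits pred_bits)
  from ptime_comp[OF this assms] show ?thesis .
qed

lemma ptime_diff_length:
  assumes "ptime f" "ptime l"
  shows "ptime (\<lambda>x. f x - length (l x))"
proof -
  have *: "fold (\<lambda>_ n. n - 1) xs n = n - length xs" for xs :: "'b list" and n :: nat
    by (induction xs arbitrary: n) auto
  \<comment> \<open>Encoding size is not monotone: a digit \<open>1\<close> takes two cells and a
    digit \<open>0\<close> one, so \<open>7\<close> takes six cells and \<open>8\<close> five. A
    smaller number has no more digits, which gives the factor 2.\<close>
  have mono: "sz m \<le> 2 * sz n" if "m \<le> n" for m n :: nat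
    using that
  proof (induction n arbitrary: m rule: less_induct)
    case (less n)
    show ?case
    proof (cases "m = 0")
      case False
      then have "sz (m div 2) \<le> 2 * sz (n div 2)"
        using less.prems by (intro less.IH) (auto simp: div_le_mono)
      then show ?thesis using False less.prems
        by (simp add: enc_nat data_of_nat.simps[of m] data_of_nat.simps[of n] data_of_bool_def)
    qed (simp add: enc_nat data_of_nat.simps)
  qed
  have "ptime (\<lambda>p :: nat \<times> 'b list. fold (\<lambda>_ n. n - 1) (snd p) (fst p))"
  proof (intro ptime_fold ptime_fst ptime_snd ptime_id)
    show "ptime (\<lambda>c :: (nat \<times> 'b list) \<times> 'b \<times> nat. snd (snd c) - 1)"
      by (intro ptime_pred ptime_snd ptime_id)
    show "sz (fold (\<lambda>_ n. n - 1) ys (fst x)) \<le> poly [:0, 2:] (sz x)"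
      for x :: "nat \<times> 'b list" and ys :: "'b list"
      unfolding * using mono[of "fst x - length ys" "fst x"] by (cases x) simp
  qed
  then have "ptime (\<lambda>p :: nat \<times> 'b list. fst p - length (snd p))" unfolding * .
  from ptime_comp[OF this ptime_Pair[OF assms]] show ?thesis by simp
qed

text \<open>The available arithmetic is truncated subtraction, so the comparison is turned into a
  strict one: a nonempty list fits iff something is left after subtracting the length of its
  tail.\<close>

lemma ptime_length_le:
  assumes "ptime f" "ptime l"
  shows "ptime (\<lambda>x. length (l x) \<le> f x)"
proof -
  have "ptime (\<lambda>x. l x = [] \<or> f x - length (tl (l x)) \<noteq> 0)"
    using assms by (intro ptime_disj ptime_null ptime_not ptime_eq ptime_const ptime_diff_length ptime_tl)
  moreover have "(l x = [] \<or> f x - length (tl (l x)) \<noteq> 0) \<longleftrightarrow> length (l x) \<le> f x" for x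
    by (cases "l x") auto
  ultimately show ?thesis by simp
qed

lemma ptime_int_of_nat: "ptime f \<Longrightarrow> ptime (\<lambda>x. int (f x))"
  by (rule ptime_recode[OF ptime_Pair[OF ptime_const[of False]]])
    (auto simp: enc_int enc_nat enc_bool data_of_int_def)

lemma ptime_int_neg: "ptime (f :: 'a::enc \<Rightarrow> int) \<Longrightarrow> ptime (\<lambda>x. f x < 0)"
  by (rule ptime_comp[OF ptime_recode_input[OF ptime_fst'[where 'a = bool and 'b = nat]]])
    (auto simp: enc_int enc_nat enc_bool data_of_int_def)

lemma ptime_nat_abs: "ptime f \<Longrightarrow> ptime (\<lambda>x. nat \<bar>f x\<bar>)"
  by (rule ptime_comp[OF ptime_recode_input[OF ptime_snd'[where 'a = bool and 'b = nat]]])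
    (auto simp: enc_int enc_nat enc_bool data_of_int_def)

section \<open>Trees and their triplets\<close>

definition resolves :: "'a rtree option \<Rightarrow> 'a \<Rightarrow> 'a \<Rightarrow> 'a \<Rightarrow> bool" where
  "resolves T a b c \<longleftrightarrow> consistent (triplet a b c) T"

lemma set_rtree_triplet [simp]: "set_rtree (triplet a b c) = {a, b, c}"
  by (auto simp: triplet_def)

lemma triplet_eq_iff:
  "triplet a b c = triplet x y z \<longleftrightarrow> c = z \<and> (a = x \<and> b = y \<or> a = y \<and> b = x)"
  by (auto simp: triplet_def)

lemma tree_over_join:
  "tree_over A s \<Longrightarrow> tree_over B t \<Longrightarrow> A \<inter> B = {} \<Longrightarrow> tree_over (A \<union> B) (join s t)"
  by (cases s; cases t) (auto intro: binary_tree_on.intros)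

lemma tree_over_Leaf: "tree_over {a} (Some (Leaf a))"
  by (auto intro: binary_tree_on.intros)

lemma tree_over_induct [consumes 1, case_names Empty Leaf join]:
  assumes "tree_over V T"
    and "P {} None" "\<And>a. P {a} (Some (Leaf a))"
    and step: "\<And>A s B t. tree_over A s \<Longrightarrow> tree_over B t \<Longrightarrow> A \<inter> B = {} \<Longrightarrow> P A s \<Longrightarrow> P B t \<Longrightarrow>
      P (A \<union> B) (join s t)"
  shows "P V T"
proof (cases T)
  case None
  then show ?thesis using assms by simp
next
  case (Some t)
  then have "binary_tree_on V t" using assms by simp
  then have "P V (Some t)"
  proof induction
    case (Leaf a)
    then show ?case using assms(3) .
  next
    case (Node A l B r)
    then show ?case using step[of A "Some l" B "Some r"] by simp
  qed
  then show ?thesis by (simp add: Some)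
qed

lemma tree_over_restrict:
  assumes "binary_tree_on V t"
  shows "tree_over (S \<inter> V) (restrict_tree S t)"
  using assms
proof induction
  case (Leaf a)
  then show ?case by (auto intro: binary_tree_on.intros)
next
  case (Node A l B r)
  then show ?case
    unfolding restrict_tree_Node_Upair Int_Un_distrib by (intro tree_over_join) auto
qed

lemma tree_over_bind_restrict:
  "tree_over V T \<Longrightarrow> tree_over (S \<inter> V) (Option.bind T (restrict_tree S))"
  by (cases T) (auto intro: tree_over_restrict)

lemma bind_join_restrict:
  "Option.bind (join s t) (restrict_tree S) =
     join (Option.bind s (restrict_tree S)) (Option.bind t (restrict_tree S))"
proof (cases s; cases t)
  fix l r assume "s = Some l" "t = Some r"
  then show ?thesis
    by (simp add: restrict_tree_Node_Upair del: restrict_tree.simps)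
next
  assume "s = None" then show ?thesis by simp
next
  fix l assume "s = Some l" "t = None" then show ?thesis by (cases "restrict_tree S l") auto
qed auto

lemma tree_over_1:
  assumes "tree_over {a} T" shows "T = Some (Leaf a)"
  using assms binary_tree_on_card_1[of "{a}"] by (cases T) auto

lemma tree_over_2:
  assumes "tree_over {a, b} T" "a \<noteq> b"
  shows "T = Some (Node (Upair (Leaf a) (Leaf b)))"
proof (cases T)
  case (Some t)
  then obtain x y where "x \<noteq> y" "{a, b} = {x, y}" "t = Node (Upair (Leaf x) (Leaf y))"
    using assms binary_tree_on_card_2[of "{a, b}" t] by auto
  then show ?thesis using Some by (auto simp: doubleton_eq_iff)
qed (use assms in auto)

lemma tree_over_empty: "tree_over {} T \<Longrightarrow> T = None"
  using binary_tree_on_finite by (cases T) auto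

text \<open>Restricted to three leaves, each side of the root is empty, a single leaf, a pair or the
  whole triplet, and this determines the join. From here on trees are handled through this recursion
  and \<open>restrict_tree\<close> is not unfolded again.\<close>

lemma resolves_join:
  assumes s: "tree_over A s" and t: "tree_over B t" and AB: "A \<inter> B = {}"
    and d: "distinct [a, b, c]" "a \<in> A \<union> B" "b \<in> A \<union> B" "c \<in> A \<union> B"
  shows "resolves (join s t) a b c \<longleftrightarrow>
    a \<in> A \<and> b \<in> A \<and> c \<in> A \<and> resolves s a b c \<or>
    a \<in> B \<and> b \<in> B \<and> c \<in> B \<and> resolves t a b c \<or>
    a \<in> A \<and> b \<in> A \<and> c \<in> B \<or> a \<in> B \<and> b \<in> B \<and> c \<in> A"
proof -
  let ?S = "{a, b, c}"
  define s' where "s' = Option.bind s (restrict_tree ?S)"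
  define t' where "t' = Option.bind t (restrict_tree ?S)"
  have s': "tree_over (?S \<inter> A) s'" unfolding s'_def using s by (rule tree_over_bind_restrict)
  have t': "tree_over (?S \<inter> B) t'" unfolding t'_def using t by (rule tree_over_bind_restrict)
  have r: "resolves (join s t) a b c \<longleftrightarrow> join s' t' = Some (triplet a b c)"
    "resolves s a b c \<longleftrightarrow> s' = Some (triplet a b c)"
    "resolves t a b c \<longleftrightarrow> t' = Some (triplet a b c)"
    by (simp_all add: resolves_def consistent_def bind_join_restrict s'_def t'_def)
  have N: "X \<inter> {a, b, c} = {} \<Longrightarrow> tree_over (?S \<inter> X) u \<Longrightarrow> u = None" for X u
    using tree_over_empty by (metis inf_commute)
  have D: "a \<noteq> b" "a \<noteq> c" "b \<noteq> c" using d by auto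
  have mem: "x \<in> A \<longleftrightarrow> x \<notin> B" if "x \<in> A \<union> B" for x using that AB by auto
  show ?thesis
  proof (cases "a \<in> A"; cases "b \<in> A"; cases "c \<in> A")
    assume m: "a \<in> A" "b \<in> A" "c \<in> A"
    then have "?S \<inter> B = {}" using mem d by auto
    then have "t' = None" using t' tree_over_empty by metis
    then show ?thesis using m mem d unfolding r by (cases s') auto
  next
    assume m: "a \<in> A" "b \<in> A" "c \<notin> A"
    then have "?S \<inter> A = {a, b}" "?S \<inter> B = {c}" using mem d by auto
    then have "s' = Some (Node (Upair (Leaf a) (Leaf b)))" "t' = Some (Leaf c)"
      using s' t' tree_over_1 tree_over_2 D by metis+
    then show ?thesis using m mem d unfolding r by (simp add: triplet_def)
  next
    assume m: "a \<in> A" "b \<notin> A" "c \<in> A"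
    then have "?S \<inter> A = {a, c}" "?S \<inter> B = {b}" using mem d by auto
    then have "s' = Some (Node (Upair (Leaf a) (Leaf c)))" "t' = Some (Leaf b)"
      using s' t' tree_over_1 tree_over_2 D by metis+
    then show ?thesis using m mem d unfolding r by (simp add: triplet_def)
  next
    assume m: "a \<notin> A" "b \<in> A" "c \<in> A"
    then have "?S \<inter> A = {b, c}" "?S \<inter> B = {a}" using mem d by auto
    then have "s' = Some (Node (Upair (Leaf b) (Leaf c)))" "t' = Some (Leaf a)"
      using s' t' tree_over_1 tree_over_2 D by metis+
    then show ?thesis using m mem d unfolding r by (simp add: triplet_def)
  next
    assume m: "a \<notin> A" "b \<notin> A" "c \<in> A"
    then have "?S \<inter> B = {a, b}" "?S \<inter> A = {c}" using mem d by auto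
    then have "t' = Some (Node (Upair (Leaf a) (Leaf b)))" "s' = Some (Leaf c)"
      using s' t' tree_over_1 tree_over_2 D by metis+
    then show ?thesis using m mem d unfolding r by (simp add: triplet_def)
  next
    assume m: "a \<notin> A" "b \<in> A" "c \<notin> A"
    then have "?S \<inter> B = {a, c}" "?S \<inter> A = {b}" using mem d by auto
    then have "t' = Some (Node (Upair (Leaf a) (Leaf c)))" "s' = Some (Leaf b)"
      using s' t' tree_over_1 tree_over_2 D by metis+
    then show ?thesis using m mem d unfolding r by (simp add: triplet_def)
  next
    assume m: "a \<in> A" "b \<notin> A" "c \<notin> A"
    then have "?S \<inter> B = {b, c}" "?S \<inter> A = {a}" using mem d by auto
    then have "t' = Some (Node (Upair (Leaf b) (Leaf c)))" "s' = Some (Leaf a)"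
      using s' t' tree_over_1 tree_over_2 D by metis+
    then show ?thesis using m mem d unfolding r by (simp add: triplet_def)
  next
    assume m: "a \<notin> A" "b \<notin> A" "c \<notin> A"
    then have "?S \<inter> A = {}" using mem d by auto
    then have "s' = None" using s' tree_over_empty by metis
    then show ?thesis using m mem d unfolding r by (cases t') auto
  qed
qed

lemma tree_over_exists: "finite V \<Longrightarrow> \<exists>T. tree_over V T"
proof (induction rule: finite_induct)
  case empty
  then show ?case by (intro exI[of _ None]) simp
next
  case (insert a V)
  then obtain T where "tree_over V T" by blast
  then have "tree_over ({a} \<union> V) (join (Some (Leaf a)) T)"
    using insert by (intro tree_over_join tree_over_Leaf) auto
  then show ?case by auto
qed

lemma resolves_restrict:
  assumes "tree_over V T" "S \<subseteq> V"
  shows "\<exists>T'. tree_over S T' \<and>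
    (\<forall>a\<in>S. \<forall>b\<in>S. \<forall>c\<in>S. distinct [a, b, c] \<longrightarrow> (resolves T' a b c \<longleftrightarrow> resolves T a b c))"
  using assms
proof (induction arbitrary: S rule: tree_over_induct)
  case Empty
  then show ?case by (intro exI[of _ None]) simp
next
  case (Leaf a)
  then show ?case
  proof (cases "S = {}")
    case True
    then show ?thesis by (intro exI[of _ None]) simp
  next
    case False
    then have "S = {a}" using Leaf by auto
    then show ?thesis using tree_over_Leaf by (intro exI[of _ "Some (Leaf a)"]) auto
  qed
next
  case (join A s B t)
  obtain s' where s': "tree_over (S \<inter> A) s'"
    "\<forall>a\<in>S \<inter> A. \<forall>b\<in>S \<inter> A. \<forall>c\<in>S \<inter> A. distinct [a, b, c] \<longrightarrow> (resolves s' a b c \<longleftrightarrow> resolves s a b c)"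
    using join.IH(1)[of "S \<inter> A"] by auto
  obtain t' where t': "tree_over (S \<inter> B) t'"
    "\<forall>a\<in>S \<inter> B. \<forall>b\<in>S \<inter> B. \<forall>c\<in>S \<inter> B. distinct [a, b, c] \<longrightarrow> (resolves t' a b c \<longleftrightarrow> resolves t a b c)"
    using join.IH(2)[of "S \<inter> B"] by auto
  have disj: "(S \<inter> A) \<inter> (S \<inter> B) = {}" using join by auto
  have S: "S = S \<inter> A \<union> S \<inter> B" using join by auto
  have "tree_over S (join s' t')"
    by (subst S) (intro tree_over_join s' t' disj)
  moreover have "resolves (join s' t') a b c \<longleftrightarrow> resolves (join s t) a b c"
    if "a \<in> S" "b \<in> S" "c \<in> S" "distinct [a, b, c]" for a b c
  proof -
    have abc: "a \<in> A \<union> B" "b \<in> A \<union> B" "c \<in> A \<union> B" using that join by auto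
    then have "a \<in> S \<inter> A \<union> S \<inter> B" "b \<in> S \<inter> A \<union> S \<inter> B" "c \<in> S \<inter> A \<union> S \<inter> B"
      using that by auto
    note r' = resolves_join[OF s'(1) t'(1) disj that(4) this]
    show ?thesis
      unfolding r' resolves_join[OF join.hyps that(4) abc]
      using s'(2) t'(2) that by (metis Int_iff)
  qed
  ultimately show ?case by blast
qed

text \<open>
  A ternary relation \<open>r a b c\<close> stands for $ab|c$. Seen from a leaf \<open>a\<close>, the other leaves are
  preordered by the height at which they branch off from the path between \<open>a\<close> and the root:
  \<open>b\<close> branches off strictly before \<open>c\<close> iff $ab|c$, and at the same node as \<open>c\<close> iff $bc|a$.
\<close>

definition dense_rel :: "'a set \<Rightarrow> ('a \<Rightarrow> 'a \<Rightarrow> 'a \<Rightarrow> bool) \<Rightarrow> bool" where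
  "dense_rel V r \<longleftrightarrow> (\<forall>a\<in>V. \<forall>b\<in>V. \<forall>c\<in>V. distinct [a, b, c] \<longrightarrow>
     (r a b c \<longleftrightarrow> r b a c) \<and> (r a b c \<or> r a c b \<or> r b c a) \<and> \<not> (r a b c \<and> r a c b))"

definition branch_le :: "('a \<Rightarrow> 'a \<Rightarrow> 'a \<Rightarrow> bool) \<Rightarrow> 'a \<Rightarrow> 'a \<Rightarrow> 'a \<Rightarrow> bool" where
  "branch_le r a b c \<longleftrightarrow> r a b c \<or> r b c a"

text \<open>The triplets on \<open>a\<close> and two of \<open>b\<close>, \<open>c\<close>, \<open>d\<close> entail $bc|d$.\<close>

definition forces :: "('a \<Rightarrow> 'a \<Rightarrow> 'a \<Rightarrow> bool) \<Rightarrow> 'a \<Rightarrow> 'a \<Rightarrow> 'a \<Rightarrow> 'a \<Rightarrow> bool" where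
  "forces r a b c d \<longleftrightarrow> r a b d \<and> r a c d \<or> r b c a \<and> r a d b \<and> r a d c"

text \<open>The negated condition says that seen from \<open>a\<close> the three leaves branch off
  at one node. Only then do the triplets with \<open>a\<close> leave the triplet on
  \<open>b\<close>, \<open>c\<close>, \<open>d\<close> open.\<close>

definition splits :: "('a \<Rightarrow> 'a \<Rightarrow> 'a \<Rightarrow> bool) \<Rightarrow> 'a \<Rightarrow> 'a \<Rightarrow> 'a \<Rightarrow> 'a \<Rightarrow> bool" where
  "splits r a b c d \<longleftrightarrow> \<not> (r b c a \<and> r c d a \<and> r b d a)"

definition branch_trans :: "('a \<Rightarrow> 'a \<Rightarrow> 'a \<Rightarrow> bool) \<Rightarrow> 'a \<Rightarrow> 'a \<Rightarrow> 'a \<Rightarrow> 'a \<Rightarrow> bool" where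
  "branch_trans r a b c d \<longleftrightarrow> (branch_le r a b c \<and> branch_le r a c d \<longrightarrow> branch_le r a b d)"

lemma dense_rel_mono: "dense_rel V r \<Longrightarrow> W \<subseteq> V \<Longrightarrow> dense_rel W r"
  unfolding dense_rel_def by blast

text \<open>\<open>dense_rel\<close> states one exclusion only; quantifying over all orders of the
  three leaves supplies the others, so exactly one resolution holds.\<close>

lemma dense_relD:
  assumes "dense_rel V r" "a \<in> V" "b \<in> V" "c \<in> V" "distinct [a, b, c]"
  shows "r a b c \<longleftrightarrow> r b a c" "r a c b \<longleftrightarrow> r c a b" "r b c a \<longleftrightarrow> r c b a"
    "r a b c \<and> \<not> r a c b \<and> \<not> r b c a \<or> \<not> r a b c \<and> r a c b \<and> \<not> r b c a \<or>
     \<not> r a b c \<and> \<not> r a c b \<and> r b c a"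
proof -
  have *: "(r x y z \<longleftrightarrow> r y x z) \<and> (r x y z \<or> r x z y \<or> r y z x) \<and> \<not> (r x y z \<and> r x z y)"
    if "{x, y, z} \<subseteq> V" "distinct [x, y, z]" for x y z
    using assms(1)[unfolded dense_rel_def, rule_format, of x y z] that by blast
  have ne: "a \<noteq> b" "a \<noteq> c" "b \<noteq> c" "b \<noteq> a" "c \<noteq> a" "c \<noteq> b" using assms(5) by auto
  have **: "(r x y z \<longleftrightarrow> r y x z) \<and> (r x y z \<or> r x z y \<or> r y z x) \<and> \<not> (r x y z \<and> r x z y)"
    if "x \<in> V" "y \<in> V" "z \<in> V" "x \<noteq> y" "x \<noteq> z" "y \<noteq> z" for x y z
    using that by (intro *) simp_all
  note V = assms(2-4)
  show "r a b c \<longleftrightarrow> r b a c" "r a c b \<longleftrightarrow> r c a b" "r b c a \<longleftrightarrow> r c b a"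
    using **[of a b c] **[of a c b] **[of b c a] V ne by blast+
  show "r a b c \<and> \<not> r a c b \<and> \<not> r b c a \<or> \<not> r a b c \<and> r a c b \<and> \<not> r b c a \<or>
     \<not> r a b c \<and> \<not> r a c b \<and> r b c a"
    using **[of a b c, OF V ne(1-3)] **[of a c b] **[of b c a] **[of b a c] **[of c a b] V ne by blast
qed

lemma dense_rel_resolves:
  assumes "tree_over V T"
  shows "dense_rel V (resolves T)"
  using assms
proof (induction rule: tree_over_induct)
  case (join A s B t)
  have *: "x \<in> A \<longleftrightarrow> x \<notin> B" if "x \<in> A \<union> B" for x using that join.hyps(3) by auto
  show ?case
    unfolding dense_rel_def
  proof (intro ballI impI)
    fix a b c assume abc: "a \<in> A \<union> B" "b \<in> A \<union> B" "c \<in> A \<union> B" "distinct [a, b, c]"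
    note r = resolves_join[OF join.hyps]
    note m = *[OF abc(1)] *[OF abc(2)] *[OF abc(3)]
    have s: "{a, b, c} \<subseteq> A \<Longrightarrow> (resolves s a b c \<longleftrightarrow> resolves s b a c) \<and> (resolves s a b c \<or> resolves s a c b \<or> resolves s b c a) \<and> \<not> (resolves s a b c \<and> resolves s a c b)"
      and t: "{a, b, c} \<subseteq> B \<Longrightarrow> (resolves t a b c \<longleftrightarrow> resolves t b a c) \<and> (resolves t a b c \<or> resolves t a c b \<or> resolves t b c a) \<and> \<not> (resolves t a b c \<and> resolves t a c b)"
      using join.IH(1)[unfolded dense_rel_def, rule_format, of a b c]
        join.IH(2)[unfolded dense_rel_def, rule_format, of a b c] abc(4) by blast+
    have ne: "b \<noteq> a" "c \<noteq> a" "c \<noteq> b" using abc(4) by auto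
    show "(resolves (join s t) a b c \<longleftrightarrow> resolves (join s t) b a c) \<and>
      (resolves (join s t) a b c \<or> resolves (join s t) a c b \<or> resolves (join s t) b c a) \<and>
      \<not> (resolves (join s t) a b c \<and> resolves (join s t) a c b)"
      using r[of a b c] r[of b a c] r[of a c b] r[of b c a] abc m ne s t
      by (cases "a \<in> A"; cases "b \<in> A"; cases "c \<in> A") simp_all
  qed
qed (auto simp: dense_rel_def)

text \<open>These are the two laws that a conflict violates. Each distribution of the four leaves
  over the two sides of the root either decides the claim or leaves it to one side.\<close>

lemma resolves_pivot:
  assumes "tree_over V T" "distinct [a, b, c, d]" "{a, b, c, d} \<subseteq> V"
  shows "branch_trans (resolves T) a b c d"
    and "forces (resolves T) a b c d \<Longrightarrow> resolves T b c d"
proof -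
  have "branch_trans (resolves T) a b c d \<and> (forces (resolves T) a b c d \<longrightarrow> resolves T b c d)"
    using assms
  proof (induction rule: tree_over_induct)
    case (join A s B t)
    have *: "x \<in> A \<longleftrightarrow> x \<notin> B" if "x \<in> A \<union> B" for x using that join.hyps(3) by auto
    have abcd: "a \<in> A \<union> B" "b \<in> A \<union> B" "c \<in> A \<union> B" "d \<in> A \<union> B" using join.prems by auto
    note m = *[OF abcd(1)] *[OF abcd(2)] *[OF abcd(3)] *[OF abcd(4)]
    have ne: "b \<noteq> a" "c \<noteq> a" "d \<noteq> a" "c \<noteq> b" "d \<noteq> b" "d \<noteq> c" using join.prems(1) by auto
    note r = resolves_join[OF join.hyps]
    show ?case
      unfolding branch_trans_def branch_le_def forces_def
      using r[of a b c] r[of b c a] r[of a c d] r[of c d a] r[of a b d] r[of b d a]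
        r[of a d b] r[of a d c] r[of b c d] abcd m ne join.prems join.IH
      unfolding branch_trans_def branch_le_def forces_def
      by (cases "a \<in> A"; cases "b \<in> A"; cases "c \<in> A"; cases "d \<in> A") simp_all
  qed auto
  then show "branch_trans (resolves T) a b c d"
    and "forces (resolves T) a b c d \<Longrightarrow> resolves T b c d" by auto
qed

text \<open>The leaves splitting a triplet are the other leaves below its least common ancestor.\<close>

lemma splits_laminar:
  assumes "tree_over V T" "distinct [b, c, d]" "distinct [b', c', d']"
    and "{b, c, d, b', c', d'} \<subseteq> V" "X \<subseteq> V - {b, c, d, b', c', d'}"
    and "x \<in> X" "splits (resolves T) x b c d" "splits (resolves T) x b' c' d'"
  shows "{y \<in> X. splits (resolves T) y b c d} \<subseteq> {y \<in> X. splits (resolves T) y b' c' d'} \<or>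
    {y \<in> X. splits (resolves T) y b' c' d'} \<subseteq> {y \<in> X. splits (resolves T) y b c d}"
  using assms
proof (induction arbitrary: X rule: tree_over_induct)
  case (join A s B t)
  note r = resolves_join[OF join.hyps]
  have mem: "y \<in> B \<longleftrightarrow> y \<notin> A" if "y \<in> A \<union> B" for y using that join.hyps(3) by auto
  have r': "resolves (join s t) b c d \<longleftrightarrow>
      (if b \<in> A \<and> c \<in> A \<and> d \<in> A then resolves s b c d
       else if b \<in> B \<and> c \<in> B \<and> d \<in> B then resolves t b c d
       else (b \<in> A \<longleftrightarrow> c \<in> A))"
    if "distinct [b, c, d]" "b \<in> A \<union> B" "c \<in> A \<union> B" "d \<in> A \<union> B" for b c d
    using r[OF that] mem[OF that(2)] mem[OF that(3)] mem[OF that(4)]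
    by (cases "b \<in> A"; cases "c \<in> A"; cases "d \<in> A") simp_all
  have sp: "splits (resolves (join s t)) y b c d \<longleftrightarrow>
      (if {b, c, d} \<subseteq> A then y \<in> A \<and> splits (resolves s) y b c d
       else if {b, c, d} \<subseteq> B then y \<in> B \<and> splits (resolves t) y b c d else True)"
    if "distinct [b, c, d]" "{b, c, d} \<subseteq> A \<union> B" "y \<in> A \<union> B - {b, c, d}" for y b c d
  proof -
    have *: "b \<in> A \<union> B" "c \<in> A \<union> B" "d \<in> A \<union> B" "y \<in> A \<union> B"
      and "y \<noteq> b" "y \<noteq> c" "y \<noteq> d" "b \<noteq> c" "b \<noteq> d" "c \<noteq> d"
      using that by auto
    then show ?thesis
      using r'[of b c y] r'[of c d y] r'[of b d y] *[THEN mem]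
      unfolding splits_def
      by (cases "y \<in> A"; cases "b \<in> A"; cases "c \<in> A"; cases "d \<in> A") simp_all
  qed
  have all: "splits (resolves (join s t)) y b c d"
    if "distinct [b, c, d]" "{b, c, d} \<subseteq> A \<union> B" "\<not> {b, c, d} \<subseteq> A" "\<not> {b, c, d} \<subseteq> B"
      "y \<in> A \<union> B - {b, c, d}" for y b c d
    unfolding sp[OF that(1,2,5)] if_not_P[OF that(3)] if_not_P[OF that(4)] ..
  have inA: "splits (resolves (join s t)) y b c d \<longleftrightarrow> y \<in> A \<and> splits (resolves s) y b c d"
    if "distinct [b, c, d]" "{b, c, d} \<subseteq> A" "y \<in> A \<union> B - {b, c, d}" for y b c d
    using sp[OF that(1) le_supI1[OF that(2)] that(3)] unfolding if_P[OF that(2)] .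
  have inB: "splits (resolves (join s t)) y b c d \<longleftrightarrow> y \<in> B \<and> splits (resolves t) y b c d"
    if "distinct [b, c, d]" "{b, c, d} \<subseteq> B" "y \<in> A \<union> B - {b, c, d}" for y b c d
  proof -
    have "\<not> {b, c, d} \<subseteq> A" using that(2) join.hyps(3) by auto
    with sp[OF that(1) le_supI2[OF that(2)] that(3)] show ?thesis
      by (simp only: if_P[OF that(2)] if_False)
  qed
  have V: "{b, c, d} \<subseteq> A \<union> B" "{b', c', d'} \<subseteq> A \<union> B" using join.prems(3) by simp_all
  have X: "y \<in> A \<union> B - {b, c, d}" "y \<in> A \<union> B - {b', c', d'}" if "y \<in> X" for y
    using subsetD[OF join.prems(4) that] by simp_all
  note x = X[OF join.prems(5)]
  \<comment> \<open>A triplet straddling the root is split by all of \<open>X\<close>. Two triplets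
    on the same side are compared within that side, and two on different sides share no splitting
    leaf, contrary to the choice of \<open>x\<close>.\<close>
  consider "\<not> {b, c, d} \<subseteq> A" "\<not> {b, c, d} \<subseteq> B" | "\<not> {b', c', d'} \<subseteq> A" "\<not> {b', c', d'} \<subseteq> B"
    | "{b, c, d} \<subseteq> A" "{b', c', d'} \<subseteq> A" | "{b, c, d} \<subseteq> B" "{b', c', d'} \<subseteq> B"
    | "{b, c, d} \<subseteq> A" "{b', c', d'} \<subseteq> B" | "{b, c, d} \<subseteq> B" "{b', c', d'} \<subseteq> A"
    by argo
  then show ?case
  proof cases
    case 1
    then show ?thesis using all[OF join.prems(1) V(1) _ _ X(1)] by blast
  next
    case 2
    then show ?thesis using all[OF join.prems(2) V(2) _ _ X(2)] by blast
  next
    case 3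
    then have eq: "{y \<in> X. splits (resolves (join s t)) y b c d} = {y \<in> X \<inter> A. splits (resolves s) y b c d}"
      "{y \<in> X. splits (resolves (join s t)) y b' c' d'} = {y \<in> X \<inter> A. splits (resolves s) y b' c' d'}"
      using inA[OF join.prems(1) _ X(1)] inA[OF join.prems(2) _ X(2)] by blast+
    show ?thesis
      unfolding eq
    proof (rule join.IH(1)[OF join.prems(1,2)])
      show "{b, c, d, b', c', d'} \<subseteq> A" using 3 by simp
      show "X \<inter> A \<subseteq> A - {b, c, d, b', c', d'}" using join.prems(4) by blast
      show "x \<in> X \<inter> A" "splits (resolves s) x b c d" "splits (resolves s) x b' c' d'"
        using eq join.prems(5-7) by blast+
    qed
  next
    case 4
    then have eq: "{y \<in> X. splits (resolves (join s t)) y b c d} = {y \<in> X \<inter> B. splits (resolves t) y b c d}"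
      "{y \<in> X. splits (resolves (join s t)) y b' c' d'} = {y \<in> X \<inter> B. splits (resolves t) y b' c' d'}"
      using inB[OF join.prems(1) _ X(1)] inB[OF join.prems(2) _ X(2)] by blast+
    show ?thesis
      unfolding eq
    proof (rule join.IH(2)[OF join.prems(1,2)])
      show "{b, c, d, b', c', d'} \<subseteq> B" using 4 by simp
      show "X \<inter> B \<subseteq> B - {b, c, d, b', c', d'}" using join.prems(4) by blast
      show "x \<in> X \<inter> B" "splits (resolves t) x b c d" "splits (resolves t) x b' c' d'"
        using eq join.prems(5-7) by blast+
    qed
  next
    case 5
    then show ?thesis
      using inA[OF join.prems(1) _ x(1)] inB[OF join.prems(2) _ x(2)] join.prems(6,7) mem[of x] by blast
  next
    case 6
    then show ?thesis
      using inB[OF join.prems(1) _ x(1)] inA[OF join.prems(2) _ x(2)] join.prems(6,7) mem[of x] by blast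
  qed
qed auto

section \<open>Inserting leaves into a tree\<close>

lemma branch_max_exists:
  assumes "finite Y" "Y \<noteq> {}" "a \<notin> Y" "dense_rel (insert a Y) r"
    and "\<And>b c d. distinct [b, c, d] \<Longrightarrow> {b, c, d} \<subseteq> Y \<Longrightarrow> branch_trans r a b c d"
  shows "\<exists>m\<in>Y. \<forall>b\<in>Y - {m}. branch_le r a b m"
  using assms
proof (induction rule: finite_ne_induct)
  case (insert y Y)
  have "dense_rel (insert a Y) r" using insert.prems(2) by (rule dense_rel_mono) auto
  then obtain m where m: "m \<in> Y" "\<forall>b\<in>Y - {m}. branch_le r a b m"
    using insert.IH insert.prems by auto
  have ym: "y \<noteq> m" "y \<noteq> a" "m \<noteq> a" using m insert by auto
  show ?case
  proof (cases "branch_le r a y m")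
    case True
    then show ?thesis using m by auto
  next
    case False
    then have le: "branch_le r a m y"
      using dense_relD[OF insert.prems(2), of a m y] m(1) ym
      unfolding branch_le_def by auto
    have "branch_le r a b y" if "b \<in> insert y Y - {y}" for b
    proof (cases "b = m")
      case False
      then have "branch_trans r a b m y"
        using that m ym by (intro insert.prems(3)) auto
      then show ?thesis using le m False that unfolding branch_trans_def by auto
    qed (use le in simp)
    then show ?thesis by blast
  qed
qed simp

text \<open>
  The new leaf hangs below the spine of a caterpillar whose other subtrees are the
  restrictions of \<open>T0\<close> to the classes of leaves branching off at the same node.
\<close>

lemma insert_leaf:
  assumes "finite Y" "tree_over Y T0" "a \<notin> Y" "dense_rel (insert a Y) r"
    and "\<And>b c d. distinct [b, c, d] \<Longrightarrow> {b, c, d} \<subseteq> Y \<Longrightarrow> branch_trans r a b c d"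
  shows "\<exists>T. tree_over (insert a Y) T \<and>
    (\<forall>b\<in>Y. \<forall>c\<in>Y. b \<noteq> c \<longrightarrow> (resolves T a b c \<longleftrightarrow> r a b c) \<and> (resolves T b c a \<longleftrightarrow> r b c a)) \<and>
    (\<forall>b\<in>Y. \<forall>c\<in>Y. \<forall>d\<in>Y. distinct [b, c, d] \<and> \<not> splits r a b c d \<longrightarrow>
       (resolves T b c d \<longleftrightarrow> resolves T0 b c d))"
  using assms
proof (induction "card Y" arbitrary: Y T0 rule: less_induct)
  case less
  show ?case
  proof (cases "Y = {}")
    case True
    then show ?thesis using tree_over_Leaf by (intro exI[of _ "Some (Leaf a)"]) auto
  next
    case False
    obtain m where m: "m \<in> Y" "\<forall>b\<in>Y - {m}. branch_le r a b m"
      using branch_max_exists[OF less.prems(1) False less.prems(3-5)] by blast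
    \<comment> \<open>\<open>B\<close> is the top class of the preorder, the leaves branching off
      together with the maximum \<open>m\<close>. It becomes one side of the root, and all other
      leaves join \<open>a\<close> on the other side.\<close>
    define B where "B = {b \<in> Y. b = m \<or> r b m a}"
    define Y' where "Y' = Y - B"
    have Y: "Y = Y' \<union> B" "Y' \<inter> B = {}" "Y' \<subseteq> Y" "B \<subseteq> Y" "m \<in> B"
      using m(1) by (auto simp: Y'_def B_def)
    have aY: "a \<notin> Y'" "a \<notin> B" "m \<noteq> a" using less.prems(3) Y(3-5) by auto
    have D: "(r x y z \<longleftrightarrow> r y x z) \<and> (r x z y \<longleftrightarrow> r z x y) \<and> (r y z x \<longleftrightarrow> r z y x) \<and>
        (r x y z \<and> \<not> r x z y \<and> \<not> r y z x \<or> \<not> r x y z \<and> r x z y \<and> \<not> r y z x \<or>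
         \<not> r x y z \<and> \<not> r x z y \<and> r y z x)"
      if "x \<in> insert a Y" "y \<in> insert a Y" "z \<in> insert a Y" "x \<noteq> y" "x \<noteq> z" "y \<noteq> z" for x y z
    proof -
      have "distinct [x, y, z]" using that by simp
      from dense_relD[OF less.prems(4) that(1-3) this] show ?thesis by blast
    qed
    have Da: "(r a b c \<longleftrightarrow> r b a c) \<and> (r a c b \<longleftrightarrow> r c a b) \<and> (r b c a \<longleftrightarrow> r c b a) \<and>
        (r a b c \<and> \<not> r a c b \<and> \<not> r b c a \<or> \<not> r a b c \<and> r a c b \<and> \<not> r b c a \<or>
         \<not> r a b c \<and> \<not> r a c b \<and> r b c a)"
      if "b \<in> Y" "c \<in> Y" "b \<noteq> c" for b c
      using that less.prems(3) by (intro D) auto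
    have tr: "branch_le r a b d" if "branch_le r a b c" "branch_le r a c d"
      "b \<in> Y" "c \<in> Y" "d \<in> Y" "b \<noteq> c" "b \<noteq> d" "c \<noteq> d" for b c d
      using less.prems(5)[of b c d] that unfolding branch_trans_def by simp
    have BB: "r b c a" if bc: "b \<in> B" "c \<in> B" "b \<noteq> c" for b c
    proof -
      have Y: "b \<in> Y" "c \<in> Y" and B: "b = m \<or> r b m a" "c = m \<or> r c m a"
        using bc by (auto simp: B_def)
      show ?thesis
      proof (cases "b = m \<or> c = m")
        case True
        then show ?thesis using B Da[OF Y bc(3)] bc(3) by blast
      next
        case False
        then have ne: "b \<noteq> m" "c \<noteq> m" "m \<noteq> b" "m \<noteq> c" by auto
        then have "r b m a" "r m b a" "r c m a" "r m c a"
          using B Da[OF Y(1) m(1) ne(1)] Da[OF Y(2) m(1) ne(2)] by simp_all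
        then have "branch_le r a b m" "branch_le r a m c" "branch_le r a c m" "branch_le r a m b"
          unfolding branch_le_def by blast+
        then have "branch_le r a b c" "branch_le r a c b"
          using tr[OF _ _ Y(1) m(1) Y(2) ne(1) bc(3) ne(4)] tr[OF _ _ Y(2) m(1) Y(1) ne(2) bc(3)[symmetric] ne(3)]
          by blast+
        then show ?thesis using Da[OF Y bc(3)] unfolding branch_le_def by argo
      qed
    qed
    have YB: "r a b c" if bc: "b \<in> Y'" "c \<in> B" for b c
    proof -
      have b: "b \<in> Y" "b \<noteq> m" "\<not> r b m a" and c: "c \<in> Y" "b \<noteq> c" "c = m \<or> r c m a"
        using bc unfolding Y'_def B_def by auto
      then have bm: "branch_le r a b m" using m by auto
      then have abm: "r a b m" using b unfolding branch_le_def by blast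
      then have nmb: "\<not> branch_le r a m b"
        using Da[OF b(1) m(1) b(2)] unfolding branch_le_def by argo
      show ?thesis
      proof (cases "c = m")
        case False
        then have cm: "branch_le r a m c" "branch_le r a c m"
          using Da[OF c(1) m(1) False] c(3) unfolding branch_le_def by blast+
        have "branch_le r a b c" "\<not> branch_le r a c b"
          using tr[OF bm cm(1) b(1) m(1) c(1) b(2) c(2)] tr[OF cm(1) _ m(1) c(1) b(1)]
            nmb b(2) c(2) False by blast+
        then show ?thesis
          using Da[OF b(1) c(1,2)] unfolding branch_le_def by blast
      qed (use abm in simp)
    qed
    obtain T1 where T1: "tree_over Y' T1"
      "\<forall>b\<in>Y'. \<forall>c\<in>Y'. \<forall>d\<in>Y'. distinct [b, c, d] \<longrightarrow> (resolves T1 b c d \<longleftrightarrow> resolves T0 b c d)"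
      using resolves_restrict[OF less.prems(2) Y(3)] by blast
    obtain T2 where T2: "tree_over B T2"
      "\<forall>b\<in>B. \<forall>c\<in>B. \<forall>d\<in>B. distinct [b, c, d] \<longrightarrow> (resolves T2 b c d \<longleftrightarrow> resolves T0 b c d)"
      using resolves_restrict[OF less.prems(2) Y(4)] by blast
    have "card Y' < card Y"
      using Y(2-5) less.prems(1) by (intro psubset_card_mono) auto
    moreover have "finite Y'" using less.prems(1) Y(3) finite_subset by blast
    moreover have "dense_rel (insert a Y') r"
      using less.prems(4) by (rule dense_rel_mono) (use Y(3) in auto)
    moreover have "branch_trans r a b c d" if "distinct [b, c, d]" "{b, c, d} \<subseteq> Y'" for b c d
      using that Y(3) by (intro less.prems(5)) auto
    ultimately obtain T' where T': "tree_over (insert a Y') T'"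
      "\<forall>b\<in>Y'. \<forall>c\<in>Y'. b \<noteq> c \<longrightarrow> (resolves T' a b c \<longleftrightarrow> r a b c) \<and> (resolves T' b c a \<longleftrightarrow> r b c a)"
      "\<forall>b\<in>Y'. \<forall>c\<in>Y'. \<forall>d\<in>Y'. distinct [b, c, d] \<and> \<not> splits r a b c d \<longrightarrow>
         (resolves T' b c d \<longleftrightarrow> resolves T1 b c d)"
      using less.hyps[OF _ _ T1(1) aY(1)] by blast
    have disj: "insert a Y' \<inter> B = {}" using Y(2) aY by auto
    have un: "insert a Y' \<union> B = insert a Y" using Y(1) by simp
    define T where "T = join T' T2"
    have "tree_over (insert a Y) T"
      using tree_over_join[OF T'(1) T2(1) disj] unfolding un T_def .
    note R = resolves_join[OF T'(1) T2(1) disj, folded T_def]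
    have mem: "x \<in> Y' \<longleftrightarrow> x \<notin> B" if "x \<in> Y" for x
      using that unfolding Y'_def by simp
    have "(resolves T a b c \<longleftrightarrow> r a b c) \<and> (resolves T b c a \<longleftrightarrow> r b c a)"
      if bc: "b \<in> Y" "c \<in> Y" "b \<noteq> c" for b c
    proof -
      have ne: "a \<noteq> b" "a \<noteq> c" "b \<noteq> a" "c \<noteq> a" using bc less.prems(3) by auto
      consider "b \<in> Y'" "c \<in> Y'" "b \<notin> B" "c \<notin> B" | "b \<in> B" "c \<in> B" "b \<notin> Y'" "c \<notin> Y'"
        | "b \<in> B" "c \<in> Y'" "b \<notin> Y'" "c \<notin> B" | "b \<in> Y'" "c \<in> B" "b \<notin> B" "c \<notin> Y'"
        using mem[OF bc(1)] mem[OF bc(2)] by argo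
      then show ?thesis
      proof cases
        case 1
        then show ?thesis using R[of a b c] R[of b c a] T'(2) bc(3) ne aY by simp
      next
        case 2
        then have "resolves T b c a" "\<not> resolves T a b c"
          using R[of a b c] R[of b c a] bc(3) ne aY by simp_all
        then show ?thesis using BB[OF 2(1,2) bc(3)] Da[OF bc] by blast
      next
        case 3
        then have "\<not> resolves T b c a" "\<not> resolves T a b c"
          using R[of a b c] R[of b c a] bc(3) ne aY by simp_all
        then show ?thesis using YB[OF 3(2,1)] Da[OF bc] by blast
      next
        case 4
        then have "\<not> resolves T b c a" "resolves T a b c"
          using R[of a b c] R[of b c a] bc(3) ne aY by simp_all
        then show ?thesis using YB[OF 4(1,2)] Da[OF bc] by blast
      qed
    qed
    moreover have "resolves T b c d \<longleftrightarrow> resolves T0 b c d"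
      if bcd: "b \<in> Y" "c \<in> Y" "d \<in> Y" "distinct [b, c, d]" and ns: "\<not> splits r a b c d" for b c d
    proof -
      have ne: "b \<noteq> c" "c \<noteq> d" "b \<noteq> d" using bcd(4) by auto
      \<comment> \<open>A triple meeting both \<open>B\<close> and \<open>Y'\<close> contains a pair
        that branches off at different nodes, so an unsplit triple lies in one of them.\<close>
      have mix: False if "x \<in> Y'" "y \<in> B" "r x y a" for x y
      proof -
        have "x \<in> Y" "y \<in> Y" "x \<noteq> y" using that(1,2) Y(2-4) by auto
        from Da[OF this] show False using YB[OF that(1,2)] that(3) by blast
      qed
      have "r b c a" "r c d a" "r b d a" "r c b a" "r d c a" "r d b a"
        using ns Da[OF bcd(1,2) ne(1)] Da[OF bcd(2,3) ne(2)] Da[OF bcd(1,3) ne(3)]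
        unfolding splits_def by blast+
      then consider "b \<in> Y'" "c \<in> Y'" "d \<in> Y'" | "b \<in> B" "c \<in> B" "d \<in> B"
        using mix mem bcd(1-3) by metis
      then show ?thesis
      proof cases
        case 1
        then show ?thesis
          using R[OF bcd(4)] T'(3) T1(2) bcd(4) ns mem[OF bcd(1)] mem[OF bcd(3)] by simp
      next
        case 2
        then show ?thesis
          using R[OF bcd(4)] T2(2) bcd(4) mem bcd(1-3) aY by auto
      qed
    qed
    ultimately show ?thesis using \<open>tree_over (insert a Y) T\<close> by blast
  qed
qed

text \<open>Three elements of a total preorder that are not all equivalent have either a unique
  maximum or two equivalent maxima above the third. The two disjuncts of \<open>forces\<close> are
  these patterns.\<close>

lemma splits_imp_forces:
  assumes "dense_rel V r" "distinct [a, b, c, d]" "{a, b, c, d} \<subseteq> V"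
    and "\<And>x y z. {x, y, z} = {b, c, d} \<Longrightarrow> distinct [x, y, z] \<Longrightarrow> branch_trans r a x y z"
    and "splits r a b c d"
  shows "forces r a b c d \<or> forces r a b d c \<or> forces r a c d b"
proof -
  have bt: "branch_trans r a b c d" "branch_trans r a b d c" "branch_trans r a c b d"
    "branch_trans r a c d b" "branch_trans r a d b c" "branch_trans r a d c b"
    using assms(2) by (auto intro!: assms(4))
  have V: "a \<in> V" "b \<in> V" "c \<in> V" "d \<in> V" using assms(3) by auto
  have d: "distinct [a, b, c]" "distinct [a, b, d]" "distinct [a, c, d]" using assms(2) by auto
  note D = dense_relD[OF assms(1) V(1,2,3) d(1)] dense_relD[OF assms(1) V(1,2,4) d(2)]
    dense_relD[OF assms(1) V(1,3,4) d(3)]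
  show ?thesis
    using bt assms(5) D
    unfolding branch_trans_def branch_le_def splits_def forces_def
    by argo
qed

lemma forces_imp_splits:
  assumes "dense_rel V r" "distinct [a, b, c, d]" "{a, b, c, d} \<subseteq> V" "forces r a b c d"
  shows "splits r a b c d"
proof -
  have V: "a \<in> V" "b \<in> V" "c \<in> V" "d \<in> V" using assms(3) by auto
  have d: "distinct [a, b, d]" "distinct [a, c, d]" using assms(2) by auto
  note D = dense_relD[OF assms(1) V(1,2,4) d(1)] dense_relD[OF assms(1) V(1,3,4) d(2)]
  show ?thesis
    using assms(4) D unfolding splits_def forces_def by argo
qed

lemma dense_rel_agree:
  assumes "dense_rel V r" "dense_rel V s" "distinct [b, c, d]" "{b, c, d} \<subseteq> V"
    and "r b c d \<and> s b c d \<or> r b d c \<and> s b d c \<or> r c d b \<and> s c d b"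
  shows "r b c d \<longleftrightarrow> s b c d"
proof -
  have V: "b \<in> V" "c \<in> V" "d \<in> V" using assms(4) by auto
  show ?thesis
    using assms(5) dense_relD(4)[OF assms(1) V assms(3)] dense_relD(4)[OF assms(2) V assms(3)]
    by argo
qed

text \<open>Leaves are inserted one at a time. A triplet split by the new leaf is forced in the new
  tree and, unless it lies inside \<open>Y\<close>, in \<open>r\<close> too, so both agree; an
  unsplit one is inherited from the previous tree. Nothing is claimed for split triplets inside
  \<open>Y\<close>, where \<open>r\<close> may contradict what is forced. The lemma serves with
  \<open>U\<close> as \<open>Y\<close>, and again with the surviving leaves as
  \<open>Y\<close>.\<close>

lemma extend_tree:
  assumes "finite X" "finite Y" "X \<inter> Y = {}" "dense_rel (Y \<union> X) r" "tree_over Y T0"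
    and tr: "\<And>a b c d. a \<in> X \<Longrightarrow> distinct [a, b, c, d] \<Longrightarrow> {b, c, d} \<subseteq> Y \<union> X \<Longrightarrow> branch_trans r a b c d"
    and fo: "\<And>a b c d. a \<in> X \<Longrightarrow> distinct [a, b, c, d] \<Longrightarrow> {b, c, d} \<subseteq> Y \<union> X \<Longrightarrow> \<not> {b, c, d} \<subseteq> Y \<Longrightarrow>
      forces r a b c d \<Longrightarrow> r b c d"
  shows "\<exists>T. tree_over (Y \<union> X) T \<and>
    (\<forall>b c d. distinct [b, c, d] \<and> {b, c, d} \<subseteq> Y \<union> X \<and> \<not> {b, c, d} \<subseteq> Y \<longrightarrow>
       (resolves T b c d \<longleftrightarrow> r b c d)) \<and>
    (\<forall>b c d. distinct [b, c, d] \<and> {b, c, d} \<subseteq> Y \<and> (\<forall>a\<in>X. \<not> splits r a b c d) \<longrightarrow>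
       (resolves T b c d \<longleftrightarrow> resolves T0 b c d))"
  using assms
proof (induction X rule: finite_induct)
  case empty
  then show ?case by auto
next
  case (insert x X)
  let ?Z = "Y \<union> X"
  have x: "x \<notin> ?Z" "Y \<union> insert x X = insert x ?Z" using insert by auto
  have dZ: "dense_rel (insert x ?Z) r" using insert.prems(3) by simp
  have "dense_rel ?Z r" using dZ by (rule dense_rel_mono) auto
  have "\<exists>T. tree_over ?Z T \<and>
    (\<forall>b c d. distinct [b, c, d] \<and> {b, c, d} \<subseteq> ?Z \<and> \<not> {b, c, d} \<subseteq> Y \<longrightarrow>
       (resolves T b c d \<longleftrightarrow> r b c d)) \<and>
    (\<forall>b c d. distinct [b, c, d] \<and> {b, c, d} \<subseteq> Y \<and> (\<forall>a\<in>X. \<not> splits r a b c d) \<longrightarrow>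
       (resolves T b c d \<longleftrightarrow> resolves T0 b c d))"
  proof (rule insert.IH[OF insert.prems(1) _ \<open>dense_rel ?Z r\<close> insert.prems(4)])
    show "X \<inter> Y = {}" using insert.prems(2) by auto
    show "branch_trans r a b c d" if "a \<in> X" "distinct [a, b, c, d]" "{b, c, d} \<subseteq> ?Z" for a b c d
      by (rule insert.prems(5)) (use that in auto)
    show "r b c d" if "a \<in> X" "distinct [a, b, c, d]" "{b, c, d} \<subseteq> ?Z" "\<not> {b, c, d} \<subseteq> Y"
      "forces r a b c d" for a b c d
      by (rule insert.prems(6)[of a]) (use that in auto)
  qed
  then obtain T' where T'1: "tree_over ?Z T'" and
    T'2: "\<forall>b c d. distinct [b, c, d] \<and> {b, c, d} \<subseteq> ?Z \<and> \<not> {b, c, d} \<subseteq> Y \<longrightarrow>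
       (resolves T' b c d \<longleftrightarrow> r b c d)" and
    T'3: "\<forall>b c d. distinct [b, c, d] \<and> {b, c, d} \<subseteq> Y \<and> (\<forall>a\<in>X. \<not> splits r a b c d) \<longrightarrow>
       (resolves T' b c d \<longleftrightarrow> resolves T0 b c d)"
    by (elim exE conjE) (rule that)
  have bt: "branch_trans r x b c d" if "distinct [b, c, d]" "{b, c, d} \<subseteq> ?Z" for b c d
    using that x(1) by (intro insert.prems(5)) auto
  have fin: "finite ?Z" using insert by auto
  have "\<exists>T. tree_over (insert x ?Z) T \<and>
    (\<forall>b\<in>?Z. \<forall>c\<in>?Z. b \<noteq> c \<longrightarrow> (resolves T x b c \<longleftrightarrow> r x b c) \<and> (resolves T b c x \<longleftrightarrow> r b c x)) \<and>
    (\<forall>b\<in>?Z. \<forall>c\<in>?Z. \<forall>d\<in>?Z. distinct [b, c, d] \<and> \<not> splits r x b c d \<longrightarrow>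
       (resolves T b c d \<longleftrightarrow> resolves T' b c d))"
    by (rule insert_leaf[OF fin T'1 x(1) dZ]) (rule bt)
  then obtain T where T1: "tree_over (insert x ?Z) T"
    and T2: "\<forall>b\<in>?Z. \<forall>c\<in>?Z. b \<noteq> c \<longrightarrow> (resolves T x b c \<longleftrightarrow> r x b c) \<and> (resolves T b c x \<longleftrightarrow> r b c x)"
    and T3: "\<forall>b\<in>?Z. \<forall>c\<in>?Z. \<forall>d\<in>?Z. distinct [b, c, d] \<and> \<not> splits r x b c d \<longrightarrow>
       (resolves T b c d \<longleftrightarrow> resolves T' b c d)"
    by (elim exE conjE) (rule that)
  have T: "tree_over (insert x ?Z) T"
    "\<And>b c. b \<in> ?Z \<Longrightarrow> c \<in> ?Z \<Longrightarrow> b \<noteq> c \<Longrightarrow> resolves T x b c \<longleftrightarrow> r x b c"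
    "\<And>b c. b \<in> ?Z \<Longrightarrow> c \<in> ?Z \<Longrightarrow> b \<noteq> c \<Longrightarrow> resolves T b c x \<longleftrightarrow> r b c x"
    "\<And>b c d. b \<in> ?Z \<Longrightarrow> c \<in> ?Z \<Longrightarrow> d \<in> ?Z \<Longrightarrow> distinct [b, c, d] \<Longrightarrow> \<not> splits r x b c d \<Longrightarrow>
       resolves T b c d \<longleftrightarrow> resolves T' b c d"
    using T1 T2 T3 by blast+
  note dT = dense_rel_resolves[OF T(1)]
  have fT: "forces (resolves T) x b c d \<longleftrightarrow> forces r x b c d"
    if "distinct [b, c, d]" "{b, c, d} \<subseteq> ?Z" for b c d
    using that T(2,3) unfolding forces_def by auto
  have forced: "resolves T b c d" if "distinct [b, c, d]" "{b, c, d} \<subseteq> ?Z" "forces r x b c d" for b c d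
    using resolves_pivot(2)[OF T(1), of x b c d] fT[OF that(1,2)] that x(1) by auto
  have "resolves T b c d \<longleftrightarrow> r b c d"
    if bcd: "distinct [b, c, d]" "{b, c, d} \<subseteq> insert x ?Z" "\<not> {b, c, d} \<subseteq> Y" for b c d
  proof (cases "x \<in> {b, c, d}")
    case True
    have *: "resolves T b c d \<longleftrightarrow> resolves T c b d" "r b c d \<longleftrightarrow> r c b d"
      using dense_relD[OF dT _ _ _ bcd(1)] dense_relD[OF dZ _ _ _ bcd(1)] bcd(2) by auto
    consider "x = b" | "x = c" | "x = d" using True by auto
    then show ?thesis
    proof cases
      case 1 then show ?thesis using T(2)[of c d] bcd by auto
    next
      case 2 then show ?thesis unfolding * using T(2)[of b d] bcd by auto
    next
      case 3 then show ?thesis using T(3)[of b c] bcd by auto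
    qed
  next
    case False
    then have Z: "{b, c, d} \<subseteq> ?Z" and xd: "distinct [x, b, c, d]" using bcd by auto
    show ?thesis
    proof (cases "splits r x b c d")
      case True
      have *: "r y z w \<and> resolves T y z w" if "{y, z, w} = {b, c, d}" "distinct [y, z, w]" "forces r x y z w" for y z w
      proof
        show "r y z w"
        proof (rule insert.prems(6))
          show "distinct [x, y, z, w]" using that(1,2) xd by auto
        qed (use that bcd Z in simp_all)
        show "resolves T y z w" by (rule forced) (use that Z in simp_all)
      qed
      have "forces r x b c d \<or> forces r x b d c \<or> forces r x c d b"
      proof (rule splits_imp_forces[OF dZ xd _ _ True])
        show "{x, b, c, d} \<subseteq> insert x ?Z" using Z by auto
        show "branch_trans r x y z w" if "{y, z, w} = {b, c, d}" "distinct [y, z, w]" for y z w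
          using that Z by (intro bt) auto
      qed
      then have "r b c d \<and> resolves T b c d \<or> r b d c \<and> resolves T b d c \<or> r c d b \<and> resolves T c d b"
        using *[OF refl bcd(1)] *[of b d c] *[of c d b] bcd(1) by (simp add: insert_commute) blast
      then show ?thesis
        using dense_rel_agree[OF dZ dT bcd(1,2)] by simp
    next
      case False
      have "resolves T b c d \<longleftrightarrow> resolves T' b c d"
        by (rule T(4)) (use False Z bcd(1) in simp_all)
      also have "\<dots> \<longleftrightarrow> r b c d"
        by (rule T'2[rule_format]) (intro conjI bcd(1,3) Z)
      finally show ?thesis .
    qed
  qed
  moreover have nonsplit: "resolves T b c d \<longleftrightarrow> resolves T0 b c d"
    if "distinct [b, c, d]" "{b, c, d} \<subseteq> Y" "\<forall>a\<in>insert x X. \<not> splits r a b c d" for b c d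
  proof -
    have "resolves T b c d \<longleftrightarrow> resolves T' b c d"
      by (rule T(4)) (use that in simp_all)
    also have "\<dots> \<longleftrightarrow> resolves T0 b c d"
      by (rule T'3[rule_format]) (intro conjI that(1,2), use that(3) in simp)
    finally show ?thesis .
  qed
  ultimately show ?case unfolding x(2) by (intro exI[of _ T] conjI T(1) allI impI; elim conjE) simp_all
qed

section \<open>Instances as lists\<close>

fun leaves :: "'a \<times> 'a \<times> 'a \<Rightarrow> 'a set" where
  "leaves (a, b, c) = {a, b, c}"

abbreviation triplet_of :: "'a \<times> 'a \<times> 'a \<Rightarrow> 'a rtree" where
  "triplet_of \<equiv> \<lambda>(a, b, c). triplet a b c"

text \<open>Density for lists: injectivity of \<open>leaves\<close> is uniqueness and the last
  conjunct is existence. A triple may list its two siblings in either order, which is why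
  \<open>rel\<close> tests both.\<close>

definition triplet_list :: "'a set \<Rightarrow> ('a \<times> 'a \<times> 'a) list \<Rightarrow> bool" where
  "triplet_list V ts \<longleftrightarrow>
     (\<forall>a b c. (a, b, c) \<in> set ts \<longrightarrow> distinct [a, b, c] \<and> {a, b, c} \<subseteq> V) \<and>
     distinct ts \<and> inj_on leaves (set ts) \<and> (\<forall>S\<subseteq>V. card S = 3 \<longrightarrow> S \<in> leaves ` set ts)"

definition rel :: "('a \<times> 'a \<times> 'a) list \<Rightarrow> 'a \<Rightarrow> 'a \<Rightarrow> 'a \<Rightarrow> bool" where
  "rel ts a b c \<longleftrightarrow> (a, b, c) \<in> set ts \<or> (b, a, c) \<in> set ts"

definition wrong :: "('a \<times> 'a \<times> 'a) list \<Rightarrow> 'a rtree option \<Rightarrow> ('a \<times> 'a \<times> 'a) set" where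
  "wrong ts T = {(a, b, c) \<in> set ts. \<not> resolves T a b c}"

lemma finite_wrong [simp]: "finite (wrong ts T)"
  unfolding wrong_def by (rule finite_subset[of _ "set ts"]) auto

lemma triplet_list_mem:
  assumes "triplet_list V ts" "(a, b, c) \<in> set ts"
  shows "distinct [a, b, c]" "a \<in> V" "b \<in> V" "c \<in> V"
  using assms unfolding triplet_list_def by auto

lemma triplet_list_leaves_eq:
  assumes "triplet_list V ts" "p \<in> set ts" "q \<in> set ts" "leaves p = leaves q"
  shows "p = q"
  using assms unfolding triplet_list_def by (auto dest: inj_onD)

lemma leaves_triplet_of: "triplet_of p = triplet_of q \<Longrightarrow> leaves p = leaves q"
  by (cases p; cases q) (auto simp: triplet_eq_iff)

lemma rooted_triplet_on_triplet:
  "rooted_triplet_on S (triplet a b c) \<longleftrightarrow> distinct [a, b, c] \<and> S = {a, b, c}"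
  unfolding rooted_triplet_on_iff triplet_eq_iff by auto

lemma dense_triplets_iff:
  assumes "distinct (map triplet_of ts)"
  shows "dense_triplets V (triplet_of ` set ts) \<longleftrightarrow> triplet_list V ts"
proof
  assume D: "dense_triplets V (triplet_of ` set ts)"
  have inj: "inj_on triplet_of (set ts)" and dts: "distinct ts"
    using assms by (simp_all add: distinct_map)
  have mem: "distinct [a, b, c] \<and> {a, b, c} \<subseteq> V" if "(a, b, c) \<in> set ts" for a b c
  proof -
    have "triplet a b c \<in> triplet_of ` set ts" using that by force
    then obtain S where "S \<subseteq> V" "rooted_triplet_on S (triplet a b c)"
      using D unfolding dense_triplets_def by blast
    then show ?thesis unfolding rooted_triplet_on_triplet by auto
  qed
  have on: "rooted_triplet_on (leaves p) (triplet_of p)" if "p \<in> set ts" for p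
    using mem that by (cases p) (auto simp: rooted_triplet_on_triplet)
  have "inj_on leaves (set ts)"
  proof (rule inj_onI)
    fix p q assume pq: "p \<in> set ts" "q \<in> set ts" "leaves p = leaves q"
    have "leaves p \<subseteq> V" "card (leaves p) = 3"
      using mem pq(1) by (cases p, auto)+
    then have "\<exists>!t. t \<in> triplet_of ` set ts \<and> rooted_triplet_on (leaves p) t"
      using D unfolding dense_triplets_def by blast
    then have "triplet_of p = triplet_of q"
      using on[OF pq(1)] on[OF pq(2)] pq by (metis imageI)
    then show "p = q" using inj pq by (auto dest: inj_onD)
  qed
  moreover have "S \<in> leaves ` set ts" if S: "S \<subseteq> V" "card S = 3" for S
  proof -
    obtain p where p: "p \<in> set ts" "rooted_triplet_on S (triplet_of p)"
      using D S unfolding dense_triplets_def by blast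
    from p(2) have "S = leaves p" by (cases p) (simp add: rooted_triplet_on_triplet)
    then show ?thesis using p(1) by blast
  qed
  ultimately show "triplet_list V ts"
    using mem dts unfolding triplet_list_def by blast
next
  assume L: "triplet_list V ts"
  have on: "rooted_triplet_on S (triplet_of p) \<longleftrightarrow> S = leaves p" if "p \<in> set ts" for p S
    using triplet_list_mem[OF L] that by (cases p) (auto simp: rooted_triplet_on_triplet)
  have sub: "leaves p \<subseteq> V" if "p \<in> set ts" for p
    using triplet_list_mem[OF L] that by (cases p) auto
  show "dense_triplets V (triplet_of ` set ts)"
    unfolding dense_triplets_def
  proof (intro conjI ballI allI impI)
    fix t assume "t \<in> triplet_of ` set ts"
    then show "\<exists>S\<subseteq>V. rooted_triplet_on S t" using on sub by blast
  next
    fix S assume "S \<subseteq> V" "card S = 3"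
    then obtain p where p: "p \<in> set ts" "S = leaves p"
      using L unfolding triplet_list_def by blast
    show "\<exists>!t. t \<in> triplet_of ` set ts \<and> rooted_triplet_on S t"
    proof (rule ex1I[of _ "triplet_of p"])
      show "triplet_of p \<in> triplet_of ` set ts \<and> rooted_triplet_on S (triplet_of p)"
        using p on by blast
      fix t assume "t \<in> triplet_of ` set ts \<and> rooted_triplet_on S t"
      then obtain q where "q \<in> set ts" "t = triplet_of q" "S = leaves q" using on by blast
      then show "t = triplet_of p" using triplet_list_leaves_eq[OF L p(1)] p(2) by blast
    qed
  qed
qed

lemma triplet_list_distinct_map:
  assumes "triplet_list V ts"
  shows "distinct (map triplet_of ts)"
  unfolding distinct_map
proof
  show "distinct ts" using assms unfolding triplet_list_def by blast
  show "inj_on triplet_of (set ts)"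
    by (intro inj_onI triplet_list_leaves_eq[OF assms] leaves_triplet_of)
qed

lemma dense_rti_yes_iff:
  assumes "triplet_list V ts"
  shows "dense_rti_yes V (triplet_of ` set ts) k \<longleftrightarrow>
    (\<exists>T. tree_over V T \<and> int (card (wrong ts T)) \<le> k)"
proof -
  have "card {t \<in> triplet_of ` set ts. \<not> consistent t T} = card (wrong ts T)" for T
  proof -
    have "{t \<in> triplet_of ` set ts. \<not> consistent t T} = triplet_of ` wrong ts T"
      unfolding wrong_def resolves_def by force
    moreover have "inj_on triplet_of (wrong ts T)"
      using triplet_list_distinct_map[OF assms] unfolding distinct_map wrong_def
      by (auto intro: inj_on_subset)
    ultimately show ?thesis by (simp add: card_image)
  qed
  then show ?thesis unfolding dense_rti_yes_def by simp
qed

lemma dense_rel_rel: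
  assumes L: "triplet_list V ts"
  shows "dense_rel V (rel ts)"
  unfolding dense_rel_def
proof (intro ballI impI)
  fix a b c assume abc: "a \<in> V" "b \<in> V" "c \<in> V" "distinct [a, b, c]"
  then have "{a, b, c} \<subseteq> V" "card {a, b, c} = 3" by auto
  then obtain x y z where p: "(x, y, z) \<in> set ts" "{a, b, c} = {x, y, z}"
    using L unfolding triplet_list_def by (metis imageE leaves.cases leaves.simps)
  have "x \<in> {a, b, c}" "y \<in> {a, b, c}" "z \<in> {a, b, c}" using p(2) by auto
  then have "rel ts a b c \<or> rel ts a c b \<or> rel ts b c a"
    using p(1) triplet_list_mem(1)[OF L p(1)] unfolding rel_def by auto
  moreover have "\<not> (rel ts a b c \<and> rel ts a c b)"
  proof
    assume "rel ts a b c \<and> rel ts a c b"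
    then obtain p q where "p \<in> set ts" "q \<in> set ts" "p \<in> {(a, b, c), (b, a, c)}" "q \<in> {(a, c, b), (c, a, b)}"
      unfolding rel_def by blast
    moreover from this have "leaves p = leaves q" by auto
    ultimately have "p = q" using triplet_list_leaves_eq[OF L] by blast
    then show False using \<open>p \<in> {_, _}\<close> \<open>q \<in> {_, _}\<close> abc(4) by auto
  qed
  moreover have "rel ts a b c \<longleftrightarrow> rel ts b a c" unfolding rel_def by blast
  ultimately show "(rel ts a b c \<longleftrightarrow> rel ts b a c) \<and> (rel ts a b c \<or> rel ts a c b \<or> rel ts b c a) \<and>
    \<not> (rel ts a b c \<and> rel ts a c b)" by blast
qed

lemma rel_mem:
  assumes "triplet_list V ts" "rel ts a b c"
  shows "a \<noteq> b" "a \<noteq> c" "b \<noteq> c" "a \<in> V" "b \<in> V" "c \<in> V"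
  using assms(2) triplet_list_mem[OF assms(1)] unfolding rel_def by fastforce+

text \<open>One inclusion suffices: \<open>r\<close> resolves the three leaves in some way, and
  \<open>s\<close> in at most one.\<close>

lemma dense_rel_leD:
  assumes "dense_rel V r" "dense_rel V s" "distinct [b, c, d]" "{b, c, d} \<subseteq> V"
    and "\<And>x y z. {x, y, z} = {b, c, d} \<Longrightarrow> r x y z \<Longrightarrow> s x y z"
  shows "r b c d \<longleftrightarrow> s b c d"
proof (rule dense_rel_agree[OF assms(1-4)])
  have "r b c d \<or> r b d c \<or> r c d b"
    using dense_relD(4)[OF assms(1) _ _ _ assms(3)] assms(4) by auto
  then show "r b c d \<and> s b c d \<or> r b d c \<and> s b d c \<or> r c d b \<and> s c d b"
    using assms(5)[of b c d] assms(5)[of b d c] assms(5)[of c d b] by (auto simp: insert_commute)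
qed

lemma rel_eq_resolves:
  assumes L: "triplet_list V ts" and T: "tree_over V T"
    and xyz: "distinct [x, y, z]" "{x, y, z} \<subseteq> V"
    and ok: "\<And>q. q \<in> wrong ts T \<Longrightarrow> leaves q \<noteq> {x, y, z}"
  shows "rel ts x y z \<longleftrightarrow> resolves T x y z"
proof (rule dense_rel_leD[OF dense_rel_rel[OF L] dense_rel_resolves[OF T] xyz])
  fix a b c assume e: "{a, b, c} = {x, y, z}" and r: "rel ts a b c"
  then have "(a, b, c) \<notin> wrong ts T" "(b, a, c) \<notin> wrong ts T"
    using ok[of "(a, b, c)"] ok[of "(b, a, c)"] by (auto simp: insert_commute)
  then have "resolves T a b c \<or> resolves T b a c"
    using r unfolding wrong_def rel_def by auto
  moreover have "a \<in> V" "b \<in> V" "c \<in> V" "distinct [a, b, c]" using rel_mem[OF L r] by auto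
  ultimately show "resolves T a b c"
    using dense_relD(1)[OF dense_rel_resolves[OF T]] by blast
qed

section \<open>Conflict packing\<close>

text \<open>
  A quadruple is a conflict relative to \<open>U\<close> if its triplets that are not inside \<open>U\<close> are
  already inconsistent with every tree; each of these contains a leaf outside \<open>U\<close>.
\<close>

fun conflict :: "('a \<times> 'a \<times> 'a) list \<Rightarrow> 'a list \<Rightarrow> 'a \<times> 'a \<times> 'a \<times> 'a \<Rightarrow> bool" where
  "conflict ts U (a, b, c, d) \<longleftrightarrow> distinct [a, b, c, d] \<and> a \<notin> set U \<and>
     (\<not> branch_trans (rel ts) a b c d \<or>
      \<not> (b \<in> set U \<and> c \<in> set U \<and> d \<in> set U) \<and> forces (rel ts) a b c d \<and> \<not> rel ts b c d)"

text \<open>Enlarging \<open>U\<close> only destroys conflicts, so a quadruple rejected once stays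
  rejected and a single pass over all quadruples gives a maximal packing.\<close>

lemma conflict_antimono: "set U \<subseteq> set U' \<Longrightarrow> conflict ts U' q \<Longrightarrow> conflict ts U q"
  by (cases q) auto

text \<open>A tree that is right on all triplets of the quadruple not inside \<open>U\<close> would
  contradict \<open>resolves_pivot\<close>. That the wrong triplet is not inside \<open>U\<close>
  keeps the certificates of successive conflicts apart.\<close>

lemma conflict_wrong:
  assumes L: "triplet_list V ts" and T: "tree_over V T"
    and C: "conflict ts U (a, b, c, d)" and V: "{a, b, c, d} \<subseteq> V"
  shows "\<exists>q\<in>wrong ts T. leaves q \<subseteq> {a, b, c, d} \<and> \<not> leaves q \<subseteq> set U"
proof (rule ccontr)
  assume "\<not> ?thesis"
  then have ok: "q \<in> wrong ts T \<Longrightarrow> leaves q \<subseteq> {a, b, c, d} \<Longrightarrow> leaves q \<subseteq> set U" for q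
    by blast
  have d: "distinct [a, b, c, d]" "a \<notin> set U" using C by auto
  have eq: "rel ts x y z \<longleftrightarrow> resolves T x y z"
    if "distinct [x, y, z]" "{x, y, z} \<subseteq> {a, b, c, d}" "\<not> {x, y, z} \<subseteq> set U" for x y z
  proof (rule rel_eq_resolves[OF L T that(1)])
    show "{x, y, z} \<subseteq> V" using that(2) V by (rule order_trans)
    show "leaves q \<noteq> {x, y, z}" if "q \<in> wrong ts T" for q
      using ok[OF that] \<open>{x, y, z} \<subseteq> {a, b, c, d}\<close> \<open>\<not> {x, y, z} \<subseteq> set U\<close> by metis
  qed
  have e: "rel ts a b c = resolves T a b c" "rel ts b c a = resolves T b c a"
    "rel ts a c d = resolves T a c d" "rel ts c d a = resolves T c d a"
    "rel ts a b d = resolves T a b d" "rel ts b d a = resolves T b d a"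
    "rel ts a d b = resolves T a d b" "rel ts a d c = resolves T a d c"
    by (rule eq; use d in auto)+
  have "branch_trans (rel ts) a b c d = branch_trans (resolves T) a b c d"
    "forces (rel ts) a b c d = forces (resolves T) a b c d"
    unfolding branch_trans_def branch_le_def forces_def e by auto
  then have "\<not> (b \<in> set U \<and> c \<in> set U \<and> d \<in> set U)" "resolves T b c d" "\<not> rel ts b c d"
    using C resolves_pivot[OF T d(1) V] by auto
  moreover have "rel ts b c d = resolves T b c d"
    by (rule eq; use d calculation(1) in auto)
  ultimately show False by simp
qed

text \<open>All four leaves of a packed conflict enter \<open>U\<close>, the origin of the factor 4.
  The list \<open>P\<close> counts the packed conflicts in unary.\<close>

fun pack_step :: "('a \<times> 'a \<times> 'a) list \<Rightarrow> 'a \<times> 'a \<times> 'a \<times> 'a \<Rightarrow> 'a list \<times> 'a list \<Rightarrow> 'a list \<times> 'a list" where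
  "pack_step ts (a, b, c, d) (U, P) =
     (if conflict ts U (a, b, c, d) then (a # b # c # d # U, a # P) else (U, P))"

definition pack :: "'a list \<Rightarrow> ('a \<times> 'a \<times> 'a) list \<Rightarrow> 'a list \<times> 'a list" where
  "pack vs ts = fold (pack_step ts) (List.product vs (List.product vs (List.product vs vs))) ([], [])"

lemma fold_pack_step_mono: "set (fst A) \<subseteq> set (fst (fold (pack_step ts) qs A))"
proof (induction qs arbitrary: A)
  case (Cons q qs)
  have "set (fst A) \<subseteq> set (fst (pack_step ts q A))"
    by (cases A; cases q) auto
  also have "\<dots> \<subseteq> set (fst (fold (pack_step ts) qs (pack_step ts q A)))" by (rule Cons.IH)
  finally show ?case by simp
qed simp

lemma fold_pack_step_maximal:
  "q \<in> set qs \<Longrightarrow> \<not> conflict ts (fst (fold (pack_step ts) qs A)) q"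
proof (induction qs arbitrary: A)
  case (Cons p qs)
  show ?case
  proof (cases "p = q")
    case True
    have "\<not> conflict ts (fst (pack_step ts q A)) q" by (cases A; cases q) auto
    moreover have "set (fst (pack_step ts q A)) \<subseteq> set (fst (fold (pack_step ts) qs (pack_step ts q A)))"
      by (rule fold_pack_step_mono)
    ultimately show ?thesis using True conflict_antimono by (metis fold_simps(2))
  next
    case False
    then show ?thesis using Cons by simp
  qed
qed simp

lemma pack_maximal:
  assumes "pack vs ts = (U, P)" "{a, b, c, d} \<subseteq> set vs"
  shows "\<not> conflict ts U (a, b, c, d)"
  using fold_pack_step_maximal[of "(a, b, c, d)" "List.product vs (List.product vs (List.product vs vs))" ts "([], [])"]
    assms unfolding pack_def by simp

text \<open>The invariant bounds \<open>length P\<close> by the number of wrong triplets inside the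
  current \<open>U\<close>. Each new certificate lies inside the enlarged \<open>U\<close> but not
  inside the old one, so it has not been counted before.\<close>

lemma pack_sound:
  assumes L: "triplet_list (set vs) ts" and "pack vs ts = (U, P)"
  shows "set U \<subseteq> set vs" "length U = 4 * length P"
    and "tree_over (set vs) T \<Longrightarrow> length P \<le> card (wrong ts T)"
proof -
  let ?I = "\<lambda>(U, P). set U \<subseteq> set vs \<and> length U = 4 * length P \<and>
    (\<forall>T. tree_over (set vs) T \<longrightarrow> length P \<le> card {q \<in> wrong ts T. leaves q \<subseteq> set U})"
  have step: "?I (pack_step ts q A)" if "q \<in> set vs \<times> set vs \<times> set vs \<times> set vs" "?I A" for q A
  proof -
    obtain a b c d U P where q: "q = (a, b, c, d)" "A = (U, P)"
      by (metis prod_cases4 surj_pair)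
    show ?thesis
    proof (cases "conflict ts U q")
      case False
      then have "pack_step ts q A = A" using q by (simp del: conflict.simps)
      then show ?thesis using that(2) by simp
    next
      case True
      have "Suc (length P) \<le> card {q \<in> wrong ts T. leaves q \<subseteq> set (a # b # c # d # U)}"
        if T: "tree_over (set vs) T" for T
      proof -
        obtain p where p: "p \<in> wrong ts T" "leaves p \<subseteq> {a, b, c, d}" "\<not> leaves p \<subseteq> set U"
          using conflict_wrong[OF L T True[unfolded q]] \<open>q \<in> _\<close> q by auto
        have "insert p {q \<in> wrong ts T. leaves q \<subseteq> set U} \<subseteq>
            {q \<in> wrong ts T. leaves q \<subseteq> set (a # b # c # d # U)}"
          using p by auto
        then have "card (insert p {q \<in> wrong ts T. leaves q \<subseteq> set U}) \<le>
            card {q \<in> wrong ts T. leaves q \<subseteq> set (a # b # c # d # U)}"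
          by (rule card_mono[rotated]) simp
        moreover have "card (insert p {q \<in> wrong ts T. leaves q \<subseteq> set U}) =
            Suc (card {q \<in> wrong ts T. leaves q \<subseteq> set U})"
          using p by (subst card_insert_disjoint) auto
        moreover have "length P \<le> card {q \<in> wrong ts T. leaves q \<subseteq> set U}"
          using \<open>?I A\<close> T q by simp
        ultimately show ?thesis by linarith
      qed
      moreover have "pack_step ts q A = (a # b # c # d # U, a # P)"
        using True q by (simp del: conflict.simps)
      ultimately show ?thesis using that q by simp
    qed
  qed
  have "?I (fold (pack_step ts) qs A)"
    if "set qs \<subseteq> set vs \<times> set vs \<times> set vs \<times> set vs" "?I A" for qs A
    using that
  proof (induction qs arbitrary: A)
    case (Cons q qs)
    then show ?case using step[of q A] by (simp del: pack_step.simps split del: prod.splits)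
  qed simp
  then have "?I (pack vs ts)" unfolding pack_def by simp
  then have I: "?I (U, P)" using assms(2) by simp
  then show "set U \<subseteq> set vs" "length U = 4 * length P" by simp_all
  assume "tree_over (set vs) T"
  then have "length P \<le> card {q \<in> wrong ts T. leaves q \<subseteq> set U}" using I by simp
  also have "\<dots> \<le> card (wrong ts T)" by (rule card_mono) auto
  finally show "length P \<le> card (wrong ts T)" .
qed

section \<open>Removing the leaves outside a saturated set\<close>

lemma set_eq_perm3:
  assumes "{x, y, z} = {b, c, d}" "distinct [b, c, d]"
  shows "(x, y, z) \<in> {(b, c, d), (c, b, d), (b, d, c), (d, b, c), (c, d, b), (d, c, b)}"
proof -
  have "b \<in> {x, y, z}" "c \<in> {x, y, z}" "d \<in> {x, y, z}" unfolding assms(1) by simp_all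
  then show ?thesis using assms(2) by auto
qed

lemma dense_rel_unique:
  assumes "dense_rel V s" "{b, c, d} \<subseteq> V" "distinct [b, c, d]" "{x, y, z} = {b, c, d}"
    and "s b c d" "s x y z"
  shows "d = z \<and> (b = x \<and> c = y \<or> b = y \<and> c = x)"
proof -
  have V: "b \<in> V" "c \<in> V" "d \<in> V" using assms(2) by simp_all
  consider "x = b" "y = c" "z = d" | "x = c" "y = b" "z = d" | "x = b" "y = d" "z = c"
    | "x = d" "y = b" "z = c" | "x = c" "y = d" "z = b" | "x = d" "y = c" "z = b"
    using set_eq_perm3[OF assms(4,3)] by blast
  then show ?thesis
    using dense_relD[OF assms(1) V assms(3)] assms(5,6) by cases simp_all
qed

lemma triplet_list_3:
  "triplet_list V ts \<Longrightarrow> S \<subseteq> V \<Longrightarrow> card S = 3 \<Longrightarrow> S \<in> leaves ` set ts"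
  by (simp add: triplet_list_def)

lemma forces_distinct:
  assumes "triplet_list V ts" "forces (rel ts) a b c d"
  shows "a \<noteq> b" "a \<noteq> c" "a \<noteq> d"
  using assms(2) rel_mem[OF assms(1)] unfolding forces_def by metis+

lemma triplet_list_covers:
  assumes "triplet_list V ts" "distinct [a, b, c]" "{a, b, c} \<subseteq> V"
  obtains q where "q \<in> set ts" "leaves q = {a, b, c}"
proof -
  have "card {a, b, c} = 3" using assms(2) by simp
  then have "{a, b, c} \<in> leaves ` set ts"
    by (rule triplet_list_3[OF assms(1,3)])
  then obtain q where "q \<in> set ts" "{a, b, c} = leaves q" by (rule imageE)
  then show thesis using that by simp
qed

lemma rel_iff_covering:
  assumes "triplet_list V ts" "q \<in> set ts" "leaves q = {a, b, c}"
  shows "rel ts a b c \<longleftrightarrow> q = (a, b, c) \<or> q = (b, a, c)"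
proof
  assume "rel ts a b c"
  then consider "(a, b, c) \<in> set ts" | "(b, a, c) \<in> set ts" unfolding rel_def by blast
  then show "q = (a, b, c) \<or> q = (b, a, c)"
  proof cases
    case 1
    then show ?thesis using triplet_list_leaves_eq[OF assms(1,2) 1] assms(3) by simp
  next
    case 2
    then show ?thesis using triplet_list_leaves_eq[OF assms(1,2) 2] assms(3) by (simp add: insert_commute)
  qed
qed (use assms(2) in \<open>auto simp: rel_def\<close>)

section \<open>Refutation by a leaf and the flip that repairs it\<close>

fun refutes :: "('a \<times> 'a \<times> 'a) list \<Rightarrow> 'a \<Rightarrow> 'a \<times> 'a \<times> 'a \<Rightarrow> bool" where
  "refutes ts w (b, c, d) \<longleftrightarrow> forces (rel ts) w b d c \<or> forces (rel ts) w c d b"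

text \<open>In a saturated instance with \<open>W\<close> outside \<open>U\<close>, all forced
  resolutions agree with one tree (\<open>forces_T\<close>). At most one of the two tests then
  succeeds, and it does not matter which leaf of \<open>W\<close> is consulted.\<close>

fun flip :: "('a \<times> 'a \<times> 'a) list \<Rightarrow> 'a set \<Rightarrow> 'a \<times> 'a \<times> 'a \<Rightarrow> 'a \<times> 'a \<times> 'a" where
  "flip ts W (b, c, d) =
     (if \<exists>w\<in>W. forces (rel ts) w b d c then (b, d, c)
      else if \<exists>w\<in>W. forces (rel ts) w c d b then (c, d, b) else (b, c, d))"

lemma leaves_flip: "leaves (flip ts W q) = leaves q"
  by (cases q) auto

lemma flip_eq: "\<not> (\<exists>w\<in>W. refutes ts w q) \<Longrightarrow> flip ts W q = q"
  by (cases q) auto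

lemma inj_on_flip:
  assumes "triplet_list V ts" shows "inj_on (flip ts W) (set ts)"
proof (rule inj_onI)
  fix p q assume "p \<in> set ts" "q \<in> set ts" "flip ts W p = flip ts W q"
  then show "p = q" using triplet_list_leaves_eq[OF assms] leaves_flip[of ts W] by metis
qed

lemma triplet_list_flip:
  assumes L: "triplet_list V ts"
  shows "triplet_list V (map (flip ts W) ts)"
  unfolding triplet_list_def
proof (intro conjI)
  have eq: "leaves ` set (map (flip ts W) ts) = leaves ` set ts"
    by (simp add: image_image leaves_flip)
  then show "\<forall>S\<subseteq>V. card S = 3 \<longrightarrow> S \<in> leaves ` set (map (flip ts W) ts)"
    using L unfolding triplet_list_def by simp
  show "distinct (map (flip ts W) ts)"
    using L inj_on_flip[OF L] unfolding triplet_list_def by (simp add: distinct_map)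
  show "inj_on leaves (set (map (flip ts W) ts))"
  proof (rule inj_onI)
    fix p q assume pq: "p \<in> set (map (flip ts W) ts)" "q \<in> set (map (flip ts W) ts)" "leaves p = leaves q"
    then obtain p0 q0 where "p0 \<in> set ts" "p = flip ts W p0" "q0 \<in> set ts" "q = flip ts W q0"
      by (auto simp del: flip.simps)
    then show "p = q" using triplet_list_leaves_eq[OF L, of p0 q0] pq(3) by (simp add: leaves_flip)
  qed
  show "\<forall>a b c. (a, b, c) \<in> set (map (flip ts W) ts) \<longrightarrow> distinct [a, b, c] \<and> {a, b, c} \<subseteq> V"
    using triplet_list_mem[OF L] by (auto split: if_splits)
qed

lemma triplet_list_filter:
  assumes L: "triplet_list V ts" and "V' \<subseteq> V"
  shows "triplet_list V' (filter (\<lambda>q. leaves q \<subseteq> V') ts)"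
  unfolding triplet_list_def
proof (intro conjI)
  show "\<forall>a b c. (a, b, c) \<in> set (filter (\<lambda>q. leaves q \<subseteq> V') ts) \<longrightarrow> distinct [a, b, c] \<and> {a, b, c} \<subseteq> V'"
    using triplet_list_mem[OF L] by auto
  show "distinct (filter (\<lambda>q. leaves q \<subseteq> V') ts)"
    using L unfolding triplet_list_def by simp
  show "inj_on leaves (set (filter (\<lambda>q. leaves q \<subseteq> V') ts))"
    using L unfolding triplet_list_def by (auto intro: inj_on_subset)
  show "\<forall>S\<subseteq>V'. card S = 3 \<longrightarrow> S \<in> leaves ` set (filter (\<lambda>q. leaves q \<subseteq> V') ts)"
  proof (intro allI impI)
    fix S assume S: "S \<subseteq> V'" "card S = 3"
    then have "S \<in> leaves ` set ts" using triplet_list_3[OF L] assms(2) by simp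
    then show "S \<in> leaves ` set (filter (\<lambda>q. leaves q \<subseteq> V') ts)" using S(1) by auto
  qed
qed

text \<open>This is what a maximal packing guarantees: a leaf outside \<open>U\<close> has a
  transitive branching order, and what it forces can be violated only inside
  \<open>U\<close>.\<close>

locale saturated =
  fixes V U :: "'a set" and ts :: "('a \<times> 'a \<times> 'a) list"
  assumes finite_V: "finite V" and tl: "triplet_list V ts" and U: "U \<subseteq> V"
    and trans: "\<And>a b c d. a \<in> V - U \<Longrightarrow> distinct [a, b, c, d] \<Longrightarrow> {b, c, d} \<subseteq> V \<Longrightarrow>
      branch_trans (rel ts) a b c d"
    and forced: "\<And>a b c d. a \<in> V - U \<Longrightarrow> distinct [a, b, c, d] \<Longrightarrow> {b, c, d} \<subseteq> V \<Longrightarrow>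
      \<not> {b, c, d} \<subseteq> U \<Longrightarrow> forces (rel ts) a b c d \<Longrightarrow> rel ts b c d"
begin

text \<open>The leaves outside \<open>U\<close> are inserted into an arbitrary tree on
  \<open>U\<close>; what they force prevails, so the choice of that tree affects only triplets
  inside \<open>U\<close>.\<close>

lemma tree_off_U:
  "\<exists>T. tree_over V T \<and> (\<forall>b c d. distinct [b, c, d] \<and> {b, c, d} \<subseteq> V \<and> \<not> {b, c, d} \<subseteq> U \<longrightarrow>
     (resolves T b c d \<longleftrightarrow> rel ts b c d))"
proof -
  have V: "V = U \<union> (V - U)" using U by auto
  obtain T0 where T0: "tree_over U T0"
    using tree_over_exists finite_subset[OF U finite_V] by blast
  have "\<exists>T. tree_over (U \<union> (V - U)) T \<and>
    (\<forall>b c d. distinct [b, c, d] \<and> {b, c, d} \<subseteq> U \<union> (V - U) \<and> \<not> {b, c, d} \<subseteq> U \<longrightarrow>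
       (resolves T b c d \<longleftrightarrow> rel ts b c d)) \<and>
    (\<forall>b c d. distinct [b, c, d] \<and> {b, c, d} \<subseteq> U \<and> (\<forall>a\<in>V - U. \<not> splits (rel ts) a b c d) \<longrightarrow>
       (resolves T b c d \<longleftrightarrow> resolves T0 b c d))"
    by (rule extend_tree)
      (use finite_V finite_subset[OF U finite_V] dense_rel_rel[OF tl] T0 trans forced V[symmetric] in
        \<open>simp_all only: Diff_disjoint finite_Diff inf_commute Diff_idemp\<close>)
  then show ?thesis unfolding V[symmetric] by blast
qed

definition T where
  "T = (SOME T. tree_over V T \<and> (\<forall>b c d. distinct [b, c, d] \<and> {b, c, d} \<subseteq> V \<and> \<not> {b, c, d} \<subseteq> U \<longrightarrow>
     (resolves T b c d \<longleftrightarrow> rel ts b c d)))"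

lemma tree_T: "tree_over V T"
  and resolves_T: "distinct [b, c, d] \<Longrightarrow> {b, c, d} \<subseteq> V \<Longrightarrow> \<not> {b, c, d} \<subseteq> U \<Longrightarrow>
    resolves T b c d \<longleftrightarrow> rel ts b c d"
  using someI_ex[OF tree_off_U, folded T_def] by blast+

text \<open>Both predicates consult only triplets containing \<open>a\<close>. As \<open>a\<close>
  lies outside \<open>U\<close>, these are triplets on which \<open>rel ts\<close> and
  \<open>T\<close> coincide.\<close>

lemma pivot_T:
  assumes "a \<in> V - U" "distinct [a, b, c, d]" "{b, c, d} \<subseteq> V"
  shows "forces (rel ts) a b c d \<longleftrightarrow> forces (resolves T) a b c d"
    and "splits (rel ts) a b c d \<longleftrightarrow> splits (resolves T) a b c d"
proof -
  have e: "resolves T a b d = rel ts a b d" "resolves T a c d = rel ts a c d"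
    "resolves T b c a = rel ts b c a" "resolves T a d b = rel ts a d b"
    "resolves T a d c = rel ts a d c" "resolves T c d a = rel ts c d a"
    "resolves T b d a = rel ts b d a"
    by (rule resolves_T; use assms in auto)+
  show "forces (rel ts) a b c d \<longleftrightarrow> forces (resolves T) a b c d"
    and "splits (rel ts) a b c d \<longleftrightarrow> splits (resolves T) a b c d"
    unfolding forces_def splits_def e by blast+
qed

lemma forces_T:
  assumes "a \<in> V - U" "distinct [b, c, d]" "{b, c, d} \<subseteq> V" "forces (rel ts) a b c d"
  shows "resolves T b c d"
proof -
  have d: "distinct [a, b, c, d]" using assms(2) forces_distinct[OF tl assms(4)] by simp
  then have "forces (resolves T) a b c d" using pivot_T assms by blast
  then show ?thesis using resolves_pivot(2)[OF tree_T d] assms by simp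
qed

text \<open>A forced resolution is the one of \<open>T\<close>, so only triplets inconsistent with
  \<open>T\<close> are refuted, and these lie inside \<open>U\<close>. Conversely, a leaf splitting
  such a triplet forces some resolution of it, which must be that of \<open>T\<close>. Only the
  third condition depends on \<open>w\<close>, so the sets of refuting leaves inherit laminarity
  from \<open>splits_laminar\<close>.\<close>

lemma refutes_iff:
  assumes q: "(b, c, d) \<in> set ts" and w: "w \<in> V - U"
  shows "refutes ts w (b, c, d) \<longleftrightarrow>
    {b, c, d} \<subseteq> U \<and> \<not> resolves T b c d \<and> splits (resolves T) w b c d"
proof
  note m = triplet_list_mem[OF tl q]
  have d: "distinct [b, d, c]" "{b, d, c} \<subseteq> V" "distinct [c, d, b]" "{c, d, b} \<subseteq> V"
    using m by auto
  note D = dense_relD[OF dense_rel_resolves[OF tree_T] m(2-4,1)]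
  {
    assume "refutes ts w (b, c, d)"
    then consider "forces (rel ts) w b d c" | "forces (rel ts) w c d b" by auto
    moreover have "resolves T x y z \<and> w \<notin> {x, y, z} \<and> splits (resolves T) w x y z"
      if f: "forces (rel ts) w x y z" and xyz: "distinct [x, y, z]" "{x, y, z} \<subseteq> V" for x y z
    proof -
      have wx: "distinct [w, x, y, z]" using forces_distinct[OF tl f] xyz(1) by simp
      have "{w, x, y, z} \<subseteq> V" using xyz(2) w by simp
      moreover have "forces (resolves T) w x y z" using pivot_T(1)[OF w wx xyz(2)] f by blast
      ultimately have "splits (resolves T) w x y z"
        by (rule forces_imp_splits[OF dense_rel_resolves[OF tree_T] wx])
      then show ?thesis using forces_T[OF w xyz f] wx by simp
    qed
    ultimately have r: "resolves T b d c \<or> resolves T c d b" and "w \<notin> {b, c, d}"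
      and s: "splits (resolves T) w b d c \<or> splits (resolves T) w c d b"
      using d by (cases, blast, blast)+
    then have wd: "w \<noteq> b" "w \<noteq> c" "w \<noteq> d" by auto
    have "\<not> resolves T b c d" using r D by blast
    moreover from this have "{b, c, d} \<subseteq> U"
      using resolves_T[OF m(1)] m(2-4) q unfolding rel_def by auto
    moreover have "splits (resolves T) w b c d"
    proof -
      have "resolves T x y w \<longleftrightarrow> resolves T y x w" if "x \<in> {b, c, d}" "y \<in> {b, c, d}" "x \<noteq> y" for x y
        by (rule dense_relD(1)[OF dense_rel_resolves[OF tree_T]]) (use that m w wd in auto)
      then show ?thesis using s m(1) unfolding splits_def by auto
    qed
    ultimately show "{b, c, d} \<subseteq> U \<and> \<not> resolves T b c d \<and> splits (resolves T) w b c d" by blast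
  }
  assume a: "{b, c, d} \<subseteq> U \<and> \<not> resolves T b c d \<and> splits (resolves T) w b c d"
  then have wd: "distinct [w, b, c, d]" using w m(1) by auto
  have "forces (resolves T) w b c d \<or> forces (resolves T) w b d c \<or> forces (resolves T) w c d b"
  proof (rule splits_imp_forces[OF dense_rel_resolves[OF tree_T] wd])
    show "{w, b, c, d} \<subseteq> V" using w m by auto
    show "branch_trans (resolves T) w x y z" if "{x, y, z} = {b, c, d}" "distinct [x, y, z]" for x y z
    proof (rule resolves_pivot(1)[OF tree_T])
      show "distinct [w, x, y, z]" using that wd by auto
      show "{w, x, y, z} \<subseteq> V" using that(1) w m by auto
    qed
  qed (use a in blast)
  moreover have "\<not> forces (resolves T) w b c d"
    using a resolves_pivot(2)[OF tree_T wd] w m by auto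
  moreover have "forces (resolves T) w b d c \<longleftrightarrow> forces (rel ts) w b d c"
    "forces (resolves T) w c d b \<longleftrightarrow> forces (rel ts) w c d b"
    using pivot_T(1)[OF w, of b d c] pivot_T(1)[OF w, of c d b] wd d by auto
  ultimately show "refutes ts w (b, c, d)" by simp
qed

lemma refutes_leaves:
  assumes "q \<in> set ts" "w \<in> V - U" "refutes ts w q" shows "leaves q \<subseteq> U"
proof -
  obtain b c d where e: "q = (b, c, d)" by (metis prod_cases3)
  then show ?thesis using refutes_iff[of b c d w] assms by (simp only: leaves.simps)
qed

lemma refutes_laminar:
  assumes "p \<in> set ts" "q \<in> set ts" "w \<in> V - U" "refutes ts w p" "refutes ts w q"
  shows "{v \<in> V - U. refutes ts v p} \<subseteq> {v \<in> V - U. refutes ts v q} \<or>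
    {v \<in> V - U. refutes ts v q} \<subseteq> {v \<in> V - U. refutes ts v p}"
proof -
  obtain b c d b' c' d' where e: "p = (b, c, d)" "q = (b', c', d')" by (metis prod_cases3)
  have p: "(b, c, d) \<in> set ts" and q: "(b', c', d') \<in> set ts" using assms(1,2) e by auto
  have w: "{b, c, d} \<subseteq> U" "\<not> resolves T b c d" "splits (resolves T) w b c d"
    "{b', c', d'} \<subseteq> U" "\<not> resolves T b' c' d'" "splits (resolves T) w b' c' d'"
    using assms(3-5) refutes_iff[OF p] refutes_iff[OF q] unfolding e by blast+
  have eq: "{v \<in> V - U. refutes ts v p} = {v \<in> V - U. splits (resolves T) v b c d}"
    "{v \<in> V - U. refutes ts v q} = {v \<in> V - U. splits (resolves T) v b' c' d'}"
    using refutes_iff[OF p] refutes_iff[OF q] w unfolding e by blast+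
  show ?thesis
    unfolding eq
  proof (rule splits_laminar[OF tree_T])
    show "{b, c, d, b', c', d'} \<subseteq> V" "V - U \<subseteq> V - {b, c, d, b', c', d'}"
      using w(1,4) U by auto
  qed (use triplet_list_mem(1)[OF tl p] triplet_list_mem(1)[OF tl q] w assms(3) in auto)
qed

text \<open>The contrary resolution is forced by triplets consisting of \<open>w\<close> and two
  leaves of \<open>q\<close>. A tree that is right on all of these cannot be right on
  \<open>q\<close>.\<close>

lemma refutes_wrong:
  assumes q: "q \<in> set ts" and w: "w \<in> V - U" "refutes ts w q" and S: "tree_over V S"
  shows "\<exists>p\<in>wrong ts S. p = q \<or> w \<in> leaves p \<and> leaves p \<subseteq> insert w (leaves q)"
proof (rule ccontr)
  assume no: "\<not> ?thesis"
  obtain b c d where e: "q = (b, c, d)" by (metis prod_cases3)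
  have bcd: "(b, c, d) \<in> set ts" using q e by simp
  note m = triplet_list_mem[OF tl bcd]
  have "{b, c, d} \<subseteq> U" using w refutes_iff[OF bcd] e by auto
  then have wd: "distinct [w, b, c, d]" using w(1) m(1) by auto
  have "resolves S b c d" using no bcd e unfolding wrong_def by auto
  have eq: "rel ts x y z = resolves S x y z"
    if "distinct [x, y, z]" "w \<in> {x, y, z}" "{x, y, z} \<subseteq> {w, b, c, d}" for x y z
  proof (rule rel_eq_resolves[OF tl S that(1)])
    show "{x, y, z} \<subseteq> V" using that(3) m w(1) by auto
    show "leaves p \<noteq> {x, y, z}" if "p \<in> wrong ts S" for p
      using no that \<open>w \<in> {x, y, z}\<close> \<open>{x, y, z} \<subseteq> {w, b, c, d}\<close> unfolding e leaves.simps by metis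
  qed
  have r: "rel ts w b c = resolves S w b c" "rel ts w d c = resolves S w d c"
    "rel ts b d w = resolves S b d w" "rel ts w c b = resolves S w c b"
    "rel ts w c d = resolves S w c d" "rel ts w d b = resolves S w d b"
    "rel ts c d w = resolves S c d w" "rel ts w b d = resolves S w b d"
    by (rule eq; use wd in auto)+
  have "forces (resolves S) w b d c \<or> forces (resolves S) w c d b"
    using w(2) unfolding e refutes.simps forces_def r by blast
  moreover have "distinct [w, b, d, c]" "distinct [w, c, d, b]" "{w, b, d, c} \<subseteq> V" "{w, c, d, b} \<subseteq> V"
    using wd m w(1) by auto
  ultimately have "resolves S b d c \<or> resolves S c d b"
    using resolves_pivot(2)[OF S, of w b d c] resolves_pivot(2)[OF S, of w c d b] by blast
  then show False
    using dense_relD(1-4)[OF dense_rel_resolves[OF S] m(2-4,1)] \<open>resolves S b c d\<close> by blast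
qed

text \<open>
  The leaf outside \<open>U\<close> that it contains tells from which pair a certifying triplet comes.
\<close>

lemma disjoint_wrong_triplets:
  assumes "Q \<subseteq> set ts" "inj_on m Q" "\<And>q. q \<in> Q \<Longrightarrow> m q \<in> V - U \<and> refutes ts (m q) q"
    and S: "tree_over V S"
  obtains g where "inj_on g Q" "\<And>q. q \<in> Q \<Longrightarrow> g q \<in> wrong ts S"
    "\<And>q. q \<in> Q \<Longrightarrow> g q = q \<or> m q \<in> leaves (g q)"
proof -
  have "\<forall>q\<in>Q. \<exists>p. p \<in> wrong ts S \<and> (p = q \<or> m q \<in> leaves p \<and> leaves p \<subseteq> insert (m q) (leaves q))"
    using refutes_wrong[OF _ _ _ S] assms(1,3) by blast
  then obtain g where g: "\<forall>q\<in>Q. g q \<in> wrong ts S \<and>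
      (g q = q \<or> m q \<in> leaves (g q) \<and> leaves (g q) \<subseteq> insert (m q) (leaves q))"
    by (rule bchoice[THEN exE])
  have inU: "leaves q \<subseteq> U" if "q \<in> Q" for q
    using refutes_leaves assms(1,3) that by blast
  have tr: "leaves (g q) \<inter> (V - U) = (if g q = q then {} else {m q})" if "q \<in> Q" for q
  proof (cases "g q = q")
    case True
    then show ?thesis using inU[OF that] by auto
  next
    case False
    then have "m q \<in> leaves (g q)" "leaves (g q) \<subseteq> insert (m q) (leaves q)" using g that by blast+
    then show ?thesis using inU[OF that] assms(3)[OF that] False by auto
  qed
  have "inj_on g Q"
  proof (rule inj_onI)
    fix p q assume pq: "p \<in> Q" "q \<in> Q" "g p = g q"
    then have "(if g p = p then {} else {m p}) = (if g q = q then {} else {m q})"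
      using tr by metis
    then show "p = q" using pq assms(2) by (auto split: if_splits dest: inj_onD)
  qed
  then show thesis by (rule that) (use g in auto)
qed

end

text \<open>The situation produced by the algorithm: the leaves \<open>W\<close> are to be removed,
  \<open>F\<close> is the set of triplets that they refute, and \<open>m\<close> matches all of
  \<open>F\<close> into \<open>W\<close>. Partners inside \<open>W\<close> are essential, because a
  certificate containing its partner then disappears together with \<open>W\<close> and is not
  charged again in the reduced instance.\<close>

locale saturated_flip = saturated +
  fixes W :: "'a set" and F :: "('a \<times> 'a \<times> 'a) set" and m :: "'a \<times> 'a \<times> 'a \<Rightarrow> 'a"
  assumes W: "W \<subseteq> V - U"
    and F: "F = {q \<in> set ts. \<exists>w\<in>W. refutes ts w q}"
    and m: "inj_on m F" "\<And>q. q \<in> F \<Longrightarrow> m q \<in> W \<and> refutes ts (m q) q"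
begin

abbreviation "r \<equiv> rel (map (flip ts W) ts)"
abbreviation "V' \<equiv> V - W"
abbreviation "ts' \<equiv> filter (\<lambda>q. leaves q \<subseteq> V') (map (flip ts W) ts)"

lemma r_tl: "triplet_list V (map (flip ts W) ts)"
  by (rule triplet_list_flip[OF tl])

lemmas dense_r = dense_rel_rel[OF r_tl]

lemma leaves_F: "q \<in> F \<Longrightarrow> leaves q \<subseteq> U"
  using F W refutes_leaves by blast

text \<open>Refuted triplets lie inside \<open>U\<close>, so flipping changes nothing else. In
  particular every triplet containing a leaf of \<open>W\<close> is preserved.\<close>

lemma r_eq_rel:
  assumes "distinct [b, c, d]" "{b, c, d} \<subseteq> V" "\<not> {b, c, d} \<subseteq> U"
  shows "r b c d \<longleftrightarrow> rel ts b c d"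
proof -
  obtain q where q: "q \<in> set ts" "leaves q = {b, c, d}"
    using triplet_list_covers[OF tl assms(1,2)] .
  then have "q \<notin> F" using leaves_F assms(3) by metis
  then have "flip ts W q = q" using q(1) F by (intro flip_eq) auto
  then have "q \<in> set (map (flip ts W) ts)" using q(1) by (metis image_eqI set_map)
  then show ?thesis
    using rel_iff_covering[OF tl q] rel_iff_covering[OF r_tl _ q(2)] by simp
qed

lemma r_pivot:
  assumes "w \<in> W" "distinct [w, b, c, d]" "{b, c, d} \<subseteq> V"
  shows "forces r w b c d \<longleftrightarrow> forces (rel ts) w b c d"
    and "splits r w b c d \<longleftrightarrow> splits (rel ts) w b c d"
    and "branch_trans r w b c d"
proof -
  have w: "w \<in> V - U" using assms(1) W by auto
  have e: "r w b d = rel ts w b d" "r w c d = rel ts w c d"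
    "r b c w = rel ts b c w" "r w d b = rel ts w d b"
    "r w d c = rel ts w d c" "r c d w = rel ts c d w"
    "r b d w = rel ts b d w" "r w b c = rel ts w b c"
    by (rule r_eq_rel; use assms w in auto)+
  show "forces r w b c d \<longleftrightarrow> forces (rel ts) w b c d"
    and "splits r w b c d \<longleftrightarrow> splits (rel ts) w b c d"
    unfolding forces_def splits_def e by blast+
  show "branch_trans r w b c d"
    using trans[OF w assms(2,3)] unfolding branch_trans_def branch_le_def e .
qed

text \<open>A flipped triplet shows a resolution forced from \<open>W\<close>, and this is the one
  of \<open>T\<close>. If nothing is flipped, neither alternative to \<open>q\<close> is forced, so
  the resolution forced by \<open>w\<close> is that of \<open>q\<close> itself.\<close>

lemma resolves_flip:
  assumes q: "q \<in> set ts" and w: "w \<in> W" "forces (rel ts) w b c d" "leaves q = {b, c, d}"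
    and bcd: "distinct [b, c, d]"
  shows "case flip ts W q of (x, y, z) \<Rightarrow> resolves T x y z"
proof -
  have WU: "w \<in> V - U" if "w \<in> W" for w using that W by auto
  obtain x y z where e: "q = (x, y, z)" by (metis prod_cases3)
  have xyz: "(x, y, z) \<in> set ts" using q e by simp
  note mem = triplet_list_mem[OF tl xyz]
  have d: "distinct [x, z, y]" "{x, z, y} \<subseteq> V" "distinct [y, z, x]" "{y, z, x} \<subseteq> V"
    using mem by auto
  consider (1) "\<exists>w\<in>W. forces (rel ts) w x z y"
    | (2) "\<not> (\<exists>w\<in>W. forces (rel ts) w x z y)" "\<exists>w\<in>W. forces (rel ts) w y z x"
    | (3) "\<not> (\<exists>w\<in>W. forces (rel ts) w x z y)" "\<not> (\<exists>w\<in>W. forces (rel ts) w y z x)" by blast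
  then show ?thesis
  proof cases
    case 1
    then show ?thesis using forces_T[OF WU d(1,2)] unfolding e by auto
  next
    case 2
    then show ?thesis using forces_T[OF WU d(3,4)] unfolding e by auto
  next
    case 3
    have V: "{b, c, d} \<subseteq> V" using w(3) mem e by auto
    have T: "resolves T b c d" by (rule forces_T[OF WU[OF w(1)] bcd V w(2)])
    have sym: "forces (rel ts) w b c d \<longleftrightarrow> forces (rel ts) w c b d" for b c d
      unfolding forces_def rel_def by blast
    have "{b, c, d} = {x, y, z}" using w(3) e by simp
    note perm = set_eq_perm3[OF this mem(1)]
    have "\<not> (b = x \<and> c = z \<and> d = y)" "\<not> (b = z \<and> c = x \<and> d = y)"
      "\<not> (b = y \<and> c = z \<and> d = x)" "\<not> (b = z \<and> c = y \<and> d = x)"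
      using 3 w(1,2) sym by blast+
    with perm have "b = x \<and> c = y \<and> d = z \<or> b = y \<and> c = x \<and> d = z"
      by blast
    then have "resolves T x y z"
      using T dense_relD(1)[OF dense_rel_resolves[OF tree_T] mem(2-4,1)] by auto
    then show ?thesis using 3 unfolding e by simp
  qed
qed

text \<open>After the flips nothing forced by a leaf of \<open>W\<close> is violated any more, not
  even inside \<open>U\<close>. This is what makes \<open>W\<close> insertable into every tree on
  \<open>V'\<close>.\<close>

lemma forces_r:
  assumes "w \<in> W" "distinct [w, b, c, d]" "{b, c, d} \<subseteq> V" "forces (rel ts) w b c d"
  shows "r b c d"
proof -
  have w: "w \<in> V - U" using assms(1) W by auto
  have bcd: "distinct [b, c, d]" using assms(2) by simp
  obtain q where q: "q \<in> set ts" "leaves q = {b, c, d}"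
    using triplet_list_covers[OF tl bcd assms(3)] .
  obtain x y z where e: "flip ts W q = (x, y, z)" by (metis prod_cases3)
  have "resolves T x y z" using resolves_flip[OF q(1) assms(1,4) q(2) bcd] e by simp
  have "leaves (x, y, z) = {b, c, d}" using leaves_flip[of ts W q] e q by simp
  have mem: "(x, y, z) \<in> set (map (flip ts W) ts)" using q(1) e by (metis image_eqI set_map)
  have "resolves T b c d" by (rule forces_T[OF w bcd assms(3,4)])
  then have "d = z \<and> (b = x \<and> c = y \<or> b = y \<and> c = x)"
    using dense_rel_unique[OF dense_rel_resolves[OF tree_T] assms(3) bcd]
      \<open>leaves (x, y, z) = _\<close> \<open>resolves T x y z\<close> by simp
  then show ?thesis using mem unfolding rel_def by auto
qed

text \<open>Besides what \<open>extend_tree\<close> provides, triplets inside \<open>V'\<close> that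
  are split by a leaf of \<open>W\<close> come out right: they are forced, and both \<open>r\<close>
  and the tree \<open>S\<close> obey what is forced. Hence \<open>S\<close> inherits from
  \<open>T0\<close> only the unsplit triplets.\<close>

lemma extension:
  assumes T0: "tree_over V' T0"
  obtains S where "tree_over V S"
    "\<And>b c d. distinct [b, c, d] \<Longrightarrow> {b, c, d} \<subseteq> V \<Longrightarrow>
       \<not> {b, c, d} \<subseteq> V' \<or> (\<exists>w\<in>W. splits r w b c d) \<Longrightarrow> resolves S b c d \<longleftrightarrow> r b c d"
    "\<And>b c d. distinct [b, c, d] \<Longrightarrow> {b, c, d} \<subseteq> V' \<Longrightarrow>
       \<not> (\<exists>w\<in>W. splits r w b c d) \<Longrightarrow> resolves S b c d \<longleftrightarrow> resolves T0 b c d"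
proof -
  have un: "V' \<union> W = V" using W by auto
  have "\<exists>S. tree_over (V' \<union> W) S \<and>
    (\<forall>b c d. distinct [b, c, d] \<and> {b, c, d} \<subseteq> V' \<union> W \<and> \<not> {b, c, d} \<subseteq> V' \<longrightarrow>
       (resolves S b c d \<longleftrightarrow> r b c d)) \<and>
    (\<forall>b c d. distinct [b, c, d] \<and> {b, c, d} \<subseteq> V' \<and> (\<forall>a\<in>W. \<not> splits r a b c d) \<longrightarrow>
       (resolves S b c d \<longleftrightarrow> resolves T0 b c d))"
  proof (rule extend_tree)
    show "finite W" "finite V'" "W \<inter> V' = {}" using finite_V W finite_subset by auto
    show "dense_rel (V' \<union> W) r" unfolding un by (rule dense_r)
    show "tree_over V' T0" by (rule T0)
    fix a b c d assume a: "a \<in> W" "distinct [a, b, c, d]" "{b, c, d} \<subseteq> V' \<union> W"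
    show "branch_trans r a b c d" by (rule r_pivot(3)[OF a[unfolded un]])
    show "r b c d" if "forces r a b c d"
      using forces_r[OF a[unfolded un]] r_pivot(1)[OF a[unfolded un]] that by blast
  qed
  then obtain S where S: "tree_over V S"
    and off: "\<forall>b c d. distinct [b, c, d] \<and> {b, c, d} \<subseteq> V \<and> \<not> {b, c, d} \<subseteq> V' \<longrightarrow>
       (resolves S b c d \<longleftrightarrow> r b c d)"
    and non: "\<forall>b c d. distinct [b, c, d] \<and> {b, c, d} \<subseteq> V' \<and> (\<forall>a\<in>W. \<not> splits r a b c d) \<longrightarrow>
       (resolves S b c d \<longleftrightarrow> resolves T0 b c d)"
    unfolding un by (elim exE conjE) (rule that)
  have "resolves S b c d \<longleftrightarrow> r b c d"
    if bcd: "distinct [b, c, d]" "{b, c, d} \<subseteq> V'" "w \<in> W" "splits r w b c d" for b c d w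
  proof -
    have wd: "distinct [w, b, c, d]" and V: "{w, b, c, d} \<subseteq> V" using bcd(1-3) W by auto
    have "forces r w b c d \<or> forces r w b d c \<or> forces r w c d b"
    proof (rule splits_imp_forces[OF dense_r wd V _ bcd(4)])
      show "branch_trans r w x y z" if "{x, y, z} = {b, c, d}" "distinct [x, y, z]" for x y z
      proof (rule r_pivot(3)[OF bcd(3)])
        show "distinct [w, x, y, z]" using that wd by auto
        show "{x, y, z} \<subseteq> V" using that V by simp
      qed
    qed
    moreover have both: "r x y z \<and> resolves S x y z"
      if f: "forces r w x y z" and xyz: "{x, y, z} = {b, c, d}" "distinct [w, x, y, z]" for x y z
    proof
      have V': "{x, y, z} \<subseteq> V" using xyz V by simp
      show "r x y z"
        using forces_r[OF bcd(3) xyz(2) V'] r_pivot(1)[OF bcd(3) xyz(2) V'] f by blast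
      have e: "resolves S w x z = r w x z" "resolves S w y z = r w y z"
        "resolves S x y w = r x y w" "resolves S w z x = r w z x" "resolves S w z y = r w z y"
        by (rule off[rule_format]; use xyz(2) V' bcd(3) V in auto)+
      have "forces (resolves S) w x y z" using f unfolding forces_def e .
      then show "resolves S x y z" using resolves_pivot(2)[OF S xyz(2)] V' V by simp
    qed
    moreover have "forces r w b c d \<Longrightarrow> r b c d \<and> resolves S b c d" "forces r w b d c \<Longrightarrow> r b d c \<and> resolves S b d c"
      "forces r w c d b \<Longrightarrow> r c d b \<and> resolves S c d b"
      by (rule both; use wd in auto)+
    ultimately have "r b c d \<and> resolves S b c d \<or> r b d c \<and> resolves S b d c \<or> r c d b \<and> resolves S c d b"
      by blast
    then show ?thesis
      using dense_rel_agree[OF dense_r dense_rel_resolves[OF S] bcd(1)] V by simp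
  qed
  note split = this
  show thesis
  proof (rule that[OF S])
    fix b c d :: 'a assume bcd: "distinct [b, c, d]"
    show "resolves S b c d \<longleftrightarrow> r b c d"
      if "{b, c, d} \<subseteq> V" "\<not> {b, c, d} \<subseteq> V' \<or> (\<exists>w\<in>W. splits r w b c d)"
    proof (cases "{b, c, d} \<subseteq> V'")
      case True
      with that(2) obtain w where "w \<in> W" "splits r w b c d" by blast
      then show ?thesis by (rule split[OF bcd True])
    next
      case False
      show ?thesis by (rule off[rule_format]) (intro conjI bcd that(1) False)
    qed
    show "resolves S b c d \<longleftrightarrow> resolves T0 b c d"
      if "{b, c, d} \<subseteq> V'" "\<not> (\<exists>w\<in>W. splits r w b c d)"
    proof (rule non[rule_format], intro conjI bcd that(1) ballI)
      show "\<not> splits r a b c d" if "a \<in> W" for a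
        using \<open>\<not> (\<exists>w\<in>W. splits r w b c d)\<close> that by blast
    qed
  qed
qed

lemma flip_not_F: "q \<in> set ts \<Longrightarrow> q \<notin> F \<Longrightarrow> flip ts W q = q"
  using F by (intro flip_eq) auto

text \<open>All of \<open>F\<close> is charged. A wrong triplet outside \<open>F\<close> is not
  flipped, so by \<open>extension\<close> it avoids \<open>W\<close> and is not split from
  \<open>W\<close>; there \<open>S\<close> coincides with the given tree, which is wrong on it as
  well.\<close>

lemma backward:
  assumes "tree_over V' T'"
  shows "\<exists>S. tree_over V S \<and> card (wrong ts S) \<le> card F + card (wrong ts' T')"
proof -
  obtain S where S: "tree_over V S"
    "\<And>b c d. distinct [b, c, d] \<Longrightarrow> {b, c, d} \<subseteq> V \<Longrightarrow>
       \<not> {b, c, d} \<subseteq> V' \<or> (\<exists>w\<in>W. splits r w b c d) \<Longrightarrow> resolves S b c d \<longleftrightarrow> r b c d"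
    "\<And>b c d. distinct [b, c, d] \<Longrightarrow> {b, c, d} \<subseteq> V' \<Longrightarrow>
       \<not> (\<exists>w\<in>W. splits r w b c d) \<Longrightarrow> resolves S b c d \<longleftrightarrow> resolves T' b c d"
    using extension[OF assms] by blast
  have "wrong ts S \<subseteq> F \<union> wrong ts' T'"
  proof
    fix q assume q: "q \<in> wrong ts S"
    obtain b c d where e: "q = (b, c, d)" by (metis prod_cases3)
    have bcd: "(b, c, d) \<in> set ts" "\<not> resolves S b c d" using q e unfolding wrong_def by auto
    note mem = triplet_list_mem[OF tl bcd(1)]
    show "q \<in> F \<union> wrong ts' T'"
    proof (cases "q \<in> F")
      case False
      then have fl: "flip ts W (b, c, d) = (b, c, d)" using flip_not_F bcd(1) e by blast
      then have in_ts: "(b, c, d) \<in> set (map (flip ts W) ts)" using bcd(1) by (metis image_eqI set_map)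
      then have "r b c d" unfolding rel_def by blast
      then have n: "{b, c, d} \<subseteq> V'" "\<not> (\<exists>w\<in>W. splits r w b c d)"
        using S(2)[OF mem(1)] mem(2-4) bcd(2) by auto
      then have "\<not> resolves T' b c d" using S(3)[OF mem(1)] bcd(2) by blast
      then show ?thesis using in_ts n(1) unfolding e wrong_def by auto
    qed simp
  qed
  moreover have "finite F" using F by simp
  ultimately have "card (wrong ts S) \<le> card (F \<union> wrong ts' T')" by (intro card_mono) auto
  also have "\<dots> \<le> card F + card (wrong ts' T')" by (rule card_Un_le)
  finally show ?thesis using S(1) by blast
qed

text \<open>The restriction of \<open>R\<close> to \<open>V'\<close> need not satisfy the flipped
  triplets. Inserting \<open>W\<close> by \<open>extension\<close> corrects every triplet split from
  \<open>W\<close>, and a second restriction yields \<open>T'\<close>. The triplets on which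
  \<open>T'\<close> is wrong are then unsplit, hence unflipped and already wrong for
  \<open>R\<close>; the certificates of \<open>F\<close> are further wrong triplets of
  \<open>R\<close>.\<close>

lemma forward:
  assumes R: "tree_over V R"
  shows "\<exists>T'. tree_over V' T' \<and> card F + card (wrong ts' T') \<le> card (wrong ts R)"
proof -
  obtain T0 where T0: "tree_over V' T0"
    "\<forall>a\<in>V'. \<forall>b\<in>V'. \<forall>c\<in>V'. distinct [a, b, c] \<longrightarrow> (resolves T0 a b c \<longleftrightarrow> resolves R a b c)"
    using resolves_restrict[OF R, of V'] by auto
  obtain S where S: "tree_over V S"
    "\<And>b c d. distinct [b, c, d] \<Longrightarrow> {b, c, d} \<subseteq> V \<Longrightarrow>
       \<not> {b, c, d} \<subseteq> V' \<or> (\<exists>w\<in>W. splits r w b c d) \<Longrightarrow> resolves S b c d \<longleftrightarrow> r b c d"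
    "\<And>b c d. distinct [b, c, d] \<Longrightarrow> {b, c, d} \<subseteq> V' \<Longrightarrow>
       \<not> (\<exists>w\<in>W. splits r w b c d) \<Longrightarrow> resolves S b c d \<longleftrightarrow> resolves T0 b c d"
    using extension[OF T0(1)] by blast
  obtain T' where T': "tree_over V' T'"
    "\<forall>a\<in>V'. \<forall>b\<in>V'. \<forall>c\<in>V'. distinct [a, b, c] \<longrightarrow> (resolves T' a b c \<longleftrightarrow> resolves S a b c)"
    using resolves_restrict[OF S(1), of V'] by auto
  obtain g where g: "inj_on g F" "\<And>q. q \<in> F \<Longrightarrow> g q \<in> wrong ts R"
    "\<And>q. q \<in> F \<Longrightarrow> g q = q \<or> m q \<in> leaves (g q)"
  proof (rule disjoint_wrong_triplets[of F m R])
    show "F \<subseteq> set ts" using F by auto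
    show "m q \<in> V - U \<and> refutes ts (m q) q" if "q \<in> F" for q using m(2)[OF that] W by blast
  qed (use m R in auto)
  have in_R: "q \<in> wrong ts R \<and> q \<notin> F \<and> leaves q \<subseteq> V'" if "q \<in> wrong ts' T'" for q
  proof -
    obtain b c d where e: "q = (b, c, d)" by (metis prod_cases3)
    have q: "(b, c, d) \<in> set (map (flip ts W) ts)" "{b, c, d} \<subseteq> V'" "\<not> resolves T' b c d"
      using that e unfolding wrong_def by auto
    note mem = triplet_list_mem[OF r_tl q(1)]
    have "\<not> resolves S b c d" using T'(2) q mem(1) by simp
    moreover have "r b c d" using q(1) unfolding rel_def by blast
    ultimately have n: "\<not> (\<exists>w\<in>W. splits r w b c d)" using S(2)[OF mem(1)] mem(2-4) by auto
    then have "\<not> resolves T0 b c d" using S(3)[OF mem(1) q(2)] \<open>\<not> resolves S b c d\<close> by blast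
    then have nR: "\<not> resolves R b c d" using T0(2) q(2) mem(1) by simp
    obtain p where p: "p \<in> set ts" "flip ts W p = (b, c, d)" using q(1) by auto
    then have lp: "leaves p = {b, c, d}" using leaves_flip[of ts W p] by simp
    \<comment> \<open>A triplet in \<open>F\<close> is split by the leaf that refutes it, whereas no
      leaf of \<open>W\<close> splits this one.\<close>
    have notF: "p' \<notin> F" if "leaves p' = {b, c, d}" for p'
    proof
      assume "p' \<in> F"
      then obtain w x y z where w: "w \<in> W" "refutes ts w (x, y, z)" "p' = (x, y, z)" "(x, y, z) \<in> set ts"
        using F by (cases p') auto
      have s: "splits (resolves T) w x y z" "{x, y, z} \<subseteq> U"
        using refutes_iff[OF w(4)] w W by auto
      note mx = triplet_list_mem[OF tl w(4)]
      have "distinct [w, x, y, z]" "{x, y, z} \<subseteq> V" using mx s(2) w(1) W by auto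
      moreover have "w \<in> V - U" using w(1) W by blast
      ultimately have "splits r w x y z"
        using s(1) r_pivot(2)[OF w(1), of x y z] pivot_T(2)[of w x y z] by blast
      moreover have "{x, y, z} = {b, c, d}" using that w(3) by simp
      moreover have "r s t w = r t s w" for s t unfolding rel_def by blast
      ultimately have "splits r w b c d"
        using set_eq_perm3[OF _ mem(1), of x y z] unfolding splits_def by auto
      then show False using n w(1) by blast
    qed
    have "flip ts W p = p" using flip_not_F[OF p(1)] notF lp by blast
    then have "(b, c, d) \<in> set ts" using p by simp
    then show ?thesis using nR notF[of q] q(2) unfolding e wrong_def by auto
  qed
  \<comment> \<open>A certificate lies in \<open>F\<close> or contains its partner in
    \<open>W\<close>; by \<open>in_R\<close> the triplets on which \<open>T'\<close> is wrong do
    neither.\<close>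
  have "wrong ts' T' \<inter> g ` F = {}"
  proof (intro equals0I, elim IntE imageE)
    fix p q assume p: "p \<in> wrong ts' T'" "p = g q" "q \<in> F"
    have "p \<noteq> q" using in_R[OF p(1)] p(3) by blast
    then have "m q \<in> leaves p" using g(3)[OF p(3)] p(2) by auto
    then show False using in_R[OF p(1)] m(2)[OF p(3)] by auto
  qed
  moreover have "finite F" using F by simp
  ultimately have "card (wrong ts' T') + card F = card (wrong ts' T' \<union> g ` F)"
    using g(1) by (simp add: card_Un_disjoint card_image)
  also have "\<dots> \<le> card (wrong ts R)"
    by (rule card_mono) (simp, use in_R g(2) in blast)
  finally show ?thesis using T'(1) by auto
qed

lemma equivalent:
  "(\<exists>T'. tree_over V' T' \<and> int (card (wrong ts' T')) \<le> k - int (card F)) \<longleftrightarrow>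
   (\<exists>S. tree_over V S \<and> int (card (wrong ts S)) \<le> k)"
proof
  assume "\<exists>T'. tree_over V' T' \<and> int (card (wrong ts' T')) \<le> k - int (card F)"
  then obtain T' where T': "tree_over V' T'" "int (card (wrong ts' T')) \<le> k - int (card F)" by blast
  obtain S where "tree_over V S" "card (wrong ts S) \<le> card F + card (wrong ts' T')"
    using backward[OF T'(1)] by blast
  then show "\<exists>S. tree_over V S \<and> int (card (wrong ts S)) \<le> k"
    using T'(2) by (intro exI[of _ S]) linarith
next
  assume "\<exists>S. tree_over V S \<and> int (card (wrong ts S)) \<le> k"
  then obtain S where S: "tree_over V S" "int (card (wrong ts S)) \<le> k" by blast
  obtain T' where "tree_over V' T'" "card F + card (wrong ts' T') \<le> card (wrong ts S)"
    using forward[OF S(1)] by blast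
  then show "\<exists>T'. tree_over V' T' \<and> int (card (wrong ts' T')) \<le> k - int (card F)"
    using S(2) by (intro exI[of _ T']) linarith
qed

end

section \<open>Greedy matching in a laminar family\<close>

text \<open>The first list holds the vertices taken so far, the second the neighbourhoods of the
  elements left unmatched.\<close>

definition match_step :: "('q \<Rightarrow> 'a list) \<Rightarrow> 'q \<Rightarrow> 'a list \<times> 'a list \<Rightarrow> 'a list \<times> 'a list" where
  "match_step N q A =
     (case filter (\<lambda>w. w \<notin> set (fst A)) (N q) of
        [] \<Rightarrow> (fst A, N q @ snd A)
      | w # _ \<Rightarrow> (w # fst A, snd A))"

text \<open>
  Smaller neighbourhoods come first. Hence, when \<open>q\<close> finds all its neighbours taken, they were
  taken by elements whose neighbourhoods are, by laminarity, contained in that of \<open>q\<close>.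
\<close>

lemma fold_match_step:
  assumes "sorted_wrt (\<lambda>p q. length (N p) \<le> length (N q)) qs" "distinct qs"
    and "\<And>q. q \<in> set qs \<Longrightarrow> distinct (N q)"
    and "\<And>p q w. p \<in> set qs \<Longrightarrow> q \<in> set qs \<Longrightarrow> w \<in> set (N p) \<Longrightarrow> w \<in> set (N q) \<Longrightarrow>
      set (N p) \<subseteq> set (N q) \<or> set (N q) \<subseteq> set (N p)"
    and "fold (match_step N) qs ([], []) = (M, D)"
  shows "\<exists>Q m. Q \<subseteq> set qs \<and> inj_on m Q \<and> m ` Q = set M \<and> (\<forall>q\<in>Q. m q \<in> set (N q)) \<and> distinct M \<and>
    set D = (\<Union>q\<in>set qs - Q. set (N q)) \<and>
    (\<forall>q\<in>set qs - Q. \<forall>w\<in>set (N q). \<exists>p\<in>Q. m p = w \<and> set (N p) \<subseteq> set (N q))"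
  using assms
proof (induction qs arbitrary: M D rule: rev_induct)
  case Nil
  then show ?case by (intro exI[of _ "{}"]) auto
next
  case (snoc q qs)
  obtain M' D' where A: "fold (match_step N) qs ([], []) = (M', D')" by fastforce
  have srt: "sorted_wrt (\<lambda>p q. length (N p) \<le> length (N q)) qs"
    "\<And>p. p \<in> set qs \<Longrightarrow> length (N p) \<le> length (N q)"
    using snoc.prems(1) by (auto simp: sorted_wrt_append)
  have "\<exists>Q m. Q \<subseteq> set qs \<and> inj_on m Q \<and> m ` Q = set M' \<and> (\<forall>q\<in>Q. m q \<in> set (N q)) \<and> distinct M' \<and>
    set D' = (\<Union>q\<in>set qs - Q. set (N q)) \<and>
    (\<forall>q\<in>set qs - Q. \<forall>w\<in>set (N q). \<exists>p\<in>Q. m p = w \<and> set (N p) \<subseteq> set (N q))"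
  proof (rule snoc.IH[OF srt(1) _ _ _ A])
    show "distinct qs" using snoc.prems(2) by simp
    show "distinct (N p)" if "p \<in> set qs" for p using snoc.prems(3) that by simp
    show "set (N p) \<subseteq> set (N q) \<or> set (N q) \<subseteq> set (N p)"
      if "p \<in> set qs" "q \<in> set qs" "w \<in> set (N p)" "w \<in> set (N q)" for p q w
      by (rule snoc.prems(4)[OF _ _ that(3,4)]) (use that in auto)
  qed
  then obtain Q m where Q: "Q \<subseteq> set qs" "inj_on m Q" "m ` Q = set M'" "\<forall>q\<in>Q. m q \<in> set (N q)"
    "distinct M'" "set D' = (\<Union>q\<in>set qs - Q. set (N q))"
    "\<forall>q\<in>set qs - Q. \<forall>w\<in>set (N q). \<exists>p\<in>Q. m p = w \<and> set (N p) \<subseteq> set (N q)"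
    by (elim exE conjE) (rule that)
  have q: "q \<notin> set qs" "q \<notin> Q" using snoc.prems(2) Q(1) by auto
  have last: "match_step N q (M', D') = (M, D)" using snoc.prems(5) A by simp
  show ?case
  proof (cases "filter (\<lambda>w. w \<notin> set M') (N q)")
    case Nil
    then have MD: "M = M'" "D = N q @ D'" using last by (auto simp: match_step_def)
    have taken: "w \<in> set M'" if "w \<in> set (N q)" for w
      using Nil that by (auto simp: filter_empty_conv)
    have un: "set (qs @ [q]) - Q = insert q (set qs - Q)" using q by auto
    have new: "\<exists>p\<in>Q. m p = w \<and> set (N p) \<subseteq> set (N q)" if w: "w \<in> set (N q)" for w
    proof -
      have "w \<in> m ` Q" using taken[OF w] Q(3) by simp
      then obtain p where p: "p \<in> Q" "m p = w" by blast
      then have pq: "p \<in> set qs" "w \<in> set (N p)" using Q(1,4) by auto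
      then have "set (N p) \<subseteq> set (N q) \<or> set (N q) \<subseteq> set (N p)"
        using snoc.prems(4)[of p q w] w by simp
      \<comment> \<open>The processing order gives \<open>N p\<close> at most as many elements as
        \<open>N q\<close>, so the unwanted inclusion is an equality.\<close>
      moreover have "set (N p) \<subseteq> set (N q)" if "set (N q) \<subseteq> set (N p)"
      proof -
        have "card (set (N p)) \<le> card (set (N q))"
          using srt(2)[OF pq(1)] snoc.prems(3)[of p] snoc.prems(3)[of q] pq(1)
          by (simp add: distinct_card)
        then show ?thesis using card_seteq[OF _ that] by auto
      qed
      ultimately show ?thesis using p by blast
    qed
    then show ?thesis
      unfolding MD
    proof (intro exI[of _ Q] exI[of _ m] conjI Q(2-5))
      show "Q \<subseteq> set (qs @ [q])" using Q(1) by auto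
      show "set (N q @ D') = (\<Union>q\<in>set (qs @ [q]) - Q. set (N q))"
        unfolding un using Q(6) by simp
      show "\<forall>q\<in>set (qs @ [q]) - Q. \<forall>w\<in>set (N q). \<exists>p\<in>Q. m p = w \<and> set (N p) \<subseteq> set (N q)"
        unfolding un using Q(7) new by blast
    qed
  next
    case (Cons w ws)
    then have MD: "M = w # M'" "D = D'" using last by (auto simp: match_step_def)
    have w: "w \<in> set (N q)" "w \<notin> set M'"
      using arg_cong[OF Cons, of set] by auto
    let ?m = "m(q := w)"
    have un: "set (qs @ [q]) - insert q Q = set qs - Q" using q by auto
    have same: "?m p = m p" if "p \<in> Q" for p using that q by auto
    have im: "?m ` Q = set M'" using same Q(3) by (metis image_cong)
    have "inj_on ?m (insert q Q)"
      using Q(2) im q w(2) same by (auto simp: inj_on_def)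
    moreover have "?m ` insert q Q = set M" unfolding image_insert im MD by simp
    moreover have "\<forall>p\<in>insert q Q. ?m p \<in> set (N p)" using Q(4) same w q by auto
    moreover have "\<forall>p\<in>set qs - Q. \<forall>v\<in>set (N p). \<exists>p'\<in>insert q Q. ?m p' = v \<and> set (N p') \<subseteq> set (N p)"
      using Q(7) same by (metis insertI2)
    moreover have "insert q Q \<subseteq> set (qs @ [q])" "distinct M"
      using Q(1,5) w MD by auto
    moreover have "set D = (\<Union>q\<in>set qs - Q. set (N q))" using Q(6) MD by simp
    ultimately show ?thesis
      unfolding un[symmetric] by (intro exI[of _ "insert q Q"] exI[of _ ?m] conjI)
  qed
qed

text \<open>Every vertex of \<open>D\<close> was found taken, so \<open>D\<close> lies inside
  \<open>M\<close>. An element \<open>q\<close> with a neighbour outside \<open>D\<close> is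
  matched, since unmatched elements put their whole neighbourhood into \<open>D\<close>. If its
  partner were in \<open>D\<close>, the invariant would place \<open>N q\<close> inside the
  neighbourhood of an unmatched element, hence inside \<open>D\<close>.\<close>

lemma greedy_matching:
  assumes "sorted_wrt (\<lambda>p q. length (N p) \<le> length (N q)) qs" "distinct qs"
    and "\<And>q. q \<in> set qs \<Longrightarrow> distinct (N q)"
    and "\<And>p q w. p \<in> set qs \<Longrightarrow> q \<in> set qs \<Longrightarrow> w \<in> set (N p) \<Longrightarrow> w \<in> set (N q) \<Longrightarrow>
      set (N p) \<subseteq> set (N q) \<or> set (N q) \<subseteq> set (N p)"
    and "fold (match_step N) qs ([], []) = (M, D)"
  obtains Q m where "Q \<subseteq> set qs" "inj_on m Q" "\<And>q. q \<in> Q \<Longrightarrow> m q \<in> set (N q)" "card Q = length M"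
    "set D \<subseteq> set M" "\<And>q. q \<in> set qs \<Longrightarrow> \<not> set (N q) \<subseteq> set D \<Longrightarrow> q \<in> Q \<and> m q \<notin> set D"
proof -
  have "\<exists>Q m. Q \<subseteq> set qs \<and> inj_on m Q \<and> m ` Q = set M \<and> (\<forall>q\<in>Q. m q \<in> set (N q)) \<and> distinct M \<and>
    set D = (\<Union>q\<in>set qs - Q. set (N q)) \<and>
    (\<forall>q\<in>set qs - Q. \<forall>w\<in>set (N q). \<exists>p\<in>Q. m p = w \<and> set (N p) \<subseteq> set (N q))"
    by (rule fold_match_step[OF assms(1,2) _ _ assms(5)]) (fact assms(3), fact assms(4))
  then obtain Q m where Q: "Q \<subseteq> set qs" "inj_on m Q" "m ` Q = set M"
    "\<forall>q\<in>Q. m q \<in> set (N q)" "distinct M" "set D = (\<Union>q\<in>set qs - Q. set (N q))"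
    "\<forall>q\<in>set qs - Q. \<forall>w\<in>set (N q). \<exists>p\<in>Q. m p = w \<and> set (N p) \<subseteq> set (N q)"
    by (elim exE conjE) (rule that)
  show thesis
  proof (rule that[OF Q(1,2)])
    show "m q \<in> set (N q)" if "q \<in> Q" for q using Q(4) that by blast
    show "card Q = length M" using Q(2,3,5) by (metis card_image distinct_card)
    show "set D \<subseteq> set M"
    proof
      fix w assume "w \<in> set D"
      then obtain q where "q \<in> set qs - Q" "w \<in> set (N q)" using Q(6) by blast
      then obtain p where "p \<in> Q" "m p = w" using Q(7) by blast
      then show "w \<in> set M" using Q(3) by blast
    qed
    fix q assume q: "q \<in> set qs" "\<not> set (N q) \<subseteq> set D"
    then have "q \<in> Q" using Q(6) by blast
    moreover have "m q \<notin> set D"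
    proof
      assume "m q \<in> set D"
      then obtain q' where q': "q' \<in> set qs - Q" "m q \<in> set (N q')" using Q(6) by blast
      then obtain p where p: "p \<in> Q" "m p = m q" "set (N p) \<subseteq> set (N q')" using Q(7) by blast
      then have "p = q" using Q(2) \<open>q \<in> Q\<close> by (auto dest: inj_onD)
      then show False using p(3) q' q(2) Q(6) by blast
    qed
    ultimately show "q \<in> Q \<and> m q \<notin> set D" by blast
  qed
qed

text \<open>Bucket sort: the list of \<open>False\<close> is a unary counter and each round appends
  the elements whose neighbourhood has that length. Starting at length one drops elements without
  neighbours, and \<open>vs\<close> is long enough to reach every length that occurs.\<close>

definition sort_by_length :: "('q \<Rightarrow> 'a list) \<Rightarrow> 'b list \<Rightarrow> 'q list \<Rightarrow> 'q list" where
  "sort_by_length N vs qs = snd (fold (\<lambda>_ A. (False # fst A,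
     snd A @ filter (\<lambda>q. length (N q) = length (fst A)) qs)) vs ([False], []))"

lemma sort_by_length:
  assumes "distinct qs" "\<And>q. q \<in> set qs \<Longrightarrow> length (N q) \<le> length vs"
  shows "distinct (sort_by_length N vs qs)"
    and "set (sort_by_length N vs qs) = {q \<in> set qs. N q \<noteq> []}"
    and "sorted_wrt (\<lambda>p q. length (N p) \<le> length (N q)) (sort_by_length N vs qs)"
proof -
  let ?s = "\<lambda>_ A. (False # fst A, snd A @ filter (\<lambda>q. length (N q) = length (fst A)) qs)"
  have eq: "sorted_wrt (\<lambda>p q. length (N p) \<le> length (N q)) (filter (\<lambda>q. length (N q) = n) qs)" for n
    by (induction qs) auto
  have "length (fst (fold ?s vs ([False], []))) = Suc (length vs) \<and>
      distinct (snd (fold ?s vs ([False], []))) \<and>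
      set (snd (fold ?s vs ([False], []))) = {q \<in> set qs. 1 \<le> length (N q) \<and> length (N q) \<le> length vs} \<and>
      sorted_wrt (\<lambda>p q. length (N p) \<le> length (N q)) (snd (fold ?s vs ([False], [])))"
  proof (induction vs rule: rev_induct)
    case (snoc v vs)
    define A where "A = fold ?s vs ([False], [])"
    have A: "length (fst A) = Suc (length vs)" "distinct (snd A)"
      "set (snd A) = {q \<in> set qs. 1 \<le> length (N q) \<and> length (N q) \<le> length vs}"
      "sorted_wrt (\<lambda>p q. length (N p) \<le> length (N q)) (snd A)"
      using snoc.IH unfolding A_def by blast+
    have e: "fold ?s (vs @ [v]) ([False], []) = ?s v A" by (simp add: A_def)
    have d1: "distinct (snd (?s v A))" using A assms(1) by auto
    have d2: "set (snd (?s v A)) = {q \<in> set qs. 1 \<le> length (N q) \<and> length (N q) \<le> length (vs @ [v])}"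
    proof -
      have "set (snd (?s v A)) = set (snd A) \<union> {q \<in> set qs. length (N q) = Suc (length vs)}"
        by (simp add: A(1))
      then show ?thesis unfolding A(3) by (auto simp: le_Suc_eq Suc_le_eq)
    qed
    have "sorted_wrt (\<lambda>p q. length (N p) \<le> length (N q)) (snd (?s v A))"
    proof -
      have "\<forall>p\<in>set (snd A). length (N p) \<le> Suc (length vs)"
        unfolding A(3) by simp
      then show ?thesis using A(1,4) eq by (simp add: sorted_wrt_append)
    qed
    then show ?case unfolding e using A(1) by (intro conjI d1 d2) simp_all
  qed auto
  then show "distinct (sort_by_length N vs qs)"
    and "set (sort_by_length N vs qs) = {q \<in> set qs. N q \<noteq> []}"
    and "sorted_wrt (\<lambda>p q. length (N p) \<le> length (N q)) (sort_by_length N vs qs)"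
    using assms(2) unfolding sort_by_length_def by (auto simp: Suc_le_eq)
qed

section \<open>The kernelization algorithm\<close>

definition certifiers :: "'a list \<Rightarrow> ('a \<times> 'a \<times> 'a) list \<Rightarrow> 'a \<times> 'a \<times> 'a \<Rightarrow> 'a list" where
  "certifiers vs ts q = filter (\<lambda>w. w \<notin> set (fst (pack vs ts)) \<and> refutes ts w q) vs"

definition matching :: "'a list \<Rightarrow> ('a \<times> 'a \<times> 'a) list \<Rightarrow> 'a list \<times> 'a list" where
  "matching vs ts =
     fold (match_step (certifiers vs ts)) (sort_by_length (certifiers vs ts) vs ts) ([], [])"

definition removable :: "'a list \<Rightarrow> ('a \<times> 'a \<times> 'a) list \<Rightarrow> 'a list" where
  "removable vs ts =
     filter (\<lambda>w. w \<notin> set (fst (pack vs ts)) \<and> w \<notin> set (snd (matching vs ts))) vs"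

definition flipped :: "'a list \<Rightarrow> ('a \<times> 'a \<times> 'a) list \<Rightarrow> ('a \<times> 'a \<times> 'a) list" where
  "flipped vs ts = filter (\<lambda>q. \<exists>w\<in>set (removable vs ts). refutes ts w q) ts"

text \<open>The instance without leaves is a yes-instance iff its parameter is nonnegative.\<close>

definition kernel ::
  "'a list \<times> ('a \<times> 'a \<times> 'a) list \<times> int \<Rightarrow> 'a list \<times> ('a \<times> 'a \<times> 'a) list \<times> int" where
  "kernel = (\<lambda>(vs, ts, k).
     if k < 0 then ([], [], k)
     else if length (snd (pack vs ts)) \<le> nat \<bar>k\<bar> \<and> length (fst (matching vs ts)) \<le> nat \<bar>k\<bar> then
       (filter (\<lambda>v. v \<notin> set (removable vs ts)) vs,
        filter (\<lambda>q. leaves q \<inter> set (removable vs ts) = {}) (map (flip ts (set (removable vs ts))) ts),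
        int (nat \<bar>k\<bar> - length (flipped vs ts)))
     else ([], [], - 1))"

lemma no_tree_if_negative:
  assumes "k < 0" shows "\<not> (\<exists>T. tree_over V T \<and> int (card (wrong ts T)) \<le> k)"
  using assms by auto

lemma triplet_list_empty: "triplet_list {} []"
  by (auto simp: triplet_list_def)

lemma kernel_correct:
  assumes vs: "distinct vs" and L: "triplet_list (set vs) ts"
    and ker: "kernel (vs, ts, k) = (vs', ts', k')"
  shows "distinct vs' \<and> triplet_list (set vs') ts' \<and>
    ((\<exists>T. tree_over (set vs') T \<and> int (card (wrong ts' T)) \<le> k') \<longleftrightarrow>
     (\<exists>T. tree_over (set vs) T \<and> int (card (wrong ts T)) \<le> k)) \<and>
    k' \<le> k \<and> int (card (set vs')) \<le> 5 * max 0 k"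
proof (cases "k < 0")
  case True
  then have "vs' = []" "ts' = []" "k' = k" using ker by (simp_all add: kernel_def)
  then show ?thesis
    using True no_tree_if_negative[OF True] triplet_list_empty by simp
next
  case False
  obtain U P where UP: "pack vs ts = (U, P)" by fastforce
  obtain M D where MD: "matching vs ts = (M, D)" by fastforce
  note pk = pack_sound[OF L UP]
  define N where "N = certifiers vs ts"
  define W where "W = set (removable vs ts)"
  interpret saturated "set vs" "set U" ts
  proof
    show "finite (set vs)" by simp
    show "triplet_list (set vs) ts" by (rule L)
    show "set U \<subseteq> set vs" by (rule pk)
    fix a b c d assume a: "a \<in> set vs - set U" "distinct [a, b, c, d]" "{b, c, d} \<subseteq> set vs"
    then have "\<not> conflict ts U (a, b, c, d)" by (intro pack_maximal[OF UP]) auto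
    then show "branch_trans (rel ts) a b c d"
      and "\<not> {b, c, d} \<subseteq> set U \<Longrightarrow> forces (rel ts) a b c d \<Longrightarrow> rel ts b c d"
      using a by auto
  qed
  have N: "set (N q) = {w \<in> set vs - set U. refutes ts w q}" for q
    by (auto simp: N_def certifiers_def UP)
  have dts: "distinct ts" using L unfolding triplet_list_def by blast
  have srt: "distinct (sort_by_length N vs ts)"
    "set (sort_by_length N vs ts) = {q \<in> set ts. N q \<noteq> []}"
    "sorted_wrt (\<lambda>p q. length (N p) \<le> length (N q)) (sort_by_length N vs ts)"
    using sort_by_length[OF dts, of N vs] unfolding N_def certifiers_def by simp_all
  have fold: "fold (match_step N) (sort_by_length N vs ts) ([], []) = (M, D)"
    using MD unfolding matching_def N_def .
  have dN: "distinct (N q)" for q using vs by (simp add: N_def certifiers_def)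
  have lam: "set (N p) \<subseteq> set (N q) \<or> set (N q) \<subseteq> set (N p)"
    if "p \<in> set (sort_by_length N vs ts)" "q \<in> set (sort_by_length N vs ts)"
      "w \<in> set (N p)" "w \<in> set (N q)" for p q w
    using refutes_laminar[of p q w] that unfolding N srt(2) by simp
  obtain Q m where Q: "Q \<subseteq> {q \<in> set ts. N q \<noteq> []}" "inj_on m Q" "\<And>q. q \<in> Q \<Longrightarrow> m q \<in> set (N q)"
    "card Q = length M" "set D \<subseteq> set M"
    "\<And>q. q \<in> {q \<in> set ts. N q \<noteq> []} \<Longrightarrow> \<not> set (N q) \<subseteq> set D \<Longrightarrow> q \<in> Q \<and> m q \<notin> set D"
  proof (rule greedy_matching[OF srt(3,1) dN lam fold, unfolded srt(2)])
    fix Q m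
    assume "Q \<subseteq> {q \<in> set ts. N q \<noteq> []}" "inj_on m Q" "\<And>q. q \<in> Q \<Longrightarrow> m q \<in> set (N q)"
      "card Q = length M" "set D \<subseteq> set M"
      "\<And>q. q \<in> {q \<in> set ts. N q \<noteq> []} \<Longrightarrow> \<not> set (N q) \<subseteq> set D \<Longrightarrow> q \<in> Q \<and> m q \<notin> set D"
    then show thesis by (rule that)
  qed
  have mQ: "m q \<in> set vs - set U \<and> refutes ts (m q) q" if "q \<in> Q" for q
    using Q(3)[OF that] unfolding N by simp
  have lowM: "length M \<le> card (wrong ts T)" if T: "tree_over (set vs) T" for T
  proof -
    have "Q \<subseteq> set ts" using Q(1) by blast
    then obtain g where "inj_on g Q" "\<And>q. q \<in> Q \<Longrightarrow> g q \<in> wrong ts T"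
      by (rule disjoint_wrong_triplets[OF _ Q(2) mQ T]) (assumption, rule that)
    then have "card Q \<le> card (wrong ts T)" by (intro card_inj_on_le[of g]) auto
    then show ?thesis using Q(4) by simp
  qed
  show ?thesis
  proof (cases "length P \<le> nat \<bar>k\<bar> \<and> length M \<le> nat \<bar>k\<bar>")
    case small: False
    then have "vs' = []" "ts' = []" "k' = - 1" using ker False by (auto simp: kernel_def UP MD)
    \<comment> \<open>Packed conflicts and matched pairs each give as many wrong triplets in every
      tree, so either number exceeding \<open>k\<close> proves a no-instance.\<close>
    moreover have "\<not> (\<exists>T. tree_over (set vs) T \<and> int (card (wrong ts T)) \<le> k)"
      using pk(3) lowM small False by fastforce
    ultimately show ?thesis
      using False no_tree_if_negative[of "- 1"] triplet_list_empty by simp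
  next
    case True
    then have vs': "vs' = filter (\<lambda>v. v \<notin> W) vs"
      and ts': "ts' = filter (\<lambda>q. leaves q \<inter> W = {}) (map (flip ts W) ts)"
      and k': "k' = int (nat \<bar>k\<bar> - length (flipped vs ts))"
      using ker False by (auto simp: kernel_def UP MD W_def)
    define F where "F = {q \<in> set ts. \<exists>w\<in>W. refutes ts w q}"
    have W_eq: "W = {w \<in> set vs. w \<notin> set U \<and> w \<notin> set D}"
      by (auto simp: W_def removable_def UP MD)
    \<comment> \<open>A leaf of \<open>W\<close> refuting \<open>q\<close> is a neighbour outside
      \<open>D\<close>. So \<open>q\<close> is matched to a leaf outside both \<open>U\<close> and
      \<open>D\<close>, that is, to a leaf of \<open>W\<close>.\<close>
    have FQ: "q \<in> Q \<and> m q \<notin> set D" if "q \<in> F" for q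
    proof -
      obtain w where w: "w \<in> W" "refutes ts w q" and q: "q \<in> set ts" using \<open>q \<in> F\<close> F_def by blast
      then have "w \<in> set (N q)" "w \<notin> set D" unfolding N W_eq by auto
      then show ?thesis using q by (intro Q(6)) auto
    qed
    interpret saturated_flip "set vs" "set U" ts W F m
    proof
      show "W \<subseteq> set vs - set U" unfolding W_eq by blast
      show "F = {q \<in> set ts. \<exists>w\<in>W. refutes ts w q}" by (rule F_def)
      show "inj_on m F" using Q(2) FQ by (meson inj_on_subset subsetI)
      show "m q \<in> W \<and> refutes ts (m q) q" if "q \<in> F" for q
        using mQ[of q] FQ[OF that] unfolding W_eq by blast
    qed
    have V': "set vs' = set vs - W" unfolding vs' by auto
    have ts'_eq: "ts' = filter (\<lambda>q. leaves q \<subseteq> set vs - W) (map (flip ts W) ts)"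
      unfolding ts'
    proof (rule filter_cong[OF refl])
      fix q assume q: "q \<in> set (map (flip ts W) ts)"
      obtain a b c where e: "q = (a, b, c)" by (metis prod_cases3)
      have "leaves q \<subseteq> set vs" using triplet_list_mem[OF r_tl q[unfolded e]] e by simp
      then show "leaves q \<inter> W = {} \<longleftrightarrow> leaves q \<subseteq> set vs - W" by blast
    qed
    have "length (flipped vs ts) = card F"
      unfolding F_def flipped_def W_def[symmetric] using dts by (simp flip: set_filter add: distinct_card)
    moreover have "card F \<le> card Q"
    proof (rule card_mono)
      show "finite Q" using Q(1) by (rule finite_subset) simp
      show "F \<subseteq> Q" using FQ by blast
    qed
    \<comment> \<open>The truncated subtraction is exact because \<open>card F\<close> is at most
      \<open>length M\<close>, which is at most \<open>k\<close> in this branch.\<close>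
    ultimately have k'_eq: "k' = k - int (card F)"
      using True Q(4) False unfolding k' by linarith
    \<comment> \<open>The remaining leaves lie in \<open>U\<close> or \<open>D\<close>, and
      \<open>D\<close> is contained in \<open>M\<close>: four leaves per packed conflict and one per
      matched pair.\<close>
    have "set vs' \<subseteq> set U \<union> set M" using V' Q(5) unfolding W_eq by blast
    then have "card (set vs') \<le> card (set U \<union> set M)" by (rule card_mono[rotated]) simp
    also have "\<dots> \<le> length U + length M"
      by (rule order_trans[OF card_Un_le]) (intro add_mono card_length)
    also have "\<dots> \<le> 5 * nat \<bar>k\<bar>" using pk(2) True by linarith
    finally have "int (card (set vs')) \<le> 5 * max 0 k" using False by linarith
    moreover have "distinct vs'" using vs unfolding vs' by simp
    moreover have "triplet_list (set vs') ts'"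
      unfolding V' ts'_eq by (rule triplet_list_filter[OF r_tl]) blast
    moreover have "k' \<le> k" unfolding k'_eq by simp
    ultimately show ?thesis
      using equivalent[of k] unfolding V' ts'_eq k'_eq by blast
  qed
qed

section \<open>The algorithm runs in polynomial time\<close>

lemma ptime_comp2:
  assumes "ptime (\<lambda>c. f (fst c) (snd c))" "ptime g" "ptime h"
  shows "ptime (\<lambda>x. f (g x) (h x))"
  using ptime_comp[OF assms(1) ptime_Pair[OF assms(2,3)]] by simp

lemmas ptime_basic = ptime_id ptime_const ptime_fst ptime_snd ptime_Pair ptime_Cons ptime_if
  ptime_not ptime_conj ptime_disj ptime_eq ptime_mem ptime_append

lemma ptime_rel:
  assumes "ptime ts" "ptime a" "ptime b" "ptime c"
  shows "ptime (\<lambda>x. rel (ts x) (a x) (b x) (c x))"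
  unfolding rel_def by (intro ptime_basic assms)

lemma ptime_forces:
  assumes "ptime ts" "ptime a" "ptime b" "ptime c" "ptime d"
  shows "ptime (\<lambda>x. forces (rel (ts x)) (a x) (b x) (c x) (d x))"
  unfolding forces_def by (intro ptime_basic ptime_rel assms)

lemma ptime_branch_trans:
  assumes "ptime ts" "ptime a" "ptime b" "ptime c" "ptime d"
  shows "ptime (\<lambda>x. branch_trans (rel (ts x)) (a x) (b x) (c x) (d x))"
  unfolding branch_trans_def branch_le_def imp_conv_disj
  by (intro ptime_basic ptime_rel assms)

text \<open>The closure rules handle projections, so pattern matching on tuples is rewritten into
  them here and in the similar lemmas below.\<close>

lemma conflict_fst_snd:
  "conflict ts U q \<longleftrightarrow> (fst q \<noteq> fst (snd q) \<and> fst q \<noteq> fst (snd (snd q)) \<and> fst q \<noteq> snd (snd (snd q)) \<and>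
     fst (snd q) \<noteq> fst (snd (snd q)) \<and> fst (snd q) \<noteq> snd (snd (snd q)) \<and>
     fst (snd (snd q)) \<noteq> snd (snd (snd q))) \<and> fst q \<notin> set U \<and>
     (\<not> branch_trans (rel ts) (fst q) (fst (snd q)) (fst (snd (snd q))) (snd (snd (snd q))) \<or>
      \<not> (fst (snd q) \<in> set U \<and> fst (snd (snd q)) \<in> set U \<and> snd (snd (snd q)) \<in> set U) \<and>
      forces (rel ts) (fst q) (fst (snd q)) (fst (snd (snd q))) (snd (snd (snd q))) \<and>
      \<not> rel ts (fst (snd q)) (fst (snd (snd q))) (snd (snd (snd q))))"
  by (cases q) auto

lemma ptime_conflict:
  assumes "ptime ts" "ptime U" "ptime q"
  shows "ptime (\<lambda>x. conflict (ts x) (U x) (q x))"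
  unfolding conflict_fst_snd
  by (intro ptime_basic ptime_rel ptime_forces ptime_branch_trans assms)

lemma pack_step_fst_snd:
  "pack_step ts q A =
     (if conflict ts (fst A) q
      then (fst q # fst (snd q) # fst (snd (snd q)) # snd (snd (snd q)) # fst A, fst q # snd A) else A)"
  by (cases q; cases A) (simp del: conflict.simps)

lemma ptime_pack:
  assumes "ptime (vs :: 'e::enc \<Rightarrow> 'a::enc list)" "ptime ts"
  shows "ptime (\<lambda>x. pack (vs x) (ts x))"
proof -
  let ?l = "\<lambda>x. List.product (vs x) (List.product (vs x) (List.product (vs x) (vs x)))"
  have l: "ptime ?l" by (intro ptime_product assms)
  obtain p where p: "\<And>x. sz (?l x) \<le> poly p (sz x)" using l ptime_sz by blast
  show ?thesis
    unfolding pack_def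
  proof (rule ptime_fold_growth[OF l ptime_const])
    show "ptime (\<lambda>c :: 'e \<times> ('a \<times> 'a \<times> 'a \<times> 'a) \<times> 'a list \<times> 'a list.
        pack_step (ts (fst c)) (fst (snd c)) (snd (snd c)))"
      unfolding pack_step_fst_snd
      by (intro ptime_basic ptime_conflict ptime_comp[OF assms(2)])
    fix x q and A :: "'a list \<times> 'a list"
    assume "q \<in> set (?l x)"
    then have "sz q \<le> poly p (sz x)" using sz_mem p[of x] by fastforce
    \<comment> \<open>Five cons cells are added, together with the four leaves of \<open>q\<close>
      and a second copy of the first.\<close>
    moreover have "sz (pack_step (ts x) q A) \<le> sz A + (2 * sz q + 5)"
      unfolding pack_step_fst_snd by (cases q; cases A) (simp add: enc_prod)
    ultimately show "sz (pack_step (ts x) q A) \<le> sz A + poly (2 * p + 5) (sz x)"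
      by simp
  qed
qed

lemma refutes_fst_snd:
  "refutes ts w q \<longleftrightarrow> forces (rel ts) w (fst q) (snd (snd q)) (fst (snd q)) \<or>
     forces (rel ts) w (fst (snd q)) (snd (snd q)) (fst q)"
  by (cases q) simp

lemma ptime_refutes:
  assumes "ptime ts" "ptime w" "ptime q"
  shows "ptime (\<lambda>x. refutes (ts x) (w x) (q x))"
  unfolding refutes_fst_snd by (intro ptime_basic ptime_forces assms)

lemma ptime_certifiers:
  assumes "ptime vs" "ptime ts" "ptime q"
  shows "ptime (\<lambda>x. certifiers (vs x) (ts x) (q x))"
  unfolding certifiers_def
  by (intro ptime_filter ptime_basic ptime_refutes ptime_pack assms ptime_comp[OF assms(1)]
      ptime_comp[OF assms(2)] ptime_comp[OF assms(3)])

lemma ptime_sort_by_length: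
  fixes N :: "'e::enc \<Rightarrow> 'q::enc \<Rightarrow> 'a::enc list" and vs :: "'e \<Rightarrow> 'b::enc list"
  assumes N: "ptime (\<lambda>c. N (fst c) (snd c))" and "ptime vs" "ptime qs"
  shows "ptime (\<lambda>x. sort_by_length (N x) (vs x) (qs x))"
proof -
  obtain p where p: "\<And>x. sz (qs x) \<le> poly p (sz x)" using assms(3) ptime_sz by blast
  show ?thesis
    unfolding sort_by_length_def
  proof (intro ptime_snd ptime_fold_growth[OF assms(2) ptime_const])
    show "ptime (\<lambda>c :: 'e \<times> 'b \<times> bool list \<times> 'q list. (False # fst (snd (snd c)),
        snd (snd (snd c)) @
          filter (\<lambda>q. length (N (fst c) q) = length (fst (snd (snd c)))) (qs (fst c))))"
      by (intro ptime_basic ptime_filter ptime_length_eq ptime_comp2[OF N] ptime_comp[OF assms(3)])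
    fix x y and A :: "bool list \<times> 'q list"
    have "sz (filter (\<lambda>q. length (N x q) = length (fst A)) (qs x)) \<le> poly p (sz x)"
      using sz_filter p le_trans by blast
    then show "sz (False # fst A, snd A @ filter (\<lambda>q. length (N x q) = length (fst A)) (qs x))
        \<le> sz A + poly (p + 1) (sz x)"
      by (cases A) (simp add: sz_append enc_bool data_of_bool_def)
  qed
qed

lemma ptime_match:
  fixes N :: "'e::enc \<Rightarrow> 'q::enc \<Rightarrow> 'a::enc list"
  assumes N: "ptime (\<lambda>c. N (fst c) (snd c))" and qs: "ptime qs"
  shows "ptime (\<lambda>x. fold (match_step (N x)) (qs x) ([], []))"
proof -
  obtain p where p: "\<And>c. sz (N (fst c) (snd c)) \<le> poly p (sz c)" using N ptime_sz by blast
  obtain q where q: "\<And>x. sz (qs x) \<le> poly q (sz x)" using qs ptime_sz by blast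
  show ?thesis
  proof (rule ptime_fold_growth[OF qs ptime_const])
    show "ptime (\<lambda>c :: 'e \<times> 'q \<times> 'a list \<times> 'a list. match_step (N (fst c)) (fst (snd c)) (snd (snd c)))"
      unfolding match_step_def
      by (intro ptime_case_list ptime_filter ptime_basic ptime_comp2[OF N])
    fix x y and A :: "'a list \<times> 'a list"
    assume "y \<in> set (qs x)"
    then have "sz y \<le> poly q (sz x)" using sz_mem q[of x] by fastforce
    then have "sz (x, y) \<le> sz x + poly q (sz x) + 1" by simp
    then have N': "sz (N x y) \<le> poly p (sz x + poly q (sz x) + 1)"
      using le_trans[OF p[of "(x, y)"] poly_nat_mono] by simp
    have "sz (match_step (N x) y A) \<le> sz A + sz (N x y) + 1"
    proof (cases "filter (\<lambda>w. w \<notin> set (fst A)) (N x y)")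
      case Nil
      then show ?thesis by (cases A) (simp add: match_step_def sz_append)
    next
      case (Cons w ws)
      then have "w \<in> set (N x y)" by (metis filter_is_subset list.set_intros(1) subsetD)
      then have "sz w < sz (N x y)" by (rule sz_mem)
      then show ?thesis using Cons by (cases A) (simp add: match_step_def)
    qed
    then show "sz (match_step (N x) y A) \<le> sz A + poly (pcompose p ([:0, 1:] + q + 1) + 1) (sz x)"
      using N' by (simp add: poly_pcompose)
  qed
qed

lemma ptime_matching:
  assumes "ptime vs" "ptime ts"
  shows "ptime (\<lambda>x. matching (vs x) (ts x))"
  unfolding matching_def
  by (intro ptime_match ptime_sort_by_length ptime_certifiers ptime_comp[OF assms(1)]
      ptime_comp[OF assms(2)] ptime_fst ptime_snd ptime_id assms)

lemma ptime_removable: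
  assumes "ptime vs" "ptime ts"
  shows "ptime (\<lambda>x. removable (vs x) (ts x))"
  unfolding removable_def
  by (intro ptime_filter ptime_basic ptime_pack ptime_matching ptime_comp[OF assms(1)]
      ptime_comp[OF assms(2)] assms)

lemma ptime_flipped:
  assumes "ptime vs" "ptime ts"
  shows "ptime (\<lambda>x. flipped (vs x) (ts x))"
  unfolding flipped_def
  by (intro ptime_filter ptime_bex ptime_refutes ptime_removable ptime_comp[OF assms(1)]
      ptime_comp[OF assms(2)] ptime_fst ptime_snd ptime_id assms)

lemma flip_fst_snd:
  "flip ts W q =
     (if \<exists>w\<in>W. forces (rel ts) w (fst q) (snd (snd q)) (fst (snd q))
      then (fst q, snd (snd q), fst (snd q))
      else if \<exists>w\<in>W. forces (rel ts) w (fst (snd q)) (snd (snd q)) (fst q)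
      then (fst (snd q), snd (snd q), fst q) else q)"
  by (cases q) simp

lemma ptime_flip:
  assumes "ptime ts" "ptime W" "ptime q"
  shows "ptime (\<lambda>x. flip (ts x) (set (W x)) (q x))"
  unfolding flip_fst_snd
  by (intro ptime_basic ptime_bex ptime_forces ptime_comp[OF assms(1)] ptime_comp[OF assms(3)] assms)

lemma leaves_disjoint_fst_snd:
  "leaves q \<inter> W = {} \<longleftrightarrow> fst q \<notin> W \<and> fst (snd q) \<notin> W \<and> snd (snd q) \<notin> W"
  by (cases q) auto

lemma ptime_kernel: "ptime (kernel :: 'a::enc list \<times> ('a \<times> 'a \<times> 'a) list \<times> int \<Rightarrow> _)"
  unfolding kernel_def case_prod_beta' leaves_disjoint_fst_snd
  by (intro ptime_basic ptime_int_neg ptime_length_le ptime_nat_abs ptime_int_of_nat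
      ptime_diff_length ptime_filter ptime_map ptime_pack ptime_matching ptime_removable
      ptime_flipped ptime_flip)

text \<open>The encoded dense instances are exactly the values \<open>enc (vs, ts, k)\<close> of
  well-formed lists. One equivalence thus serves to decode the input and to validate the
  output.\<close>

lemma encodes_iff:
  "encodes x V R k \<and> dense_rti_instance V R k \<longleftrightarrow>
    (\<exists>vs ts. distinct vs \<and> set vs = V \<and> triplet_list V ts \<and> R = triplet_of ` set ts \<and>
       x = enc (vs, ts, k))"
proof -
  have "data_of_triple = enc"
    by (rule ext) (auto simp: enc_nat)
  then have e: "enc (vs, ts, k) = DCons (data_of_list data_of_nat vs)
      (DCons (data_of_list data_of_triple ts) (data_of_int k))" for vs ts
    by (simp add: enc_list enc_nat enc_int)
  show ?thesis
  proof
    assume "encodes x V R k \<and> dense_rti_instance V R k"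
    then have "dense_triplets V R" and "encodes x V R k"
      unfolding dense_rti_instance_def by blast+
    from this(2) obtain vs ts where *: "distinct vs" "set vs = V" "distinct (map triplet_of ts)"
      "set (map triplet_of ts) = R" "x = enc (vs, ts, k)"
      unfolding encodes_def Let_def e[symmetric] by (elim exE conjE) (rule that)
    with \<open>dense_triplets V R\<close> have "triplet_list V ts" using dense_triplets_iff[OF *(3)] by simp
    then show "\<exists>vs ts. distinct vs \<and> set vs = V \<and> triplet_list V ts \<and> R = triplet_of ` set ts \<and>
       x = enc (vs, ts, k)" using * by (intro exI[of _ vs] exI[of _ ts]) auto
  next
    assume "\<exists>vs ts. distinct vs \<and> set vs = V \<and> triplet_list V ts \<and> R = triplet_of ` set ts \<and>
       x = enc (vs, ts, k)"
    then obtain vs ts where *: "distinct vs" "set vs = V" "triplet_list V ts" "R = triplet_of ` set ts"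
      "x = enc (vs, ts, k)" by blast
    note d = triplet_list_distinct_map[OF *(3)]
    have "dense_triplets V R" using dense_triplets_iff[OF d] * by simp
    moreover have "set (map triplet_of ts) = R" using * by simp
    moreover have "finite V" using *(2) by auto
    ultimately show "encodes x V R k \<and> dense_rti_instance V R k"
      unfolding encodes_def dense_rti_instance_def Let_def e[symmetric] using *(1,2,5) d
      by (intro conjI exI[of _ vs] exI[of _ ts])
  qed
qed

theorem theorem2:
  shows "\<exists>(A :: prog) (p :: nat poly).
    \<forall>(V :: nat set) (R :: nat rtree set) (k :: int) (x :: data).
      dense_rti_instance V R k \<and> encodes x V R k \<longrightarrow>
      (\<exists>t y V' R' k'.
         exec A x t y \<and> t \<le> poly p (size x) \<and>
         encodes y V' R' k' \<and> dense_rti_instance V' R' k' \<and>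
         (dense_rti_yes V' R' k' \<longleftrightarrow> dense_rti_yes V R k) \<and>
         k' \<le> k \<and> int (card V') \<le> 5 * max 0 k)"
proof -
  \<comment> \<open>Program and polynomial are fixed before any instance is given:
    \<open>kernel\<close> is total on triples of lists and parameter, well-formed or not, and its
    correctness is invoked only for instances.\<close>
  obtain A p where A: "\<And>i :: nat list \<times> (nat \<times> nat \<times> nat) list \<times> int.
      \<exists>t. exec A (enc i) t (enc (kernel i)) \<and> t \<le> poly p (sz i)"
    using ptime_kernel by (rule ptimeE) blast
  show ?thesis
  proof (intro exI[of _ A] exI[of _ p] allI impI)
    fix V :: "nat set" and R k x
    assume "dense_rti_instance V R k \<and> encodes x V R k"
    then have "encodes x V R k \<and> dense_rti_instance V R k" by (rule conjE) (rule conjI)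
    then obtain vs ts where i: "distinct vs" "set vs = V" "triplet_list V ts" "R = triplet_of ` set ts"
      "x = enc (vs, ts, k)"
      unfolding encodes_iff by (elim exE conjE) (rule that)
    obtain vs' ts' k' where ker: "kernel (vs, ts, k) = (vs', ts', k')" by (metis prod_cases3)
    obtain t where t: "exec A x t (enc (vs', ts', k'))" "t \<le> poly p (size x)"
      using A[of "(vs, ts, k)"] ker i(5) by auto
    have *: "distinct vs'" "triplet_list (set vs') ts'"
      "(\<exists>T. tree_over (set vs') T \<and> int (card (wrong ts' T)) \<le> k') \<longleftrightarrow>
       (\<exists>T. tree_over V T \<and> int (card (wrong ts T)) \<le> k)"
      "k' \<le> k" "int (card (set vs')) \<le> 5 * max 0 k"
      using kernel_correct[OF i(1) _ ker] i(2,3) by auto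
    have "encodes (enc (vs', ts', k')) (set vs') (triplet_of ` set ts') k' \<and>
        dense_rti_instance (set vs') (triplet_of ` set ts') k'"
      unfolding encodes_iff using *(1,2) by blast
    moreover have "dense_rti_yes (set vs') (triplet_of ` set ts') k' \<longleftrightarrow> dense_rti_yes V R k"
      unfolding i(4) dense_rti_yes_iff[OF *(2)] dense_rti_yes_iff[OF i(3)] by (rule *(3))
    ultimately show "\<exists>t y V' R' k'. exec A x t y \<and> t \<le> poly p (size x) \<and>
         encodes y V' R' k' \<and> dense_rti_instance V' R' k' \<and>
         (dense_rti_yes V' R' k' \<longleftrightarrow> dense_rti_yes V R k) \<and>
         k' \<le> k \<and> int (card V') \<le> 5 * max 0 k"
      using t *(4,5) by blast
  qed
qed

end
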